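(* Let $\Sigma$ be a finite alphabet, let $h:\Sigma^*\to\Sigma^*$ be a nonerasing morphism prolongable on $w_0$, and let $\mathbf w=w_0w_1w_2\cdots=h^\omega(w_0)$. Let $\Delta\subsetneq\Sigma$ be a nonempty subalphabet such that $\mathbf w$ contains infinitely many letters of $\overline{\Delta}=\Sigma\setminus\Delta$ and $\Delta$-blocks of unbounded length. For $k\ge0$ let $(i_k,j_k)$ denote the starting and ending positions of the $k$-th maximal $\Delta$-block in $\mathbf w$. Then $\limsup_{k\to\infty}j_k/i_k$ is an algebraic number of degree at most $|\Sigma|$. If moreover $h$ is uniform, then $\limsup_{k\to\infty}j_k/i_k$ is rational.
   Context: Positions are indexed from $0$. A morphism is nonerasing if $h(c)\neq\epsilon$ for every letter $c$; it is uniform if $|h(c)|$ is the same for all letters; it is prolongable on $a$ if $h(a)=ax$ with $x$ nonempty (and $h^n(x)$ nonempty for all $n$), in which case $h^\omega(a)=a\,x\,h(x)h^2(x)\cdots$ is its infinite fixed point. A factor $w_i\cdots w_j$ ($i\le j$) of $\mathbf w$ is a $\Delta$-block if all its letters lie in $\Delta$; it is a maximal $\Delta$-block if moreover $w_{j+1}\in\overline\Delta$ and either $i=0$ or $w_{i-1}\in\overline\Delta$. Maximal $\Delta$-blocks are enumerated in increasing order of position. *)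

theory Defs
  imports "HOL-Computational_Algebra.Polynomial" "HOL-Library.Liminf_Limsup"
          "HOL-Library.Infinite_Set" "HOL-Library.Extended_Real"
begin

definition morph :: "('a \<Rightarrow> 'a list) \<Rightarrow> 'a list \<Rightarrow> 'a list" where
  "morph h xs = concat (map h xs)"

definition morph_pow :: "('a \<Rightarrow> 'a list) \<Rightarrow> nat \<Rightarrow> 'a list \<Rightarrow> 'a list" where
  "morph_pow h n = (morph h ^^ n)"

definition nonerasing :: "('a \<Rightarrow> 'a list) \<Rightarrow> bool" where
  "nonerasing h \<longleftrightarrow> (\<forall>c. h c \<noteq> [])"

definition uniform_morph :: "('a \<Rightarrow> 'a list) \<Rightarrow> bool" where
  "uniform_morph h \<longleftrightarrow> (\<exists>l. \<forall>c. length (h c) = l)"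

definition prolongable :: "('a \<Rightarrow> 'a list) \<Rightarrow> 'a \<Rightarrow> bool" where
  "prolongable h a \<longleftrightarrow> (\<exists>x. h a = a # x \<and> x \<noteq> [] \<and> (\<forall>n. morph_pow h n x \<noteq> []))"

text \<open>The infinite fixed point h^omega(a), as a function from positions (indexed from 0)
  to letters. When h is prolongable on a, h^m(a) is a prefix of h^(m+1)(a) and
  |h^(n+1)(a)| > n, so position n is read off from h^(n+1)(a).\<close>
definition fixpt :: "('a \<Rightarrow> 'a list) \<Rightarrow> 'a \<Rightarrow> nat \<Rightarrow> 'a" where
  "fixpt h a n = morph_pow h (Suc n) [a] ! n"

definition block_starts :: "(nat \<Rightarrow> 'a) \<Rightarrow> 'a set \<Rightarrow> nat set" where
  "block_starts w D = {i. w i \<in> D \<and> (i = 0 \<or> w (i - 1) \<notin> D)}"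

definition block_start :: "(nat \<Rightarrow> 'a) \<Rightarrow> 'a set \<Rightarrow> nat \<Rightarrow> nat" where
  "block_start w D k = enumerate (block_starts w D) k"

text \<open>End position j_k: the least j \<ge> i_k with w_(j+1) not in Delta
  (then all of w_(i_k) .. w_j lie in Delta).\<close>
definition block_end :: "(nat \<Rightarrow> 'a) \<Rightarrow> 'a set \<Rightarrow> nat \<Rightarrow> nat" where
  "block_end w D k = (LEAST j. block_start w D k \<le> j \<and> w (Suc j) \<notin> D)"

definition algebraic_deg_le :: "real \<Rightarrow> nat \<Rightarrow> bool" where
  "algebraic_deg_le x n \<longleftrightarrow>
     (\<exists>p. (\<forall>i. coeff p i \<in> \<int>) \<and> p \<noteq> 0 \<and> degree p \<le> n \<and> poly p x = 0)"

end

theory Submission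
  imports Defs "HOL-Computational_Algebra.Fundamental_Theorem_Algebra"
begin

text \<open>
  Replace \<open>h\<close> by a power \<open>g\<close> for which the relation ``\<open>d\<close> occurs in \<open>g c\<close>'' is idempotent, and let
  \<open>Y\<close> be the set of letters \<open>c\<close> such that \<open>g c\<close> contains a letter outside \<open>\<Delta>\<close>; then \<open>c \<in> Y\<close> iff \<open>g c\<close>
  contains a letter of \<open>Y\<close>. Call two consecutive occurrences of letters of \<open>Y\<close> a gap. As the word is
  fixed by \<open>g\<close>, every gap is interior to the image of a single letter or the image of an earlier gap,
  and the length of an image depends only on the factor spanning the gap. So every gap is a copy,
  further to the right, of an iterate of one of finitely many gaps, and the limit superior is
  governed by the iterates of these. The same holds for the \<open>\<Delta>\<close>-blocks, which are one more image away.

  The end points of an iterated gap are lengths of iterated images under a morphism on an enlarged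
  alphabet. Along residue classes modulo a suitable \<open>m\<close> such lengths are asymptotic to
  \<open>c n\<^sup>k \<Lambda>\<^sup>n\<close> with a common \<open>k\<close> and \<open>\<Lambda>\<close> (a form of the Perron-Frobenius theorem), and \<open>\<Lambda>\<close> is a
  root of a rational polynomial of degree at most \<open>|\<Sigma>|\<close>. Their generating functions are rational, and
  comparing them at the singularity \<open>1 / \<Lambda>\<close> shows that the limits of the quotients lie in
  \<open>\<rat>(\<Lambda>)\<close>. In the uniform case \<open>\<Lambda>\<close> is an integer.
\<close>

section \<open>Linear recurrences with a dominant root\<close>

text \<open>The complement of \<Delta> itself cannot be iterated: the image of a letter outside
  \<Delta> may lie inside \<Delta>, and conversely. This is what \<open>Y\<close> repairs. The
  quotient j / i of a block is 1 + (j - i) / i. Among the copies of a factor the leftmost therefore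
  has the largest quotient, and gaps of bounded length contribute only the value 1; so the limit
  superior is a maximum of finitely many limits, one for each base gap and residue class. Residue
  classes are unavoidable: the incidence matrix may have several eigenvalues of maximal modulus, and
  lengths then oscillate. A power with idempotent letter sets leaves only a positive one. The
  enlarged alphabet has up to three letters for each letter of \<Sigma>, so a recurrence over it
  gives too large a degree for \<Lambda>. For the degree, \<Lambda> is instead identified as the
  growth rate of the iterated images of \<open>w 0\<close>, which use original letters only. The
  recurrence over the enlarged alphabet only serves to place the quotients of growth constants in
  the field generated by \<Lambda>.\<close>

lemma linear_dependence:
  fixes v :: "'k \<Rightarrow> 'i \<Rightarrow> 'f::field"
  assumes "finite I" "finite K" "card I < card K"
  shows "\<exists>c. (\<exists>k\<in>K. c k \<noteq> 0) \<and> (\<forall>i\<in>I. (\<Sum>k\<in>K. c k * v k i) = 0)"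
  using assms
proof (induction I arbitrary: K v rule: finite_induct)
  case empty
  then have "K \<noteq> {}" by auto
  then show ?case by (intro exI[of _ "\<lambda>_. 1"]) auto
next
  case (insert i0 I)
  show ?case
  proof (cases "\<forall>k\<in>K. v k i0 = 0")
    case True
    have "card I < card K" using insert by auto
    from insert.IH[OF insert.prems(1) this, of v] True show ?thesis by auto
  next
    case False
    then obtain k0 where k0: "k0 \<in> K" "v k0 i0 \<noteq> 0" by auto
    define v' where "v' = (\<lambda>k i. v k i - v k i0 / v k0 i0 * v k0 i)"
    have "card I < card (K - {k0})" using insert k0 by auto
    then obtain c where c: "\<exists>k\<in>K - {k0}. c k \<noteq> 0"
        "\<forall>i\<in>I. (\<Sum>k\<in>K - {k0}. c k * v' k i) = 0"
      using insert.IH[of "K - {k0}" v'] insert.prems by auto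
    \<comment> \<open>The relation among the reduced vectors \<open>v'\<close> is kept; the
      coefficient at the pivot \<open>k0\<close> collects what the elimination subtracted from the
      others.\<close>
    define c' where "c' = c(k0 := - (\<Sum>k\<in>K - {k0}. c k * v k i0) / v k0 i0)"
    have split: "(\<Sum>k\<in>K. c' k * v k i) =
        (\<Sum>k\<in>K - {k0}. c k * v k i) - (\<Sum>k\<in>K - {k0}. c k * v k i0) / v k0 i0 * v k0 i" for i
    proof -
      have "(\<Sum>k\<in>K. c' k * v k i) = c' k0 * v k0 i + (\<Sum>k\<in>K - {k0}. c' k * v k i)"
        using insert.prems k0 by (simp add: sum.remove)
      also have "(\<Sum>k\<in>K - {k0}. c' k * v k i) = (\<Sum>k\<in>K - {k0}. c k * v k i)"
        by (rule sum.cong) (auto simp: c'_def)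
      finally show ?thesis by (simp add: c'_def)
    qed
    have "(\<Sum>k\<in>K. c' k * v k i) = (\<Sum>k\<in>K - {k0}. c k * v' k i)" for i
      unfolding split v'_def
      by (simp add: sum_subtractf right_diff_distrib sum_distrib_right sum_distrib_left sum_divide_distrib mult.assoc)
    moreover have "(\<Sum>k\<in>K. c' k * v k i0) = 0"
      unfolding split using k0 by simp
    ultimately have "\<forall>i\<in>insert i0 I. (\<Sum>k\<in>K. c' k * v k i) = 0" using c by auto
    moreover have "\<exists>k\<in>K. c' k \<noteq> 0" using c by (auto simp: c'_def)
    ultimately show ?thesis by blast
  qed
qed

lemma common_denominator:
  fixes c :: "'k \<Rightarrow> rat"
  assumes "finite K"
  shows "\<exists>d::int. d > 0 \<and> (\<forall>k\<in>K. of_int d * c k \<in> \<int>)"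
  using assms
proof (induction K rule: finite_induct)
  case empty then show ?case by (intro exI[of _ 1]) auto
next
  case (insert x K)
  then obtain d where d: "d > 0" "\<forall>k\<in>K. of_int d * c k \<in> \<int>" by auto
  obtain p q where pq: "quotient_of (c x) = (p, q)" by fastforce
  have q: "q > 0" using quotient_of_denom_pos[OF pq] .
  have cx: "c x = of_int p / of_int q" using quotient_of_div[OF pq] .
  have "of_int (d * q) * c x = (of_int (d * p) :: rat)" using q cx by simp
  then have 1: "of_int (d * q) * c x \<in> \<int>" by (metis Ints_of_int)
  have 2: "of_int (d * q) * c k \<in> \<int>" if "k \<in> K" for k
  proof -
    have "of_int (d * q) * c k = of_int q * (of_int d * c k)" by simp
    then show ?thesis using d that by (metis Ints_mult Ints_of_int)
  qed
  show ?case using 1 2 d q by (intro exI[of _ "d * q"]) auto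
qed

text \<open>The polynomial \<open>p\<close> with the shift of sequences put for its variable. A
  factor \<open>[:- m, 1:]\<close> becomes a first-order difference operator, so a recurrence can be
  solved one root at a time.\<close>

definition shift_op :: "'a::comm_ring_1 poly \<Rightarrow> (nat \<Rightarrow> 'a) \<Rightarrow> nat \<Rightarrow> 'a" where
  "shift_op p u n = (\<Sum>i\<le>degree p. coeff p i * u (n + i))"

lemma shift_op_bound:
  assumes "degree p \<le> N"
  shows "shift_op p u n = (\<Sum>i\<le>N. coeff p i * u (n + i))"
  unfolding shift_op_def using assms
  by (intro sum.mono_neutral_left) (auto simp: coeff_eq_0)

lemma shift_op_linear_factor:
  "shift_op ([:- m, 1:] * q) u n = shift_op q u (Suc n) - m * shift_op q u n"
proof -
  let ?N = "degree q"
  have c: "coeff ([:- m, 1:] * q) i = (case i of 0 \<Rightarrow> 0 | Suc j \<Rightarrow> coeff q j) - m * coeff q i" for i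
    by (simp add: coeff_pCons split: nat.split)
  have "degree ([:- m, 1:] * q) \<le> Suc ?N"
    using degree_mult_le[of "[:- m, 1:]" q] by simp
  then have "shift_op ([:- m, 1:] * q) u n = (\<Sum>i\<le>Suc ?N. coeff ([:- m, 1:] * q) i * u (n + i))"
    by (rule shift_op_bound)
  also have "\<dots> = (\<Sum>i\<le>Suc ?N. (case i of 0 \<Rightarrow> 0 | Suc j \<Rightarrow> coeff q j) * u (n + i))
      - m * (\<Sum>i\<le>Suc ?N. coeff q i * u (n + i))"
    unfolding c by (simp only: left_diff_distrib sum_subtractf sum_distrib_left mult.assoc)
  also have "(\<Sum>i\<le>Suc ?N. (case i of 0 \<Rightarrow> 0 | Suc j \<Rightarrow> coeff q j) * u (n + i)) = shift_op q u (Suc n)"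
    by (subst sum.atMost_Suc_shift) (simp add: shift_op_def)
  also have "(\<Sum>i\<le>Suc ?N. coeff q i * u (n + i)) = shift_op q u n"
    using shift_op_bound[of q "Suc ?N" u n] by simp
  finally show ?thesis .
qed

lemma geometric_bound_step:
  fixes u :: "nat \<Rightarrow> complex"
  assumes "norm m < r" "\<And>n. norm (u (Suc n) - m * u n) \<le> C * r ^ n"
  shows "\<exists>C'. \<forall>n. norm (u n) \<le> C' * r ^ n"
proof -
  \<comment> \<open>The second entry lets \<open>C'\<close> absorb the forcing term, since then |m|
    C' + C is at most r C'; the first starts the induction.\<close>
  define C' where "C' = max (norm (u 0)) (C / (r - norm m))"
  have r: "r > 0" using assms(1) norm_ge_zero[of m] by linarith
  have "C / (r - norm m) \<le> C'" by (simp add: C'_def)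
  then have C: "C \<le> C' * (r - norm m)" using assms(1) by (simp add: field_simps)
  have "norm (u n) \<le> C' * r ^ n" for n
  proof (induction n)
    case 0 then show ?case by (simp add: C'_def)
  next
    case (Suc n)
    have "norm (u (Suc n)) \<le> norm (m * u n) + norm (u (Suc n) - m * u n)"
      by (metis add.commute diff_add_cancel norm_triangle_ineq)
    also have "\<dots> \<le> norm m * (C' * r ^ n) + C * r ^ n"
      using Suc assms(2)[of n] by (intro add_mono) (auto simp: norm_mult mult_left_mono)
    also have "\<dots> \<le> norm m * (C' * r ^ n) + C' * (r - norm m) * r ^ n"
      using C r by (simp add: mult_right_mono)
    also have "\<dots> = C' * r ^ Suc n" by (simp add: algebra_simps)
    finally show ?case .
  qed
  then show ?thesis by blast
qed

lemma linear_factor: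
  fixes q :: "complex poly"
  assumes "degree q > 0"
  obtains m q' where "q = [:- m, 1:] * q'" "poly q m = 0" "degree q = Suc (degree q')"
proof -
  have "\<not> constant (poly q)" using assms by (simp add: constant_degree)
  then obtain m where m: "poly q m = 0" using fundamental_theorem_of_algebra by blast
  then obtain q' where q': "q = [:- m, 1:] * q'" by (auto simp: poly_eq_0_iff_dvd)
  have "q' \<noteq> 0" using assms q' by auto
  then have "degree q = Suc (degree q')" unfolding q' by (subst degree_mult_eq) auto
  then show ?thesis using that q' m by blast
qed

text \<open>Splitting off a root \<open>m\<close> writes \<open>shift_op q u\<close> as a
  first-order difference of \<open>shift_op q' u\<close>, so the bound descends to the cofactor
  \<open>q'\<close> of smaller degree and finally to \<open>u\<close>.\<close>

lemma shift_op_geometric_bound: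
  fixes q :: "complex poly"
  assumes "q \<noteq> 0" "\<And>m. poly q m = 0 \<Longrightarrow> norm m < r"
    "\<And>n. norm (shift_op q u n) \<le> C * r ^ n"
  shows "\<exists>C. \<forall>n. norm (u n) \<le> C * r ^ n"
  using assms
proof (induction "degree q" arbitrary: q C)
  case 0
  then obtain c where c: "q = [:c:]" "c \<noteq> 0" by (metis degree_eq_zeroE pCons_eq_0_iff)
  have "norm (u n) \<le> C / norm c * r ^ n" for n
    using 0(4)[of n] c by (simp add: shift_op_def norm_mult field_simps)
  then show ?case by blast
next
  case (Suc d)
  then obtain m q' where q': "q = [:- m, 1:] * q'" "poly q m = 0" "degree q = Suc (degree q')"
    by (metis linear_factor zero_less_Suc)
  have "\<exists>C. \<forall>n. norm (shift_op q' u n) \<le> C * r ^ n"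
    by (rule geometric_bound_step[of m])
      (use Suc.prems q' in \<open>auto simp: shift_op_linear_factor[symmetric]\<close>)
  then obtain C' where "\<And>n. norm (shift_op q' u n) \<le> C' * r ^ n" by blast
  moreover have "q' \<noteq> 0" using Suc.prems q' by auto
  ultimately show ?case
    using Suc.hyps(1)[of q' C'] Suc.hyps(2) q' Suc.prems(2) by auto
qed

text \<open>The polynomial functions of \<open>n\<close>. In the binomial basis the forward
  difference sends each basis element to its predecessor, so first-order equations can be solved
  explicitly.\<close>

definition binomial_sum :: "(nat \<Rightarrow> complex) \<Rightarrow> bool" where
  "binomial_sum f \<longleftrightarrow> (\<exists>K a. \<forall>n. f n = (\<Sum>k<K. a k * of_nat (n choose k)))"

lemma binomial_sumI:
  "(\<And>n. f n = (\<Sum>k<K. a k * of_nat (n choose k))) \<Longrightarrow> binomial_sum f"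
  unfolding binomial_sum_def by blast

lemma binomial_sum_add:
  assumes "binomial_sum f" "binomial_sum g"
  shows "binomial_sum (\<lambda>n. f n + g n)"
proof -
  obtain K a where a: "\<forall>n. f n = (\<Sum>k<K. a k * of_nat (n choose k))"
    using assms by (auto simp: binomial_sum_def)
  obtain L b where b: "\<forall>n. g n = (\<Sum>k<L. b k * of_nat (n choose k))"
    using assms by (auto simp: binomial_sum_def)
  have A: "f n = (\<Sum>k<max K L. (if k < K then a k else 0) * of_nat (n choose k))" for n
    unfolding a[rule_format] by (rule sum.mono_neutral_cong_left) auto
  have B: "g n = (\<Sum>k<max K L. (if k < L then b k else 0) * of_nat (n choose k))" for n
    unfolding b[rule_format] by (rule sum.mono_neutral_cong_left) auto
  have "f n + g n = (\<Sum>k<max K L. ((if k < K then a k else 0) + (if k < L then b k else 0)) * of_nat (n choose k))" for n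
    unfolding A B by (simp only: sum.distrib[symmetric] distrib_right)
  then show ?thesis by (rule binomial_sumI)
qed

lemma binomial_sum_cmult:
  assumes "binomial_sum f"
  shows "binomial_sum (\<lambda>n. c * f n)"
proof -
  obtain K a where a: "\<forall>n. f n = (\<Sum>k<K. a k * of_nat (n choose k))"
    using assms by (auto simp: binomial_sum_def)
  have "c * f n = (\<Sum>k<K. (c * a k) * of_nat (n choose k))" for n
    by (simp add: a sum_distrib_left mult.assoc)
  then show ?thesis by (rule binomial_sumI)
qed

lemma binomial_sum_choose: "binomial_sum (\<lambda>n. of_nat (n choose k))"
proof -
  have "of_nat (n choose k) = (\<Sum>j<Suc k. (if j = k then 1 else 0) * of_nat (n choose j) :: complex)" for n
    by (simp add: sum.delta)
  then show ?thesis by (rule binomial_sumI)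
qed

lemma binomial_sum_solve_choose:
  assumes "\<alpha> \<noteq> 0"
  shows "\<exists>g. binomial_sum g \<and> (\<forall>n. \<alpha> * g (Suc n) - \<beta> * g n = of_nat (n choose k))"
proof (cases "\<alpha> = \<beta>")
  case True
  \<comment> \<open>The resonant case: Pascal's rule makes \<open>n choose Suc k\<close> an
    antidifference of \<open>n choose k\<close>, and the degree rises by one.\<close>
  show ?thesis
    by (intro exI[of _ "\<lambda>n. (1 / \<alpha>) * of_nat (n choose Suc k)"] conjI binomial_sum_cmult binomial_sum_choose)
      (use True assms in \<open>auto simp: field_simps\<close>)
next
  case False
  show ?thesis
  proof (induction k)
    case 0
    show ?case
      by (intro exI[of _ "\<lambda>n. (1 / (\<alpha> - \<beta>)) * of_nat (n choose 0)"] conjI binomial_sum_cmult binomial_sum_choose)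
        (use False in \<open>simp add: diff_divide_distrib[symmetric]\<close>)
  next
    case (Suc k)
    then obtain g where g: "binomial_sum g" "\<And>n. \<alpha> * g (Suc n) - \<beta> * g n = of_nat (n choose k)" by blast
    \<comment> \<open>Applied to \<open>n choose Suc k\<close>, the operator yields (\<alpha> -
      \<beta>) times the same binomial plus \<alpha> times \<open>n choose k\<close>; the solution
      \<open>g\<close> for \<open>k\<close> cancels the second term.\<close>
    define g' where "g' = (\<lambda>n. (1 / (\<alpha> - \<beta>)) * (of_nat (n choose Suc k) + (- \<alpha>) * g n))"
    have "binomial_sum g'"
      unfolding g'_def by (intro binomial_sum_cmult binomial_sum_add binomial_sum_choose g)
    moreover have "\<alpha> * g' (Suc n) - \<beta> * g' n = of_nat (n choose Suc k)" for n
    proof -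
      have e: "(\<alpha> - \<beta>) * g' j = of_nat (j choose Suc k) - \<alpha> * g j" for j
        using False by (simp add: g'_def)
      have "(\<alpha> - \<beta>) * (\<alpha> * g' (Suc n) - \<beta> * g' n) =
          \<alpha> * ((\<alpha> - \<beta>) * g' (Suc n)) - \<beta> * ((\<alpha> - \<beta>) * g' n)"
        by (simp add: algebra_simps)
      also have "\<dots> = \<alpha> * (of_nat (Suc n choose Suc k) - \<alpha> * g (Suc n)) - \<beta> * (of_nat (n choose Suc k) - \<alpha> * g n)"
        unfolding e ..
      also have "\<dots> = (\<alpha> - \<beta>) * of_nat (n choose Suc k) + \<alpha> * of_nat (n choose k)
          - \<alpha> * (\<alpha> * g (Suc n) - \<beta> * g n)"
        by (simp add: algebra_simps)
      also have "\<dots> = (\<alpha> - \<beta>) * of_nat (n choose Suc k)" unfolding g(2) by simp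
      finally show ?thesis using False by simp
    qed
    ultimately show ?case by blast
  qed
qed

lemma binomial_sum_solve:
  assumes "\<alpha> \<noteq> 0" "binomial_sum f"
  shows "\<exists>g. binomial_sum g \<and> (\<forall>n. \<alpha> * g (Suc n) - \<beta> * g n = f n)"
proof -
  obtain K a where a: "\<forall>n. f n = (\<Sum>k<K. a k * of_nat (n choose k))"
    using assms by (auto simp: binomial_sum_def)
  have "\<exists>g. binomial_sum g \<and> (\<forall>n. \<alpha> * g (Suc n) - \<beta> * g n = (\<Sum>k<K. a k * of_nat (n choose k)))"
  proof (induction K)
    case 0
    have "binomial_sum (\<lambda>_. 0)" unfolding binomial_sum_def by (intro exI[of _ 0]) auto
    then show ?case by (intro exI[of _ "\<lambda>_. 0"]) auto
  next
    case (Suc K)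
    then obtain g where g: "binomial_sum g" "\<forall>n. \<alpha> * g (Suc n) - \<beta> * g n = (\<Sum>k<K. a k * of_nat (n choose k))"
      by blast
    obtain g' where g': "binomial_sum g'" "\<forall>n. \<alpha> * g' (Suc n) - \<beta> * g' n = of_nat (n choose K)"
      using binomial_sum_solve_choose[OF assms(1)] by blast
    have "\<alpha> * (g (Suc n) + a K * g' (Suc n)) - \<beta> * (g n + a K * g' n) = (\<Sum>k<Suc K. a k * of_nat (n choose k))" for n
    proof -
      have "\<alpha> * (g (Suc n) + a K * g' (Suc n)) - \<beta> * (g n + a K * g' n)
        = (\<alpha> * g (Suc n) - \<beta> * g n) + a K * (\<alpha> * g' (Suc n) - \<beta> * g' n)" by (simp add: algebra_simps)
      then show ?thesis using g(2) g'(2) by simp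
    qed
    then show ?case
      by (intro exI[of _ "\<lambda>n. g n + a K * g' n"] conjI binomial_sum_add binomial_sum_cmult g(1) g'(1)) auto
  qed
  then show ?thesis using a by auto
qed

text \<open>All contributions of roots of modulus below \<open>\<Lambda>\<close> go into one error
  term of a rate \<open>r\<close> strictly smaller than \<open>\<Lambda>\<close>; the multiplicity
  of the root \<open>\<Lambda>\<close> is reflected in the degree of the polynomial
  \<open>f\<close>.\<close>

definition dominated :: "real \<Rightarrow> (nat \<Rightarrow> complex) \<Rightarrow> bool" where
  "dominated \<Lambda> u \<longleftrightarrow> (\<exists>f r C. binomial_sum f \<and> 0 < r \<and> r < \<Lambda> \<and>
     (\<forall>n. norm (u n - f n * of_real \<Lambda> ^ n) \<le> C * r ^ n))"

lemma dominated_step: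
  assumes "dominated \<Lambda> (\<lambda>n. u (Suc n) - m * u n)" "norm m < \<Lambda> \<or> m = of_real \<Lambda>"
  shows "dominated \<Lambda> u"
proof -
  obtain f r C where f: "binomial_sum f" "0 < r" "r < \<Lambda>"
    "\<And>n. norm (u (Suc n) - m * u n - f n * of_real \<Lambda> ^ n) \<le> C * r ^ n"
    using assms(1) by (auto simp: dominated_def)
  have L: "complex_of_real \<Lambda> \<noteq> 0" using f by auto
  obtain g where g: "binomial_sum g" "\<And>n. of_real \<Lambda> * g (Suc n) - m * g n = f n"
    using binomial_sum_solve[OF L f(1)] by blast
  \<comment> \<open>Subtracting a particular solution for the polynomial part leaves a forcing term
    of rate \<open>r\<close>.\<close>
  define v where "v = (\<lambda>n. u n - g n * of_real \<Lambda> ^ n)"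
  have v: "v (Suc n) - m * v n = u (Suc n) - m * u n - f n * of_real \<Lambda> ^ n" for n
    unfolding v_def g(2)[symmetric] by (simp add: algebra_simps)
  have vb: "norm (v (Suc n) - m * v n) \<le> C * r ^ n" for n unfolding v by (rule f)
  show ?thesis
  proof (cases "norm m < \<Lambda>")
    case True
    obtain r' where r': "max r (norm m) < r'" "r' < \<Lambda>" using True f dense[of "max r (norm m)" \<Lambda>] by auto
    have C0: "C \<ge> 0" using order_trans[OF norm_ge_zero vb[of 0]] by simp
    have "norm (v (Suc n) - m * v n) \<le> C * r' ^ n" for n
      by (rule order_trans[OF vb]) (use C0 f r' in \<open>auto intro!: mult_left_mono power_mono\<close>)
    then obtain C' where "\<forall>n. norm (v n) \<le> C' * r' ^ n"
      using geometric_bound_step[of m r' v C] r' by auto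
    then show ?thesis unfolding dominated_def v_def using g(1) r' f
      by (intro exI[of _ g] exI[of _ r'] exI[of _ C']) auto
  next
    case False
    then have m: "m = of_real \<Lambda>" using assms(2) by simp
    define e where "e = (\<lambda>n. v (Suc n) - m * v n)"
    \<comment> \<open>The equation v (n + 1) = \<Lambda> v n + e n is solved backwards from
      infinity: minus the sum of \<open>T n i\<close> over \<open>i\<close> is a solution, and it
      has the rate \<open>r\<close> of the forcing term.\<close>
    define T where "T = (\<lambda>n i. e (n + i) / of_real \<Lambda> ^ Suc i)"
    have Tb: "norm (T n i) \<le> (C * r ^ n / \<Lambda>) * (r / \<Lambda>) ^ i" for n i
      using vb[of "n + i"] f
      by (simp add: T_def e_def norm_divide norm_power norm_mult field_simps power_add)
    have geo: "(\<lambda>i. (C * r ^ n / \<Lambda>) * (r / \<Lambda>) ^ i) sums ((C * r ^ n / \<Lambda>) * (1 / (1 - r / \<Lambda>)))" for n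
      using f by (intro sums_mult geometric_sums) auto
    have sT: "summable (T n)" for n
      by (rule summable_comparison_test'[OF sums_summable[OF geo[of n]]]) (rule Tb)
    have nT: "norm (suminf (T n)) \<le> (C * r ^ n / \<Lambda>) * (1 / (1 - r / \<Lambda>))" for n
    proof -
      have sn: "summable (\<lambda>i. norm (T n i))"
        by (rule summable_comparison_test'[OF sums_summable[OF geo[of n]]]) (use Tb in auto)
      have "norm (suminf (T n)) \<le> (\<Sum>i. norm (T n i))" by (rule summable_norm[OF sn])
      also have "\<dots> \<le> (\<Sum>i. (C * r ^ n / \<Lambda>) * (r / \<Lambda>) ^ i)"
        by (rule suminf_le[OF Tb sn sums_summable[OF geo]])
      also have "\<dots> = (C * r ^ n / \<Lambda>) * (1 / (1 - r / \<Lambda>))" using geo by (rule sums_unique[symmetric])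
      finally show ?thesis .
    qed
    define w where "w = (\<lambda>n. - suminf (T n))"
    have w: "w (Suc n) - m * w n = e n" for n
    proof -
      have "suminf (T n) = e n / of_real \<Lambda> + (\<Sum>i. T n (Suc i))"
        using suminf_split_head[OF sT[of n]] by (simp add: T_def)
      also have "(\<lambda>i. T n (Suc i)) = (\<lambda>i. T (Suc n) i / of_real \<Lambda>)"
        by (auto simp: T_def)
      also have "(\<Sum>i. T (Suc n) i / of_real \<Lambda>) = suminf (T (Suc n)) / of_real \<Lambda>"
        by (rule suminf_divide[OF sT])
      finally show ?thesis using L by (simp add: w_def m field_simps)
    qed
    have hom: "v n - w n = (v 0 - w 0) * of_real \<Lambda> ^ n" for n
    proof (induction n)
      case (Suc n)
      have "v (Suc n) - w (Suc n) = m * (v n - w n)"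
        using w[of n] by (simp add: e_def algebra_simps)
      then show ?case using Suc m by simp
    qed simp
    define K where "K = C / \<Lambda> * (1 / (1 - r / \<Lambda>))"
    \<comment> \<open>The homogeneous part is a constant times \<Lambda>^n and joins the polynomial
      factor; \<open>n choose 0\<close> is the constant 1 in the binomial basis.\<close>
    define f' where "f' = (\<lambda>n. g n + (v 0 - w 0) * of_nat (n choose 0))"
    have "u n - f' n * of_real \<Lambda> ^ n = w n" for n
      using hom[of n] by (simp add: v_def f'_def algebra_simps)
    then have "norm (u n - f' n * of_real \<Lambda> ^ n) \<le> K * r ^ n" for n
      using nT[of n] by (simp add: w_def K_def mult.commute mult.left_commute)
    moreover have "binomial_sum f'"
      unfolding f'_def by (intro binomial_sum_add binomial_sum_cmult binomial_sum_choose g)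
    ultimately show ?thesis unfolding dominated_def using f by blast
  qed
qed

lemma shift_op_dominated:
  fixes q :: "complex poly"
  assumes "\<Lambda> > 0" "q \<noteq> 0" "\<And>m. poly q m = 0 \<Longrightarrow> norm m < \<Lambda> \<or> m = of_real \<Lambda>"
    "dominated \<Lambda> (shift_op q u)"
  shows "dominated \<Lambda> u"
  using assms(2-)
proof (induction "degree q" arbitrary: q)
  case 0
  then obtain c where c: "q = [:c:]" "c \<noteq> 0" by (metis degree_eq_zeroE pCons_eq_0_iff)
  from 0(4) obtain f r C where f: "binomial_sum f" "0 < r" "r < \<Lambda>"
     "\<And>n. norm (c * u n - f n * of_real \<Lambda> ^ n) \<le> C * r ^ n"
    using c by (auto simp: dominated_def shift_op_def)
  have "norm (u n - (1 / c * f n) * of_real \<Lambda> ^ n) \<le> C / norm c * r ^ n" for n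
  proof -
    have "u n - (1 / c * f n) * of_real \<Lambda> ^ n = (c * u n - f n * of_real \<Lambda> ^ n) / c"
      using c by (simp add: field_simps)
    then show ?thesis using f(4)[of n] c by (simp add: norm_divide divide_right_mono)
  qed
  then show ?case unfolding dominated_def using f binomial_sum_cmult[OF f(1), of "1 / c"] by blast
next
  case (Suc d)
  then obtain m q' where q': "q = [:- m, 1:] * q'" "poly q m = 0" "degree q = Suc (degree q')"
    by (metis linear_factor zero_less_Suc)
  have eq: "shift_op q u = (\<lambda>n. shift_op q' u (Suc n) - m * shift_op q' u n)"
    unfolding q'(1) shift_op_linear_factor ..
  have "dominated \<Lambda> (shift_op q' u)"
    by (rule dominated_step[of _ _ m]) (use Suc.prems q' eq in auto)
  moreover have "q' \<noteq> 0" using Suc.prems q' by auto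
  ultimately show ?case
    using Suc.hyps(1)[of q'] Suc.hyps(2) q' Suc.prems(2) by auto
qed

lemma choose_over_power_tendsto:
  "(\<lambda>n. real (n choose k) / real n ^ k) \<longlonglongrightarrow> 1 / fact k"
proof (induction k)
  case 0 then show ?case by simp
next
  case (Suc k)
  have e: "real (n choose Suc k) / real n ^ Suc k = (real (n choose k) / real n ^ k) * ((1 - real k / real n) / real (Suc k))"
    if "n > k" for n
  proof -
    have "Suc k * (n choose Suc k) = (n - k) * (n choose k)"
      by (metis binomial_absorb_comp binomial_absorption)
    then have "real (Suc k) * real (n choose Suc k) = (real n - real k) * real (n choose k)"
      using that by (metis of_nat_diff of_nat_mult less_imp_le)
    then have x: "real (n choose Suc k) = (real n - real k) * real (n choose k) / real (Suc k)"
      by (metis nonzero_mult_div_cancel_left of_nat_neq_0)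
    have "1 - real k / real n = (real n - real k) / real n"
      using that by (simp add: diff_divide_distrib)
    then show ?thesis unfolding x by (simp del: of_nat_Suc add: mult_ac)
  qed
  have "(\<lambda>n. (real (n choose k) / real n ^ k) * ((1 - real k / real n) / real (Suc k))) \<longlonglongrightarrow> 1 / fact k * ((1 - 0) / real (Suc k))"
    by (intro tendsto_intros Suc lim_const_over_n) auto
  then have "(\<lambda>n. (real (n choose k) / real n ^ k) * ((1 - real k / real n) / real (Suc k))) \<longlonglongrightarrow> 1 / fact (Suc k)"
    by (simp add: mult.commute)
  then show ?case
    by (rule Lim_transform_eventually) (use e in \<open>auto intro!: eventually_mono[OF eventually_gt_at_top[of k]]\<close>)
qed

section \<open>Growth of iterated morphisms\<close>

lemma morph_simps [simp]:
  "morph g [] = []" "morph g (x # u) = g x @ morph g u" "morph g (u @ v) = morph g u @ morph g v"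
  by (simp_all add: morph_def)

lemma morph_pow_0 [simp]: "morph_pow g 0 u = u"
  by (simp add: morph_pow_def)

lemma morph_pow_Suc: "morph_pow g (Suc n) u = morph_pow g n (morph g u)"
  by (simp add: morph_pow_def funpow_swap1)

lemma morph_pow_add: "morph_pow g (m + n) u = morph_pow g m (morph_pow g n u)"
  by (simp add: morph_pow_def funpow_add)

lemma morph_pow_Nil [simp]: "morph_pow g n [] = []"
  by (induction n) (auto simp: morph_pow_Suc)

lemma morph_pow_append [simp]: "morph_pow g n (u @ v) = morph_pow g n u @ morph_pow g n v"
  by (induction n arbitrary: u v) (auto simp: morph_pow_Suc)

lemma morph_pow_conv_letters: "morph_pow g n u = morph (\<lambda>x. morph_pow g n [x]) u"
proof (induction u)
  case (Cons x u)
  then show ?case using morph_pow_append[of g n "[x]" u] by simp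
qed simp

lemma morph_pow_mult: "morph_pow (\<lambda>x. morph_pow g m [x]) n u = morph_pow g (m * n) u"
proof (induction n arbitrary: u)
  case (Suc n)
  then show ?case
    by (simp add: morph_pow_Suc morph_pow_conv_letters[symmetric] morph_pow_add[symmetric] add.commute)
qed simp

lemma sum_list_morph:
  fixes f :: "'i \<Rightarrow> 'b::comm_monoid_add"
  shows "(\<Sum>y\<leftarrow>morph g u. f y) = (\<Sum>x\<leftarrow>u. \<Sum>y\<leftarrow>g x. f y)"
  by (induction u) auto

abbreviation wlen :: "('i \<Rightarrow> 'i list) \<Rightarrow> nat \<Rightarrow> 'i list \<Rightarrow> real" where
  "wlen g n u \<equiv> real (length (morph_pow g n u))"

lemma length_morph_pow: "length (morph_pow g n u) = (\<Sum>x\<leftarrow>u. length (morph_pow g n [x]))"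
  by (subst morph_pow_conv_letters) (simp add: morph_def length_concat comp_def)

lemma wlen_sum: "wlen g n u = (\<Sum>x\<leftarrow>u. wlen g n [x])"
  by (subst length_morph_pow) (induction u; simp)

lemma wlen_add: "wlen g (n + t) u = (\<Sum>x\<leftarrow>morph_pow g t u. wlen g n [x])"
  by (simp add: morph_pow_add wlen_sum[symmetric])

lemma set_morph_pow_closed:
  assumes "\<And>x. x \<in> A \<Longrightarrow> set (g x) \<subseteq> A" "set u \<subseteq> A"
  shows "set (morph_pow g n u) \<subseteq> A"
  using assms(2)
proof (induction n arbitrary: u)
  case (Suc n)
  have "set (morph g u) \<subseteq> A" using assms(1) Suc.prems by (auto simp: morph_def)
  then show ?case using Suc.IH by (simp add: morph_pow_Suc)
qed simp

lemma morph_pow_nonempty: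
  assumes "\<And>x. x \<in> A \<Longrightarrow> set (g x) \<subseteq> A" "\<And>x. x \<in> A \<Longrightarrow> g x \<noteq> []" "set u \<subseteq> A" "u \<noteq> []"
  shows "morph_pow g n u \<noteq> []"
  using assms(3,4)
proof (induction n arbitrary: u)
  case (Suc n)
  have "set (morph g u) \<subseteq> A" using assms(1) Suc.prems by (auto simp: morph_def)
  moreover have "morph g u \<noteq> []" using assms(2) Suc.prems by (auto simp: morph_def neq_Nil_conv)
  ultimately show ?case using Suc.IH by (simp add: morph_pow_Suc)
qed simp

lemma geometric_contradiction:
  fixes r s :: real
  assumes "0 < r" "r < s" "\<And>n. s ^ n \<le> C * r ^ n"
  shows False
proof -
  have "1 < s / r" using assms by simp
  then obtain n where "C < (s / r) ^ n" using real_arch_pow by blast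
  then have "C * r ^ n < s ^ n" using assms by (simp add: power_divide field_simps)
  then show False using assms(3)[of n] by linarith
qed

section \<open>Eigenvectors of the incidence matrix as additive weights of words\<close>

lemma eigenvector_iterate:
  fixes v :: "'i \<Rightarrow> 'b::comm_ring_1"
  assumes "\<And>x. x \<in> A \<Longrightarrow> set (g x) \<subseteq> A" "\<And>x. x \<in> A \<Longrightarrow> (\<Sum>y\<leftarrow>g x. v y) = m * v x"
    "set u \<subseteq> A"
  shows "(\<Sum>y\<leftarrow>morph_pow g n u. v y) = m ^ n * (\<Sum>y\<leftarrow>u. v y)"
  using assms(3)
proof (induction n arbitrary: u)
  case (Suc n)
  have "set (morph g u) \<subseteq> A" using assms(1) Suc.prems by (auto simp: morph_def)
  then have "(\<Sum>y\<leftarrow>morph_pow g (Suc n) u. v y) = m ^ n * (\<Sum>y\<leftarrow>morph g u. v y)"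
    using Suc.IH by (simp add: morph_pow_Suc)
  also have "(\<Sum>y\<leftarrow>morph g u. v y) = (\<Sum>x\<leftarrow>u. m * v x)"
    unfolding sum_list_morph using assms(2) Suc.prems
    by (intro arg_cong[of _ _ sum_list] map_cong) auto
  finally show ?case by (simp add: sum_list_const_mult mult_ac)
qed simp

text \<open>A lower bound of Collatz-Wielandt type: a weight that every letter passes on to its
  image with a factor at least \<open>m\<close> grows at least like m^n.\<close>

lemma subeigenvector_iterate:
  fixes v :: "'i \<Rightarrow> real"
  assumes "\<And>x. x \<in> A \<Longrightarrow> set (g x) \<subseteq> A" "\<And>x. x \<in> A \<Longrightarrow> m * v x \<le> (\<Sum>y\<leftarrow>g x. v y)"
    "set u \<subseteq> A" "m \<ge> 0"
  shows "m ^ n * (\<Sum>y\<leftarrow>u. v y) \<le> (\<Sum>y\<leftarrow>morph_pow g n u. v y)"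
  using assms(3)
proof (induction n arbitrary: u)
  case (Suc n)
  have "set (morph g u) \<subseteq> A" using assms(1) Suc.prems by (auto simp: morph_def)
  then have "m ^ n * (\<Sum>y\<leftarrow>morph g u. v y) \<le> (\<Sum>y\<leftarrow>morph_pow g (Suc n) u. v y)"
    using Suc.IH by (simp add: morph_pow_Suc)
  moreover have "(\<Sum>x\<leftarrow>u. m * v x) \<le> (\<Sum>y\<leftarrow>morph g u. v y)"
    unfolding sum_list_morph using assms(2) Suc.prems by (intro sum_list_mono) auto
  then have "m ^ n * (m * (\<Sum>x\<leftarrow>u. v x)) \<le> m ^ n * (\<Sum>y\<leftarrow>morph g u. v y)"
    using assms(4) by (intro mult_left_mono) (auto simp: sum_list_const_mult)
  ultimately show ?case by (simp add: mult_ac)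
qed simp

lemma sum_list_bound:
  fixes v :: "'i \<Rightarrow> 'b::real_normed_vector"
  assumes "\<And>y. y \<in> set u \<Longrightarrow> norm (v y) \<le> M"
  shows "norm (\<Sum>y\<leftarrow>u. v y) \<le> M * real (length u)"
  using assms
proof (induction u)
  case (Cons a u)
  have "norm (v a + (\<Sum>y\<leftarrow>u. v y)) \<le> norm (v a) + norm (\<Sum>y\<leftarrow>u. v y)" by (rule norm_triangle_ineq)
  then show ?case using Cons by (fastforce simp: algebra_simps)
qed simp

text \<open>Equality in the triangle inequality aligns all summands; a summand that is itself an
  \<open>m\<close>-multiple of the total then forces \<open>m\<close> to be real and positive.\<close>
lemma aligned_sum_positive:
  fixes v :: "'i \<Rightarrow> complex"
  assumes "(\<Sum>y\<leftarrow>u. v y) = m * v x" "x \<in> set u" "v x \<noteq> 0" "m \<noteq> 0"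
    "(\<Sum>y\<leftarrow>u. norm (v y)) \<le> norm m * norm (v x)"
  shows "m = of_real (norm m)"
proof -
  define s where "s = m * v x"
  \<comment> \<open>Multiplication by this unit number rotates the total \<open>s\<close> onto the
    positive real axis.\<close>
  define w where "w = cnj s / norm s"
  have s: "s \<noteq> 0" using assms by (simp add: s_def)
  have w1: "norm w = 1" using s by (simp add: w_def norm_divide)
  have ws: "w * s = of_real (norm s)"
    using s by (simp add: w_def mult.commute[of "cnj s"] complex_norm_square[symmetric] power2_eq_square)
  have le: "Re (w * v y) \<le> norm (v y)" for y
    using complex_Re_le_cmod[of "w * v y"] w1 by (simp add: norm_mult)
  have "(\<Sum>y\<leftarrow>u. Re (w * v y)) = Re (w * (\<Sum>y\<leftarrow>u. v y))"
    by (induction u) (auto simp: algebra_simps)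
  also have "\<dots> = norm s" using ws assms(1) by (simp add: s_def)
  finally have tot: "(\<Sum>y\<leftarrow>u. norm (v y) - Re (w * v y)) \<le> 0"
    using assms(5) by (simp add: sum_list_subtractf s_def norm_mult)
  have "norm (v x) - Re (w * v x) \<le> (\<Sum>y\<leftarrow>u. norm (v y) - Re (w * v y))"
    by (rule member_le_sum_list) (use assms(2) le in auto)
  then have re: "Re (w * v x) = norm (w * v x)" using tot le[of x] w1 by (simp add: norm_mult)
  have "w * v x = of_real (norm (v x))"
  proof -
    have "Im (w * v x) = 0"
      using re cmod_power2[of "w * v x"] by simp
    then show ?thesis using re w1 by (simp add: complex_eq_iff norm_mult)
  qed
  then have "m * of_real (norm (v x)) = of_real (norm m * norm (v x))"
    using ws by (simp add: s_def norm_mult mult.left_commute)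
  then show ?thesis using assms(3) by simp
qed

text \<open>For an eigenvector \<open>v\<close>, choose \<open>d\<close> such that as few letters as possible of the support of \<open>v\<close>
  occur in \<open>g d\<close>. These letters all occur in each other's images, so either the summands of the
  eigenvalue equation are aligned at one of them, or the norm of \<open>v\<close> cut off to these letters grows by
  a factor exceeding \<open>|m|\<close>.\<close>
lemma eigenvalue_positive_or_exceeded:
  fixes v :: "'i \<Rightarrow> complex"
  assumes A: "finite A" "\<And>x. x \<in> A \<Longrightarrow> set (g x) \<subseteq> A"
    and trans: "\<And>x y. x \<in> A \<Longrightarrow> y \<in> set (g x) \<Longrightarrow> set (g y) \<subseteq> set (g x)"
    and eig: "\<And>x. x \<in> A \<Longrightarrow> (\<Sum>y\<leftarrow>g x. v y) = m * v x"
    and x0: "x0 \<in> A" "v x0 \<noteq> 0" and m: "m \<noteq> 0"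
  shows "m = of_real (norm m) \<or> (\<exists>\<kappa> c x. \<kappa> > norm m \<and> x \<in> A \<and> (\<forall>n. \<kappa> ^ n \<le> c * wlen g n [x]))"
proof -
  define R where "R = (\<lambda>x. {y \<in> set (g x). v y \<noteq> 0})"
  obtain d where d: "d \<in> A" "v d \<noteq> 0" "\<And>x. x \<in> A \<Longrightarrow> v x \<noteq> 0 \<Longrightarrow> card (R d) \<le> card (R x)"
    using ex_has_least_nat[of "\<lambda>x. x \<in> A \<and> v x \<noteq> 0" x0 "\<lambda>x. card (R x)"] x0 by auto
  have RA: "R d \<subseteq> A" using A d by (auto simp: R_def)
  have Req: "R e = R d" if "e \<in> R d" for e
  proof (rule card_seteq)
    show "finite (R d)" by (simp add: R_def)
    show "R e \<subseteq> R d" using that trans[OF d(1)] by (auto simp: R_def)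
    show "card (R d) \<le> card (R e)" using that RA by (intro d(3)) (auto simp: R_def)
  qed
  have Rne: "R d \<noteq> {}"
  proof
    assume "R d = {}"
    then have "(\<Sum>y\<leftarrow>g d. v y) = (\<Sum>y\<leftarrow>g d. 0)"
      by (intro arg_cong[of _ _ sum_list] map_cong) (auto simp: R_def)
    then show False using eig[OF d(1)] d m by simp
  qed
  show ?thesis
  proof (cases "\<exists>e\<in>R d. (\<Sum>y\<leftarrow>g e. norm (v y)) \<le> norm m * norm (v e)")
    case True
    then obtain e where e: "e \<in> R d" "(\<Sum>y\<leftarrow>g e. norm (v y)) \<le> norm m * norm (v e)" by blast
    have "e \<in> R e" using Req[OF e(1)] e by simp
    then have "e \<in> set (g e)" "v e \<noteq> 0" by (auto simp: R_def)
    then have "m = of_real (norm m)"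
      using aligned_sum_positive[OF eig _ _ m e(2)] e(1) RA by auto
    then show ?thesis ..
  next
    case False
    define y where "y = (\<lambda>x. if x \<in> R d then norm (v x) else 0)"
    have ypos: "y e > 0" if "e \<in> R d" for e using that by (auto simp: y_def R_def)
    have ynn: "y e \<ge> 0" for e by (simp add: y_def)
    have sume: "(\<Sum>z\<leftarrow>g e. y z) = (\<Sum>z\<leftarrow>g e. norm (v z))" if "e \<in> R d" for e
      using Req[OF that] by (intro arg_cong[of _ _ sum_list] map_cong) (auto simp: y_def R_def)
    \<comment> \<open>The least Collatz-Wielandt quotient of the truncated weight. No equality in
      the triangle inequality means that each of the finitely many quotients exceeds |m|, hence so
      does their minimum.\<close>
    define \<kappa> where "\<kappa> = Min ((\<lambda>e. (\<Sum>z\<leftarrow>g e. y z) / y e) ` R d)"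
    have fin: "finite (R d)" by (simp add: R_def)
    have "norm m < (\<Sum>z\<leftarrow>g e. y z) / y e" if "e \<in> R d" for e
      using False that ypos[OF that] sume[OF that] by (auto simp: field_simps y_def)
    then have k1: "norm m < \<kappa>" unfolding \<kappa>_def using fin Rne by (subst Min_gr_iff) auto
    have k2: "\<kappa> * y e \<le> (\<Sum>z\<leftarrow>g e. y z)" if "e \<in> A" for e
    proof (cases "e \<in> R d")
      case True
      then have "\<kappa> \<le> (\<Sum>z\<leftarrow>g e. y z) / y e" unfolding \<kappa>_def using fin by (intro Min_le) auto
      then show ?thesis using ypos[OF True] by (simp add: field_simps)
    next
      case False
      then show ?thesis using ynn by (auto simp: y_def intro!: sum_list_nonneg)
    qed
    have k0: "0 \<le> \<kappa>" using k1 norm_ge_zero[of m] by linarith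
    obtain e where e: "e \<in> R d" using Rne by blast
    have eA: "e \<in> A" using e RA by auto
    define M where "M = Max (y ` R d)"
    have yM: "norm (y z) \<le> M" for z
    proof (cases "z \<in> R d")
      case True then show ?thesis unfolding M_def using fin ynn by auto
    next
      case False
      have "0 \<le> y e" "y e \<le> M" using e fin ynn by (auto simp: M_def)
      then show ?thesis using False by (simp add: y_def)
    qed
    have "\<kappa> ^ n * y e \<le> M * wlen g n [e]" for n
    proof -
      have "\<kappa> ^ n * (\<Sum>z\<leftarrow>[e]. y z) \<le> (\<Sum>z\<leftarrow>morph_pow g n [e]. y z)"
        by (rule subeigenvector_iterate[of A]) (use A k2 eA k0 in auto)
      also have "\<dots> \<le> norm (\<Sum>z\<leftarrow>morph_pow g n [e]. y z)" by simp
      also have "\<dots> \<le> M * wlen g n [e]" by (rule sum_list_bound) (rule yM)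
      finally show ?thesis by simp
    qed
    then have "\<kappa> ^ n \<le> (M / y e) * wlen g n [e]" for n
      using ypos[OF e] by (simp add: field_simps)
    then show ?thesis using k1 eA by blast
  qed
qed

section \<open>The leading term of the lengths of iterated images\<close>

lemma binomial_sum_over_power_tendsto:
  fixes a :: "nat \<Rightarrow> complex"
  assumes "\<And>j. j < K \<Longrightarrow> a j \<noteq> 0 \<Longrightarrow> j \<le> k"
  shows "(\<lambda>n. (\<Sum>j<K. a j * of_nat (n choose j)) / of_nat n ^ k) \<longlonglongrightarrow> (if k < K then a k else 0) / fact k"
proof -
  have "(\<lambda>n. a j * of_nat (n choose j) / of_nat n ^ k) \<longlonglongrightarrow> (if j = k then a k / fact k else 0)" if "j < K" for j
  proof (cases "a j = 0 \<or> j = k")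
    case True
    have "(\<lambda>n. complex_of_real (real (n choose k) / real n ^ k)) \<longlonglongrightarrow> of_real (1 / fact k)"
      by (intro tendsto_of_real choose_over_power_tendsto)
    then have "(\<lambda>n. a k * complex_of_real (real (n choose k) / real n ^ k)) \<longlonglongrightarrow> a k * of_real (1 / fact k)"
      by (intro tendsto_mult[OF tendsto_const])
    then show ?thesis using True by auto
  next
    case False
    then have jk: "j < k" using assms[of j] that by auto
    have "(\<lambda>n. a j * complex_of_real (real (n choose j) / real n ^ j * (1 / real n) ^ (k - j))) \<longlonglongrightarrow> a j * of_real (1 / fact j * 0 ^ (k - j))"
      by (intro tendsto_intros choose_over_power_tendsto lim_const_over_n)
    moreover have "a j * complex_of_real (real (n choose j) / real n ^ j * (1 / real n) ^ (k - j)) = a j * of_nat (n choose j) / of_nat n ^ k" for n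
    proof -
      have "real n ^ k = real n ^ j * real n ^ (k - j)" using jk by (simp flip: power_add)
      then have "real (n choose j) / real n ^ j * (1 / real n) ^ (k - j) = real (n choose j) / real n ^ k"
        by (simp add: power_divide)
      then show ?thesis by simp
    qed
    ultimately show ?thesis using jk by (simp add: zero_power)
  qed
  then have "(\<lambda>n. \<Sum>j<K. a j * of_nat (n choose j) / of_nat n ^ k) \<longlonglongrightarrow> (\<Sum>j<K. if j = k then a k / fact k else 0)"
    by (intro tendsto_sum) auto
  then show ?thesis by (cases "k < K") (simp_all add: sum_divide_distrib)
qed

lemma shift_op_sum_list:
  "shift_op q (\<lambda>n. \<Sum>y\<leftarrow>u. f y n) n = (\<Sum>y\<leftarrow>u. shift_op q (f y) n)"
  by (induction u) (simp_all add: shift_op_def distrib_left sum.distrib)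

lemma shift_op_Suc: "shift_op q (\<lambda>n. u (Suc n)) n = shift_op q u (Suc n)"
  by (simp add: shift_op_def)

text \<open>The roots of a minimal recurrence bound all lengths from above. An eigenvalue of maximal
  modulus \<Lambda> that is not positive would, by transitivity, give a letter growing faster than
  that bound allows. So \<Lambda> is the only root of its modulus, every length is a polynomial
  times \<Lambda>^n up to a smaller exponential, and \<open>k\<close> is the largest degree that
  occurs.\<close>

theorem growth_of_transitive_morphism:
  fixes g :: "'i \<Rightarrow> 'i list"
  assumes A: "finite A" "A \<noteq> {}" "\<And>x. x \<in> A \<Longrightarrow> set (g x) \<subseteq> A" "\<And>x. x \<in> A \<Longrightarrow> g x \<noteq> []"
    and trans: "\<And>x y. x \<in> A \<Longrightarrow> y \<in> set (g x) \<Longrightarrow> set (g y) \<subseteq> set (g x)"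
  shows "\<exists>\<Lambda> k c. \<Lambda> > 0 \<and> (\<forall>x\<in>A. (\<lambda>n. wlen g n [x] / (real n ^ k * \<Lambda> ^ n)) \<longlonglongrightarrow> c x) \<and> (\<exists>x\<in>A. c x > 0)"
proof -
  define E where "E = (\<lambda>x n. complex_of_real (wlen g n [x]))"
  \<comment> \<open>The condition is posed at index 0 only: lengths at n + 1 are sums of lengths at
    n over the letters of an image, so it propagates to all indices.\<close>
  define ann where "ann = (\<lambda>q. q \<noteq> 0 \<and> (\<forall>x\<in>A. shift_op q (E x) 0 = 0))"
  have E1: "wlen g n [x] \<ge> 1" if "x \<in> A" for x n
    using morph_pow_nonempty[of A g "[x]" n] A that by (simp add: Suc_le_eq)
  have normE: "norm (E x n) = wlen g n [x]" for x n by (simp add: E_def)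
  have ESuc: "E x (Suc n) = (\<Sum>y\<leftarrow>g x. E y n)" for x n
  proof -
    have *: "complex_of_real (\<Sum>y\<leftarrow>u. f y) = (\<Sum>y\<leftarrow>u. of_real (f y))" for u and f :: "'i \<Rightarrow> real"
      by (induction u) auto
    have "wlen g (Suc n) [x] = (\<Sum>y\<leftarrow>g x. wlen g n [y])"
      using wlen_add[of g n 1 "[x]"] by (simp add: morph_pow_Suc)
    then show ?thesis unfolding E_def by (simp only: *)
  qed
  txt \<open>By minimality, every root of an annihilating polynomial of least degree is an eigenvalue.\<close>
  have "\<exists>q. ann q"
  proof -
    obtain c where c: "\<exists>k\<in>{..card A}. c k \<noteq> 0" "\<forall>x\<in>A. (\<Sum>k\<le>card A. c k * E x k) = 0"
      using linear_dependence[of A "{..card A}" "\<lambda>k x. E x k"] A by auto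
    define q where "q = (\<Sum>k\<le>card A. monom (c k) k)"
    have cq: "coeff q i = (if i \<le> card A then c i else 0)" for i
      by (simp add: q_def coeff_sum)
    have "degree q \<le> card A" by (rule degree_le) (simp add: cq)
    then have "shift_op q (E x) 0 = (\<Sum>k\<le>card A. c k * E x k)" for x
      by (simp add: shift_op_bound cq)
    moreover have "q \<noteq> 0" using c(1) cq by (metis atMost_iff coeff_0)
    ultimately show ?thesis using c unfolding ann_def by auto
  qed
  then obtain q where q: "ann q" "\<And>p. ann p \<Longrightarrow> degree q \<le> degree p"
    using ex_has_least_nat[of ann _ degree] by blast
  have q0: "q \<noteq> 0" using q by (simp add: ann_def)
  have zero: "shift_op q (E x) n = 0" if "x \<in> A" for x n
    using that
  proof (induction n arbitrary: x)
    case 0 then show ?case using q by (simp add: ann_def)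
  next
    case (Suc n)
    have "shift_op q (E x) (Suc n) = shift_op q (\<lambda>n. \<Sum>y\<leftarrow>g x. E y n) n"
      by (simp add: shift_op_Suc[symmetric] ESuc)
    also have "\<dots> = (\<Sum>y\<leftarrow>g x. shift_op q (E y) n)" by (rule shift_op_sum_list)
    also have "\<dots> = (\<Sum>y\<leftarrow>g x. 0)"
      by (intro arg_cong[of _ _ sum_list] map_cong) (use Suc A(3) in auto)
    finally show ?case by simp
  qed
  have eigen: "\<exists>v. (\<forall>x\<in>A. (\<Sum>y\<leftarrow>g x. v y) = m * v x) \<and> (\<exists>x\<in>A. v x \<noteq> 0)" if m: "poly q m = 0" for m
  proof -
    \<comment> \<open>The values of the cofactor \<open>q'\<close> on the length sequences form the
      eigenvector. They do not all vanish, since \<open>q'\<close> has smaller degree than the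
      minimal \<open>q\<close>.\<close>
    obtain q' where q': "q = [:- m, 1:] * q'" using m by (auto simp: poly_eq_0_iff_dvd)
    have "q' \<noteq> 0" using q0 q' by auto
    then have "degree q = Suc (degree q')" unfolding q' by (subst degree_mult_eq) auto
    then have "\<not> ann q'" using q(2)[of q'] by auto
    then have "\<exists>x\<in>A. shift_op q' (E x) 0 \<noteq> 0" using \<open>q' \<noteq> 0\<close> by (simp add: ann_def)
    moreover have "(\<Sum>y\<leftarrow>g x. shift_op q' (E y) 0) = m * shift_op q' (E x) 0" if "x \<in> A" for x
    proof -
      have "(\<Sum>y\<leftarrow>g x. shift_op q' (E y) 0) = shift_op q' (\<lambda>n. E x (Suc n)) 0"
        by (simp add: shift_op_sum_list ESuc)
      also have "\<dots> = shift_op q' (E x) (Suc 0)" by (simp add: shift_op_Suc)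
      moreover have "shift_op q' (E x) (Suc 0) - m * shift_op q' (E x) 0 = 0"
        using zero[OF that, of 0] unfolding q' shift_op_linear_factor .
      ultimately show ?thesis by simp
    qed
    ultimately show ?thesis by blast
  qed
  define R where "R = {m. poly q m = 0}"
  have finR: "finite R" using poly_roots_finite[OF q0] by (simp add: R_def)
  have Ebound: "\<exists>C. \<forall>n. wlen g n [x] \<le> C * r ^ n" if "x \<in> A" "0 < r" "\<And>m. m \<in> R \<Longrightarrow> norm m < r" for x r
    using shift_op_geometric_bound[OF q0, of r "E x" 0] that zero by (auto simp: R_def normE)
  have big: "\<exists>m\<in>R. norm m \<ge> 1"
  proof (rule ccontr)
    assume neg: "\<not> ?thesis"
    \<comment> \<open>The entry 1/2 keeps the rate positive and the maximum defined even without
      roots. Lengths of nonempty words cannot decay at a rate below 1.\<close>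
    define r where "r = Max (insert (1/2) (norm ` R))"
    have r: "r < 1" "\<And>m. m \<in> R \<Longrightarrow> norm m \<le> r" using neg finR by (auto simp: r_def)
    have r2: "1/2 \<le> r" unfolding r_def by (rule Max_ge) (use finR in auto)
    obtain x where x: "x \<in> A" using A by blast
    obtain C where C: "\<And>n. wlen g n [x] \<le> C * ((r + 1) / 2) ^ n"
      using Ebound[OF x, of "(r + 1) / 2"] r r2 by fastforce
    then have "1 ^ n \<le> C * ((r + 1) / 2) ^ n" for n using order_trans[OF E1[OF x] C[of n]] by simp
    then show False using geometric_contradiction[of "(r + 1) / 2" 1 C] r r2 by auto
  qed
  define \<Lambda> where "\<Lambda> = Max (norm ` R)"
  have Lge: "norm m \<le> \<Lambda>" if "m \<in> R" for m using that finR by (auto simp: \<Lambda>_def)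
  have L1: "\<Lambda> \<ge> 1" using big Lge by (meson order_trans)
  have "R \<noteq> {}" using big by auto
  then have "\<Lambda> \<in> norm ` R" unfolding \<Lambda>_def using finR by (intro Max_in) auto
  then obtain m where m: "m \<in> R" "norm m = \<Lambda>" by auto
  have dom: "norm m < \<Lambda> \<or> m = of_real \<Lambda>" if mR: "m \<in> R" for m
  proof (cases "norm m = \<Lambda>")
    case True
    obtain v x0 where v: "\<forall>x\<in>A. (\<Sum>y\<leftarrow>g x. v y) = m * v x" "x0 \<in> A" "v x0 \<noteq> 0"
      using eigen[of m] mR by (auto simp: R_def)
    have "m \<noteq> 0" using True L1 by auto
    then have "m = of_real (norm m) \<or> (\<exists>\<kappa> c x. \<kappa> > norm m \<and> x \<in> A \<and> (\<forall>n. \<kappa> ^ n \<le> c * wlen g n [x]))"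
      using eigenvalue_positive_or_exceeded[of A g v m x0] A trans v by auto
    then show ?thesis
    proof
      assume "\<exists>\<kappa> c x. \<kappa> > norm m \<and> x \<in> A \<and> (\<forall>n. \<kappa> ^ n \<le> c * wlen g n [x])"
      then obtain \<kappa> c x where k: "\<kappa> > \<Lambda>" "x \<in> A" "\<And>n. \<kappa> ^ n \<le> c * wlen g n [x]"
        using True by auto
      \<comment> \<open>The upper bound needs a rate strictly above the moduli of all roots, the
        contradiction one strictly below \<kappa>.\<close>
      obtain r where r: "\<Lambda> < r" "r < \<kappa>" using dense[OF k(1)] by blast
      obtain C where C: "\<And>n. wlen g n [x] \<le> C * r ^ n"
        using Ebound[OF k(2), of r] r L1 Lge by fastforce
      have c: "c \<ge> 0" using k(3)[of 0] by simp
      have "\<kappa> ^ n \<le> (c * C) * r ^ n" for n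
        using order_trans[OF k(3)[of n] mult_left_mono[OF C[of n] c]] by (simp add: mult.assoc)
      then show ?thesis using geometric_contradiction[of r \<kappa> "c * C"] r L1 by auto
    qed (use True in simp)
  qed (use Lge[OF mR] in auto)
  have domE: "dominated \<Lambda> (E x)" if "x \<in> A" for x
  proof (rule shift_op_dominated[OF _ q0])
    have "binomial_sum (\<lambda>_. 0)" by (rule binomial_sumI[where K = 0]) simp
    then have "dominated \<Lambda> (\<lambda>n. 0)" unfolding dominated_def using L1
      by (intro exI[of _ "\<lambda>_. 0"] exI[of _ "\<Lambda> / 2"] exI[of _ 0]) auto
    moreover have "shift_op q (E x) = (\<lambda>n. 0)" using zero[OF that] by auto
    ultimately show "dominated \<Lambda> (shift_op q (E x))" by simp
  qed (use L1 dom in \<open>auto simp: R_def\<close>)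
  have "\<forall>x\<in>A. \<exists>K a r C. 0 < r \<and> r < \<Lambda> \<and>
     (\<forall>n. norm (E x n - (\<Sum>j<K. a j * of_nat (n choose j)) * of_real \<Lambda> ^ n) \<le> C * r ^ n)"
  proof
    fix x assume "x \<in> A"
    then obtain f r C where f: "binomial_sum f" "0 < r" "r < \<Lambda>"
      "\<forall>n. norm (E x n - f n * of_real \<Lambda> ^ n) \<le> C * r ^ n"
      using domE unfolding dominated_def by blast
    obtain K a where "\<And>n. f n = (\<Sum>j<K. a j * of_nat (n choose j))"
      using f(1) unfolding binomial_sum_def by blast
    then show "\<exists>K a r C. 0 < r \<and> r < \<Lambda> \<and>
      (\<forall>n. norm (E x n - (\<Sum>j<K. a j * of_nat (n choose j)) * of_real \<Lambda> ^ n) \<le> C * r ^ n)"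
      using f by (intro exI[of _ K] exI[of _ a] exI[of _ r] exI[of _ C]) simp
  qed
  from bchoice[OF this] obtain K where "\<forall>x\<in>A. \<exists>a r C. 0 < r \<and> r < \<Lambda> \<and>
     (\<forall>n. norm (E x n - (\<Sum>j<K x. a j * of_nat (n choose j)) * of_real \<Lambda> ^ n) \<le> C * r ^ n)" by blast
  from bchoice[OF this] obtain a where "\<forall>x\<in>A. \<exists>r C. 0 < r \<and> r < \<Lambda> \<and>
     (\<forall>n. norm (E x n - (\<Sum>j<K x. a x j * of_nat (n choose j)) * of_real \<Lambda> ^ n) \<le> C * r ^ n)" by blast
  from bchoice[OF this] obtain r where "\<forall>x\<in>A. \<exists>C. 0 < r x \<and> r x < \<Lambda> \<and>
     (\<forall>n. norm (E x n - (\<Sum>j<K x. a x j * of_nat (n choose j)) * of_real \<Lambda> ^ n) \<le> C * r x ^ n)" by blast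
  from bchoice[OF this] obtain C where d: "\<And>x. x \<in> A \<Longrightarrow> 0 < r x" "\<And>x. x \<in> A \<Longrightarrow> r x < \<Lambda>"
     "\<And>x n. x \<in> A \<Longrightarrow> norm (E x n - (\<Sum>j<K x. a x j * of_nat (n choose j)) * of_real \<Lambda> ^ n) \<le> C x * r x ^ n"
    by blast
  \<comment> \<open>The binomial degrees that occur in the leading part of some letter. If there
    were none, all lengths would have a rate below \<Lambda>, whereas the weight of an eigenvector
    for a root of modulus \<Lambda> forces growth like \<Lambda>^n.\<close>
  define S where "S = (\<Union>x\<in>A. {j. j < K x \<and> a x j \<noteq> 0})"
  have finS: "finite S" using A by (auto simp: S_def)
  have "S \<noteq> {}"
  proof
    assume S: "S = {}"
    obtain v x0 where v: "\<forall>x\<in>A. (\<Sum>y\<leftarrow>g x. v y) = m * v x" "x0 \<in> A" "v x0 \<noteq> 0"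
      using eigen[of m] m by (auto simp: R_def)
    have sub: "set (morph_pow g n [x0]) \<subseteq> A" for n using v(2) A by (intro set_morph_pow_closed) auto
    define M where "M = Max ((\<lambda>x. norm (v x)) ` A)"
    have M: "norm (v x) \<le> M" if "x \<in> A" for x using that A by (auto simp: M_def)
    have Mpos: "M > 0" using M[OF v(2)] v(3) by (smt (verit) zero_less_norm_iff)
    have "(\<Sum>y\<leftarrow>morph_pow g n [x0]. v y) = m ^ n * v x0" for n
      using eigenvector_iterate[of A g v m "[x0]" n] v A by auto
    moreover have "norm (\<Sum>y\<leftarrow>morph_pow g n [x0]. v y) \<le> M * wlen g n [x0]" for n
      by (rule sum_list_bound) (use M sub[of n] in auto)
    ultimately have b: "\<Lambda> ^ n * norm (v x0) \<le> M * wlen g n [x0]" for n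
      by (metis m(2) norm_mult norm_power)
    have z: "(\<Sum>j<K x0. a x0 j * of_nat (n choose j)) = 0" for n
      by (rule sum.neutral) (use S v(2) in \<open>auto simp: S_def\<close>)
    have "wlen g n [x0] \<le> C x0 * r x0 ^ n" for n
      using d(3)[OF v(2), of n] unfolding z by (simp add: normE)
    then have "M * wlen g n [x0] \<le> M * (C x0 * r x0 ^ n)" for n
      using Mpos by (intro mult_left_mono) auto
    then have "\<Lambda> ^ n * norm (v x0) \<le> M * (C x0 * r x0 ^ n)" for n
      using b order_trans by blast
    then have "\<Lambda> ^ n \<le> (M * C x0 / norm (v x0)) * r x0 ^ n" for n
      using v(3) by (simp add: field_simps)
    then show False using geometric_contradiction d(1,2)[OF v(2)] by blast
  qed
  define k where "k = Max S"
  define b where "b = (\<lambda>x. (if k < K x then a x k else 0) / fact k)"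
  have lim: "(\<lambda>n. E x n / (of_nat n ^ k * of_real \<Lambda> ^ n)) \<longlonglongrightarrow> b x" if x: "x \<in> A" for x
  proof -
    define f where "f = (\<lambda>n. (\<Sum>j<K x. a x j * of_nat (n choose j)))"
    have l1: "(\<lambda>n. f n / of_nat n ^ k) \<longlonglongrightarrow> b x"
      unfolding f_def b_def
      by (rule binomial_sum_over_power_tendsto) (use x finS in \<open>auto simp: k_def S_def intro!: Max_ge\<close>)
    have l2: "(\<lambda>n. E x n / (of_nat n ^ k * of_real \<Lambda> ^ n) - f n / of_nat n ^ k) \<longlonglongrightarrow> 0"
    proof (rule tendsto_0_le[where K = 1])
      have C0: "C x \<ge> 0" using order_trans[OF norm_ge_zero d(3)[OF x, of 0]] by simp
      show "\<forall>\<^sub>F n in sequentially. norm (E x n / (of_nat n ^ k * of_real \<Lambda> ^ n) - f n / of_nat n ^ k)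
          \<le> norm (C x * (r x / \<Lambda>) ^ n) * 1"
      proof (rule eventually_mono[OF eventually_gt_at_top[of 0]])
        fix n :: nat assume n: "n > 0"
        have L0: "complex_of_real \<Lambda> \<noteq> 0" using L1 by auto
        have "E x n / (of_nat n ^ k * of_real \<Lambda> ^ n) - f n / of_nat n ^ k
          = (E x n - f n * of_real \<Lambda> ^ n) / (of_nat n ^ k * of_real \<Lambda> ^ n)"
          using L0 n by (simp add: diff_divide_distrib)
        then have "norm (E x n / (of_nat n ^ k * of_real \<Lambda> ^ n) - f n / of_nat n ^ k)
           = norm (E x n - f n * of_real \<Lambda> ^ n) / (real n ^ k * \<Lambda> ^ n)"
          using L1 by (simp add: norm_divide norm_mult norm_power)
        also have "\<dots> \<le> (C x * r x ^ n) / (real n ^ k * \<Lambda> ^ n)"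
          using d(3)[OF x, of n] L1 by (intro divide_right_mono) (auto simp: f_def)
        also have "\<dots> \<le> (C x * r x ^ n) / (1 * \<Lambda> ^ n)"
          using C0 d(1)[OF x] L1 n by (intro divide_left_mono mult_right_mono) auto
        finally have "norm (E x n / (of_nat n ^ k * of_real \<Lambda> ^ n) - f n / of_nat n ^ k) \<le> C x * (r x / \<Lambda>) ^ n"
          by (simp add: power_divide)
        then show "norm (E x n / (of_nat n ^ k * of_real \<Lambda> ^ n) - f n / of_nat n ^ k) \<le> norm (C x * (r x / \<Lambda>) ^ n) * 1"
          unfolding mult_1_right real_norm_def using abs_ge_self order_trans by blast
      qed
      have "(\<lambda>n. (r x / \<Lambda>) ^ n) \<longlonglongrightarrow> 0" using d(1,2)[OF x] L1 by (intro LIMSEQ_realpow_zero) auto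
      then show "(\<lambda>n. C x * (r x / \<Lambda>) ^ n) \<longlonglongrightarrow> 0" by (rule tendsto_mult_right_zero)
    qed
    show ?thesis using tendsto_add[OF l2 l1] by simp
  qed
  have limR: "(\<lambda>n. complex_of_real (wlen g n [x] / (real n ^ k * \<Lambda> ^ n))) \<longlonglongrightarrow> b x" if "x \<in> A" for x
    using lim[OF that] by (simp add: E_def)
  have Re: "(\<lambda>n. wlen g n [x] / (real n ^ k * \<Lambda> ^ n)) \<longlonglongrightarrow> Re (b x)" if "x \<in> A" for x
    using tendsto_Re[OF limR[OF that]] by simp
  have Im: "Im (b x) = 0" if "x \<in> A" for x
    using tendsto_Im[OF limR[OF that]] by (simp add: LIMSEQ_const_iff)
  have nonneg: "Re (b x) \<ge> 0" if "x \<in> A" for x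
    by (rule LIMSEQ_le_const[OF Re[OF that]]) (use L1 in auto)
  have "k \<in> S" unfolding k_def using finS \<open>S \<noteq> {}\<close> by (rule Max_in)
  then obtain x where x: "x \<in> A" "k < K x" "a x k \<noteq> 0" by (auto simp: S_def)
  then have "b x \<noteq> 0" by (simp add: b_def)
  then have "Re (b x) > 0" using Im[OF x(1)] nonneg[OF x(1)] by (simp add: complex_eq_iff)
  then show ?thesis using Re x(1) L1
    by (intro exI[of _ \<Lambda>] exI[of _ k] exI[of _ "\<lambda>x. Re (b x)"]) auto
qed

lemma set_morph_pow_add:
  "set (morph_pow g (m + n) u) = (\<Union>y\<in>set (morph_pow g n u). set (morph_pow g m [y]))"
  by (subst morph_pow_add, subst morph_pow_conv_letters) (simp add: morph_def)

text \<open>The letter sets of the n-th images compose like powers in a finite semigroup, so they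
  are periodic with some period \<open>p\<close> from some index \<open>i\<close> on. A positive
  multiple of \<open>p\<close> that is at least \<open>i\<close> is idempotent, and
  \<open>i * p\<close> is one because \<open>i\<close> is chosen positive.\<close>

lemma idempotent_letter_sets:
  fixes g :: "'i::finite \<Rightarrow> 'i list"
  shows "\<exists>m>0. \<forall>x. (\<Union>y\<in>set (morph_pow g m [x]). set (morph_pow g m [y])) = set (morph_pow g m [x])"
proof -
  define S where "S = (\<lambda>n x. set (morph_pow g n [x]))"
  have Sadd: "S (m + n) x = (\<Union>y\<in>S n x. S m y)" for m n x
    by (simp add: S_def set_morph_pow_add)
  have "\<not> inj_on S {1..}"
    using finite_imageD[of S "{1..}"] infinite_Ici[of "1::nat"] finite[of "S ` {1..}"] by blast
  then obtain i j where ij: "i \<ge> 1" "i < j" "S i = S j"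
    unfolding inj_on_def by (metis atLeast_iff linorder_neqE_nat)
  define p where "p = j - i"
  have per1: "S (n + p) = S n" if "n \<ge> i" for n
  proof
    fix x
    have "S (n + p) x = S ((n - i) + j) x" using that ij by (simp add: p_def)
    also have "\<dots> = S ((n - i) + i) x" by (simp only: Sadd ij(3))
    finally show "S (n + p) x = S n x" using that by simp
  qed
  have per: "S (n + q * p) = S n" if "n \<ge> i" for n q
  proof (induction q)
    case (Suc q)
    have "S (n + Suc q * p) = S (n + q * p + p)" by (simp add: add_ac)
    then show ?case using per1[of "n + q * p"] that Suc by simp
  qed simp
  have "i * p \<ge> i" "i * p > 0" using ij by (auto simp: p_def)
  then have "S (i * p + i * p) = S (i * p)" using per by blast
  then have "\<forall>x. (\<Union>y\<in>S (i * p) x. S (i * p) y) = S (i * p) x" by (simp flip: Sadd)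
  then show ?thesis using \<open>i * p > 0\<close> unfolding S_def by blast
qed

lemma tendsto_sum_list:
  fixes c :: "'i \<Rightarrow> real"
  assumes "\<And>x. x \<in> set u \<Longrightarrow> (f x \<longlongrightarrow> c x) F"
  shows "((\<lambda>n. \<Sum>x\<leftarrow>u. f x n) \<longlongrightarrow> (\<Sum>x\<leftarrow>u. c x)) F"
  using assms by (induction u) (auto intro: tendsto_add)

text \<open>A power with idempotent letter sets is transitive. The remaining \<open>t\<close> steps
  are moved into the starting word, so that all residue classes share \<open>k\<close> and \<Lambda>
  and differ only in the constants.\<close>

theorem morphism_growth:
  fixes g :: "'i::finite \<Rightarrow> 'i list"
  assumes A: "A \<noteq> {}" "\<And>x. x \<in> A \<Longrightarrow> set (g x) \<subseteq> A" "\<And>x. x \<in> A \<Longrightarrow> g x \<noteq> []"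
  obtains m \<Lambda> k c where "m > 0" "\<Lambda> > 0"
    "\<And>u t. set u \<subseteq> A \<Longrightarrow>
       (\<lambda>n. wlen g (m * n + t) u / (real n ^ k * \<Lambda> ^ n)) \<longlonglongrightarrow> (\<Sum>x\<leftarrow>morph_pow g t u. c x)"
    "\<exists>x\<in>A. c x > 0"
proof -
  obtain m where m: "m > 0"
    "\<And>x. (\<Union>y\<in>set (morph_pow g m [x]). set (morph_pow g m [y])) = set (morph_pow g m [x])"
    using idempotent_letter_sets[of g] by blast
  define G where "G = (\<lambda>x. morph_pow g m [x])"
  have G: "wlen G n u = wlen g (m * n) u" for n u by (simp add: G_def morph_pow_mult)
  have "\<exists>\<Lambda> k c. \<Lambda> > 0 \<and> (\<forall>x\<in>A. (\<lambda>n. wlen G n [x] / (real n ^ k * \<Lambda> ^ n)) \<longlonglongrightarrow> c x) \<and> (\<exists>x\<in>A. c x > 0)"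
  proof (rule growth_of_transitive_morphism)
    show "set (G x) \<subseteq> A" if "x \<in> A" for x
      unfolding G_def using A that by (intro set_morph_pow_closed) auto
    show "G x \<noteq> []" if "x \<in> A" for x
      unfolding G_def using A that by (intro morph_pow_nonempty[of A]) auto
    show "set (G y) \<subseteq> set (G x)" if "y \<in> set (G x)" for x y
      using m(2)[of x] that by (auto simp: G_def)
  qed (use A in auto)
  then obtain \<Lambda> k c where L: "\<Lambda> > 0" "\<exists>x\<in>A. c x > 0"
    "\<And>x. x \<in> A \<Longrightarrow> (\<lambda>n. wlen g (m * n) [x] / (real n ^ k * \<Lambda> ^ n)) \<longlonglongrightarrow> c x"
    unfolding G by blast
  have "(\<lambda>n. wlen g (m * n + t) u / (real n ^ k * \<Lambda> ^ n)) \<longlonglongrightarrow> (\<Sum>x\<leftarrow>morph_pow g t u. c x)"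
    if "set u \<subseteq> A" for u t
  proof -
    have "(\<lambda>n. \<Sum>x\<leftarrow>morph_pow g t u. wlen g (m * n) [x] / (real n ^ k * \<Lambda> ^ n)) \<longlonglongrightarrow> (\<Sum>x\<leftarrow>morph_pow g t u. c x)"
      using set_morph_pow_closed[of A g, OF A(2) that] by (intro tendsto_sum_list L(3)) auto
    moreover have "(\<Sum>x\<leftarrow>v. f x / d) = (\<Sum>x\<leftarrow>v. f x) / d" for v and f :: "'i \<Rightarrow> real" and d
      by (induction v) (auto simp: add_divide_distrib)
    ultimately show ?thesis by (simp add: wlen_add)
  qed
  then show ?thesis using that m(1) L(1,2) by blast
qed

section \<open>Quotients of growth constants\<close>

definition rpoly :: "real \<Rightarrow> rat poly \<Rightarrow> real" where
  "rpoly z p = poly (map_poly of_rat p) z"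

lemma rpoly_0 [simp]: "rpoly z 0 = 0"
  by (simp add: rpoly_def)

lemma rpoly_pCons [simp]: "rpoly z (pCons a p) = of_rat a + z * rpoly z p"
  by (simp add: rpoly_def map_poly_pCons)

lemma rpoly_add [simp]: "rpoly z (p + q) = rpoly z p + rpoly z q"
  by (induction p q rule: poly_induct2) (auto simp: of_rat_add algebra_simps)

lemma rpoly_smult [simp]: "rpoly z (smult a p) = of_rat a * rpoly z p"
  by (induction p) (auto simp: of_rat_mult algebra_simps)

lemma rpoly_mult [simp]: "rpoly z (p * q) = rpoly z p * rpoly z q"
  by (induction p) (auto simp: algebra_simps)

lemma rpoly_1 [simp]: "rpoly z 1 = 1"
  by (simp add: one_pCons)

lemma rpoly_power [simp]: "rpoly z (p ^ n) = rpoly z p ^ n"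
  by (induction n) auto

lemma rpoly_sum: "rpoly z (\<Sum>i\<in>I. f i) = (\<Sum>i\<in>I. rpoly z (f i))"
  by (induction I rule: infinite_finite_induct) auto

lemma rpoly_monom [simp]: "rpoly z (monom a n) = of_rat a * z ^ n"
  by (induction n) (auto simp: monom_0 monom_Suc)

lemma rpoly_of_rat: "rpoly (of_rat r) p = of_rat (poly p r)"
  by (induction p) (auto simp: of_rat_add of_rat_mult)

lemma rpoly_mod:
  assumes "rpoly z f = 0"
  shows "rpoly z (p mod f) = rpoly z p"
proof -
  have "rpoly z p = rpoly z (p div f * f + p mod f)" by simp
  also have "\<dots> = rpoly z (p mod f)" by (simp only: rpoly_add rpoly_mult assms)
  finally show ?thesis ..
qed

lemma rpoly_tendsto [tendsto_intros]:
  "(f \<longlongrightarrow> z) F \<Longrightarrow> ((\<lambda>x. rpoly (f x) p) \<longlongrightarrow> rpoly z p) F"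
  unfolding rpoly_def by (rule tendsto_poly)

lemma eventually_rpoly_nonzero:
  assumes "p \<noteq> 0"
  shows "\<forall>\<^sub>F z in at_left \<rho>. rpoly z p \<noteq> 0"
proof -
  have "map_poly of_rat p \<noteq> (0 :: real poly)"
    using assms by (metis coeff_0 coeff_map_poly of_rat_0 of_rat_eq_0_iff poly_eqI)
  then have "finite {z. rpoly z p = 0}" unfolding rpoly_def by (rule poly_roots_finite)
  then have "\<forall>\<^sub>F z in at_left \<rho>. \<forall>y\<in>{z. rpoly z p = 0}. z \<noteq> y"
    by (intro eventually_ball_finite) (auto intro: eventually_neq_at_within)
  then show ?thesis by (rule eventually_mono) auto
qed

text \<open>Membership in the field generated by \<rho> over the rationals, in terms of quotients so
  that it makes sense for any real \<rho>.\<close>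

definition in_rational_field :: "real \<Rightarrow> real \<Rightarrow> bool" where
  "in_rational_field \<rho> x \<longleftrightarrow> (\<exists>p q. rpoly \<rho> q \<noteq> 0 \<and> x = rpoly \<rho> p / rpoly \<rho> q)"

lemma in_rational_field_1: "in_rational_field \<rho> 1"
  unfolding in_rational_field_def by (intro exI[of _ 1]) auto

lemma in_rational_field_Rats:
  assumes "in_rational_field \<rho> x" "\<rho> \<in> \<rat>"
  shows "x \<in> \<rat>"
  using assms by (auto simp: in_rational_field_def rpoly_of_rat elim!: Rats_cases)

text \<open>Common factors vanishing at \<open>\<rho>\<close> are cancelled by dividing both polynomials by a
  rational polynomial of least degree that vanishes at \<open>\<rho>\<close>.\<close>
lemma in_rational_field_limit:
  assumes "((\<lambda>z. rpoly z p / rpoly z q) \<longlongrightarrow> L) (at_left \<rho>)" "q \<noteq> 0"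
  shows "in_rational_field \<rho> L"
  using assms
proof (induction "degree q" arbitrary: p q rule: less_induct)
  case less
  have lim: "((\<lambda>z. rpoly z r) \<longlongrightarrow> rpoly \<rho> r) (at_left \<rho>)" for r
    by (intro tendsto_intros)
  show ?case
  proof (cases "rpoly \<rho> q = 0")
    case False
    have "((\<lambda>z. rpoly z p / rpoly z q) \<longlongrightarrow> rpoly \<rho> p / rpoly \<rho> q) (at_left \<rho>)"
      by (intro tendsto_divide lim False)
    then have "L = rpoly \<rho> p / rpoly \<rho> q"
      using less.prems(1) tendsto_unique trivial_limit_at_left_real by blast
    then show ?thesis using False by (auto simp: in_rational_field_def)
  next
    case q: True
    \<comment> \<open>A finite limit of the quotient and a vanishing denominator force the numerator
      to vanish at \<rho> as well.\<close>
    have "((\<lambda>z. rpoly z p / rpoly z q * rpoly z q) \<longlongrightarrow> L * rpoly \<rho> q) (at_left \<rho>)"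
      by (intro tendsto_mult less.prems lim)
    then have "((\<lambda>z. rpoly z p) \<longlongrightarrow> L * rpoly \<rho> q) (at_left \<rho>)"
      by (rule Lim_transform_eventually)
        (rule eventually_mono[OF eventually_rpoly_nonzero[OF less.prems(2)]], simp)
    then have p: "rpoly \<rho> p = 0"
      using lim[of p] tendsto_unique trivial_limit_at_left_real q by fastforce
    obtain f where f: "f \<noteq> 0" "rpoly \<rho> f = 0" "\<And>r. r \<noteq> 0 \<Longrightarrow> rpoly \<rho> r = 0 \<Longrightarrow> degree f \<le> degree r"
      using ex_has_least_nat[of "\<lambda>f. f \<noteq> 0 \<and> rpoly \<rho> f = 0" q degree] q less.prems(2) by auto
    have dvd: "f dvd r" if "rpoly \<rho> r = 0" for r
    proof (rule ccontr)
      assume "\<not> f dvd r"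
      then have n0: "r mod f \<noteq> 0" by (simp add: mod_eq_0_iff_dvd)
      then have "degree (r mod f) < degree f" using f(1) degree_mod_less by blast
      moreover have "rpoly \<rho> (r mod f) = 0"
        using that f(2) by (simp add: rpoly_mod)
      ultimately show False using f(3)[OF n0] by simp
    qed
    obtain p' q' where pq: "p = f * p'" "q = f * q'" using dvd p q by (meson dvdE)
    have q': "q' \<noteq> 0" using less.prems(2) pq by auto
    have "degree f > 0"
    proof (rule ccontr)
      assume "\<not> degree f > 0"
      then obtain a where "f = [:a:]" by (auto elim: degree_eq_zeroE)
      then show False using f by auto
    qed
    then have "degree q' < degree q" using f(1) q' by (simp add: pq degree_mult_eq)
    moreover have "((\<lambda>z. rpoly z p' / rpoly z q') \<longlongrightarrow> L) (at_left \<rho>)"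
      by (rule Lim_transform_eventually[OF less.prems(1)])
        (rule eventually_mono[OF eventually_rpoly_nonzero[OF f(1)]], simp add: pq)
    ultimately show ?thesis using less.hyps q' by blast
  qed
qed

text \<open>For x = A / B at \<rho>, the N + 1 polynomials A^k B^(N-k) reduced modulo
  \<open>f\<close> lie in a space of dimension N. A linear relation between them, evaluated at
  \<rho> and divided by the N-th power of B, is an equation for \<open>x\<close>. Homogenizing
  avoids an inverse of B modulo \<open>f\<close>, which need not exist if \<open>f\<close> is
  reducible.\<close>

lemma in_rational_field_algebraic:
  assumes "in_rational_field \<rho> x" "f \<noteq> 0" "degree f \<le> N" "rpoly \<rho> f = 0"
  shows "algebraic_deg_le x N"
proof -
  obtain A B where AB: "rpoly \<rho> B \<noteq> 0" "x = rpoly \<rho> A / rpoly \<rho> B"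
    using assms(1) by (auto simp: in_rational_field_def)
  define v where "v = (\<lambda>k. (A ^ k * B ^ (N - k)) mod f)"
  have "degree f > 0"
  proof (rule ccontr)
    assume "\<not> degree f > 0"
    then obtain a where "f = [:a:]" by (auto elim: degree_eq_zeroE)
    then show False using assms by auto
  qed
  then have degv: "degree (v k) < N" for k
    using degree_mod_less[OF assms(2), of "A ^ k * B ^ (N - k)"] assms(3) by (auto simp: v_def)
  have rv: "rpoly \<rho> (v k) = rpoly \<rho> A ^ k * rpoly \<rho> B ^ (N - k)" for k
    using assms(4) by (simp add: v_def rpoly_mod)
  obtain c where c: "\<exists>k\<in>{..N}. c k \<noteq> 0" "\<forall>i\<in>{..<N}. (\<Sum>k\<le>N. c k * coeff (v k) i) = 0"
    using linear_dependence[of "{..<N}" "{..N}" "\<lambda>k. coeff (v k)"] by auto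
  have "(\<Sum>k\<le>N. smult (c k) (v k)) = 0"
  proof (rule poly_eqI)
    fix i show "coeff (\<Sum>k\<le>N. smult (c k) (v k)) i = coeff 0 i"
    proof (cases "i < N")
      case True then show ?thesis using c(2) by (simp add: coeff_sum)
    next
      case False
      then have "coeff (v k) i = 0" for k using degv[of k] by (intro coeff_eq_0) auto
      then show ?thesis by (simp add: coeff_sum)
    qed
  qed
  then have "rpoly \<rho> (\<Sum>k\<le>N. smult (c k) (v k)) = 0" by simp
  then have "(\<Sum>k\<le>N. of_rat (c k) * (rpoly \<rho> A ^ k * rpoly \<rho> B ^ (N - k))) = 0"
    by (simp add: rpoly_sum rv)
  moreover have "of_rat (c k) * (rpoly \<rho> A ^ k * rpoly \<rho> B ^ (N - k)) = rpoly \<rho> B ^ N * (of_rat (c k) * x ^ k)" if "k \<le> N" for k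
    using AB that by (simp add: power_divide power_diff)
  ultimately have "rpoly \<rho> B ^ N * (\<Sum>k\<le>N. of_rat (c k) * x ^ k) = 0"
    by (simp add: sum_distrib_left)
  then have x: "(\<Sum>k\<le>N. of_rat (c k) * x ^ k) = 0" using AB by simp
  obtain d :: int where d: "d > 0" "\<forall>k\<in>{..N}. of_int d * c k \<in> \<int>"
    using common_denominator[of "{..N}" c] by auto
  define P where "P = (\<Sum>k\<le>N. monom (of_rat (of_int d * c k)) k :: real poly)"
  have cP: "coeff P i = (if i \<le> N then of_rat (of_int d * c i) else 0)" for i
    by (simp add: P_def coeff_sum)
  have "coeff P i \<in> \<int>" for i
  proof (cases "i \<le> N")
    case True
    then obtain j where "of_int d * c i = of_int j" using d(2) by (auto elim: Ints_cases)
    then show ?thesis unfolding cP by simp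
  qed (simp add: cP)
  moreover have "P \<noteq> 0" using c(1) d(1) cP
    by (metis atMost_iff coeff_0 mult_eq_0_iff of_int_eq_0_iff of_rat_eq_0_iff less_irrefl)
  moreover have "degree P \<le> N" by (rule degree_le) (simp add: cP)
  moreover have "poly P x = of_int d * (\<Sum>k\<le>N. of_rat (c k) * x ^ k)"
    by (simp add: P_def poly_sum poly_monom of_rat_mult sum_distrib_left mult.assoc)
  then have "poly P x = 0" using x by simp
  ultimately show ?thesis unfolding algebraic_deg_le_def by blast
qed

section \<open>Generating functions near their singularity\<close>

lemma growth_ratio:
  fixes s :: "nat \<Rightarrow> real"
  assumes "(\<lambda>n. s n / (real n ^ k * \<Lambda> ^ n)) \<longlonglongrightarrow> C" "C > 0" "\<Lambda> > 0"
  shows "(\<lambda>n. s (Suc n) / s n) \<longlonglongrightarrow> \<Lambda>"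
proof -
  let ?u = "\<lambda>n. s n / (real n ^ k * \<Lambda> ^ n)"
  have "(\<lambda>n. ?u (Suc n) / ?u n * (\<Lambda> * (1 + 1 / real n) ^ k)) \<longlonglongrightarrow> C / C * (\<Lambda> * (1 + 0) ^ k)"
    by (intro tendsto_intros assms LIMSEQ_Suc lim_const_over_n) (use assms in auto)
  then have "(\<lambda>n. ?u (Suc n) / ?u n * (\<Lambda> * (1 + 1 / real n) ^ k)) \<longlonglongrightarrow> \<Lambda>" using assms by simp
  then show ?thesis
  proof (rule Lim_transform_eventually)
    show "\<forall>\<^sub>F n in sequentially. ?u (Suc n) / ?u n * (\<Lambda> * (1 + 1 / real n) ^ k) = s (Suc n) / s n"
    proof (rule eventually_mono[OF eventually_gt_at_top[of 0]])
      fix n :: nat assume n: "n > 0"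
      have "1 + 1 / real n = real (Suc n) / real n" using n by (simp add: field_simps)
      then have e: "(1 + 1 / real n) ^ k = real (Suc n) ^ k / real n ^ k" by (simp add: power_divide)
      show "?u (Suc n) / ?u n * (\<Lambda> * (1 + 1 / real n) ^ k) = s (Suc n) / s n"
        unfolding e using n assms(3) by (simp del: of_nat_Suc)
    qed
  qed
qed

text \<open>The generating functions of \<open>s\<close> and \<open>t\<close> are rational functions with a common
  denominator, and the quotient of their numerators tends to \<open>D / C\<close> at the radius of convergence.\<close>
theorem growth_quotient_in_rational_field:
  fixes s t :: "nat \<Rightarrow> nat" and c :: "nat \<Rightarrow> rat"
  assumes L: "\<Lambda> > 0"
    and s: "(\<lambda>n. real (s n) / (real n ^ k * \<Lambda> ^ n)) \<longlonglongrightarrow> C" "C > 0"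
    and t: "(\<lambda>n. real (t n) / (real n ^ k * \<Lambda> ^ n)) \<longlonglongrightarrow> D"
    and c: "i0 \<le> N" "c i0 \<noteq> 0"
    and recs: "\<And>n. (\<Sum>i\<le>N. c i * of_nat (s (n + i))) = 0"
    and rect: "\<And>n. (\<Sum>i\<le>N. c i * of_nat (t (n + i))) = 0"
  shows "in_rational_field (1 / \<Lambda>) (D / C)"
proof -
  define \<rho> where "\<rho> = 1 / \<Lambda>"
  have rho: "\<rho> > 0" using L by (simp add: \<rho>_def)
  have spos: "\<forall>\<^sub>F n in sequentially. C / 2 < real (s n) / (real n ^ k * \<Lambda> ^ n)"
    using order_tendstoD(1)[OF s(1), of "C / 2"] s(2) by simp
  have quot: "(\<lambda>n. real (t n) / real (s n)) \<longlonglongrightarrow> D / C"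
  proof -
    have "(\<lambda>n. (real (t n) / (real n ^ k * \<Lambda> ^ n)) / (real (s n) / (real n ^ k * \<Lambda> ^ n))) \<longlonglongrightarrow> D / C"
      by (intro tendsto_divide s t) (use s(2) in simp)
    then show ?thesis
      by (rule Lim_transform_eventually)
        (rule eventually_mono[OF eventually_gt_at_top[of 0]], use L in auto)
  qed
  define F where "F = (\<lambda>z. \<Sum>n. real (s n) * z ^ n)"
  define G where "G = (\<lambda>z. \<Sum>n. real (t n) * z ^ n)"
  have sums: "summable (\<lambda>n. real (s n) * z ^ n)" if z: "0 < z" "z < \<rho>" for z
  proof -
    have "\<Lambda> * z < 1" using z L by (simp add: \<rho>_def field_simps)
    then obtain r where r: "\<Lambda> * z < r" "r < 1" using dense by blast
    have "(\<lambda>n. real (s (Suc n)) / real (s n) * z) \<longlonglongrightarrow> \<Lambda> * z"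
      by (intro tendsto_intros growth_ratio[OF s L])
    then have "\<forall>\<^sub>F n in sequentially. real (s (Suc n)) / real (s n) * z < r"
      using r order_tendstoD(2) by blast
    moreover have "\<forall>\<^sub>F n in sequentially. s n > 0"
      using spos by (rule eventually_mono) (use s(2) in \<open>auto intro!: gr0I\<close>)
    ultimately have "\<forall>\<^sub>F n in sequentially. real (s (Suc n)) * z \<le> r * real (s n)"
      by eventually_elim (simp add: field_simps)
    then obtain n0 where n0: "\<And>n. n \<ge> n0 \<Longrightarrow> real (s (Suc n)) * z \<le> r * real (s n)"
      by (auto simp: eventually_at_top_linorder)
    show ?thesis
    proof (rule summable_ratio_test[OF r(2)])
      fix n assume "n \<ge> n0"
      from mult_right_mono[OF n0[OF this], of "z ^ n"] z
      show "norm (real (s (Suc n)) * z ^ Suc n) \<le> r * norm (real (s n) * z ^ n)"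
        by (simp add: mult_ac)
    qed
  qed
  have tbound: "\<exists>n0. \<forall>n\<ge>n0. \<bar>real (t n) - D / C * real (s n)\<bar> \<le> e * real (s n)" if e: "e > 0" for e
  proof -
    have "\<forall>\<^sub>F n in sequentially. s n > 0"
      using spos by (rule eventually_mono) (use s(2) in \<open>auto intro!: gr0I\<close>)
    moreover have "\<forall>\<^sub>F n in sequentially. \<bar>real (t n) / real (s n) - D / C\<bar> < e"
      using tendstoD[OF quot e] by (simp add: dist_real_def)
    ultimately have "\<forall>\<^sub>F n in sequentially. \<bar>real (t n) - D / C * real (s n)\<bar> \<le> e * real (s n)"
    proof eventually_elim
      case (elim n)
      have "real (t n) - D / C * real (s n) = (real (t n) / real (s n) - D / C) * real (s n)"
        using elim by (simp add: left_diff_distrib)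
      then show ?case using elim by (simp add: abs_mult mult_right_mono)
    qed
    then show ?thesis by (simp add: eventually_at_top_linorder)
  qed
  have tsums: "summable (\<lambda>n. real (t n) * z ^ n)" if z: "0 < z" "z < \<rho>" for z
  proof -
    obtain n0 where n0: "\<And>n. n \<ge> n0 \<Longrightarrow> \<bar>real (t n) - D / C * real (s n)\<bar> \<le> 1 * real (s n)"
      using tbound[of 1] by auto
    show ?thesis
    proof (rule summable_comparison_test')
      show "summable (\<lambda>n. (1 + \<bar>D / C\<bar>) * (real (s n) * z ^ n))" by (intro summable_mult sums z)
      fix n assume "n \<ge> n0"
      have "D / C * real (s n) \<le> \<bar>D / C\<bar> * real (s n)" by (intro mult_right_mono abs_ge_self) simp
      then have "real (t n) \<le> (1 + \<bar>D / C\<bar>) * real (s n)"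
        using n0[OF \<open>n \<ge> n0\<close>] by (simp add: algebra_simps abs_le_iff)
      from mult_right_mono[OF this, of "z ^ n"] z
      show "norm (real (t n) * z ^ n) \<le> (1 + \<bar>D / C\<bar>) * (real (s n) * z ^ n)"
        by (simp add: mult.assoc)
    qed
  qed
  have near: "\<forall>\<^sub>F z in at_left \<rho>. 0 < z \<and> z < \<rho>"
    using rho by (auto simp: eventually_at_left_field intro!: exI[of _ 0])
  have Finf: "filterlim F at_top (at_left \<rho>)"
    unfolding filterlim_at_top
  proof
    fix M :: real
    \<comment> \<open>At the radius of convergence the terms stay above \<open>C / 2\<close>
      eventually, so the partial sums are unbounded.\<close>
    have "\<exists>n0. M < (\<Sum>n<n0. real (s n) * \<rho> ^ n)"
    proof (rule ccontr)
      assume "\<not> ?thesis"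
      then have b: "(\<Sum>n<n0. real (s n) * \<rho> ^ n) \<le> M" for n0 by (meson not_less)
      have "summable (\<lambda>n. real (s n) * \<rho> ^ n)"
        by (rule summableI_nonneg_bounded[where x = M]) (use b rho in auto)
      then have "(\<lambda>n. real (s n) * \<rho> ^ n) \<longlonglongrightarrow> 0" by (rule summable_LIMSEQ_zero)
      from order_tendstoD(2)[OF this, of "C / 2"]
      have "\<forall>\<^sub>F n in sequentially. real (s n) * \<rho> ^ n < C / 2" using s(2) by simp
      moreover have "\<forall>\<^sub>F n in sequentially. C / 2 \<le> real (s n) * \<rho> ^ n"
        using spos eventually_gt_at_top[of 0]
      proof eventually_elim
        case (elim n)
        have "real (s n) / (real n ^ k * \<Lambda> ^ n) \<le> real (s n) / (1 * \<Lambda> ^ n)"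
          using elim L by (intro divide_left_mono mult_right_mono) auto
        from order_trans[OF less_imp_le[OF elim(1)] this] show ?case by (simp add: \<rho>_def power_divide)
      qed
      ultimately have "\<forall>\<^sub>F n in sequentially. False" by eventually_elim simp
      then show False by simp
    qed
    then obtain n0 where n0: "M < (\<Sum>n<n0. real (s n) * \<rho> ^ n)" by blast
    have "((\<lambda>z. \<Sum>n<n0. real (s n) * z ^ n) \<longlongrightarrow> (\<Sum>n<n0. real (s n) * \<rho> ^ n)) (at_left \<rho>)"
      by (intro tendsto_intros)
    then have "\<forall>\<^sub>F z in at_left \<rho>. M < (\<Sum>n<n0. real (s n) * z ^ n)" using n0 order_tendstoD(1) by blast
    then show "\<forall>\<^sub>F z in at_left \<rho>. M \<le> F z" using near
    proof eventually_elim
      case (elim z)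
      have "(\<Sum>n<n0. real (s n) * z ^ n) \<le> F z"
        unfolding F_def by (rule sum_le_suminf) (use elim sums in auto)
      then show ?case using elim by simp
    qed
  qed
  have GF: "((\<lambda>z. G z / F z) \<longlongrightarrow> D / C) (at_left \<rho>)"
  proof (rule tendstoI)
    fix e :: real assume e: "e > 0"
    \<comment> \<open>An Abelian argument: the tail of \<open>G - (D / C) F\<close> costs at most a
      third of \<open>e\<close> times \<open>F\<close>. The head is bounded by the constant
      \<open>K\<close>, which is at most another third because \<open>F\<close> diverges.\<close>
    obtain n0 where n0: "\<And>n. n \<ge> n0 \<Longrightarrow> \<bar>real (t n) - D / C * real (s n)\<bar> \<le> (e / 3) * real (s n)"
      using tbound[of "e / 3"] e by auto
    define d where "d = (\<lambda>n. \<bar>real (t n) - D / C * real (s n)\<bar>)"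
    define K where "K = (\<Sum>n<n0. d n * \<rho> ^ n)"
    have "\<forall>\<^sub>F z in at_left \<rho>. F z \<ge> max 1 (3 * K / e)"
      using Finf unfolding filterlim_at_top by blast
    then show "\<forall>\<^sub>F z in at_left \<rho>. dist (G z / F z) (D / C) < e" using near
    proof eventually_elim
      case (elim z)
      then have z: "0 < z" "z < \<rho>" by auto
      have F1: "F z \<ge> 1" "3 * K / e \<le> F z" using elim(1) by (simp_all only: max.bounded_iff)
      have b: "d n * z ^ n \<le> (if n < n0 then d n * \<rho> ^ n else 0) + (e / 3) * (real (s n) * z ^ n)" for n
      proof (cases "n < n0")
        case True
        have "d n * z ^ n \<le> d n * \<rho> ^ n" using z by (intro mult_left_mono power_mono) (auto simp: d_def)
        then show ?thesis using True z e by (simp add: add_increasing2)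
      next
        case False
        then have "d n \<le> (e / 3) * real (s n)" using n0 by (simp add: d_def)
        from mult_right_mono[OF this, of "z ^ n"] show ?thesis using False z by (simp add: mult.assoc)
      qed
      have s1: "(\<lambda>n. if n < n0 then d n * \<rho> ^ n else 0) sums K"
        unfolding K_def using sums_If_finite_set[of "{..<n0}" "\<lambda>n. d n * \<rho> ^ n"] by simp
      have s2: "(\<lambda>n. (e / 3) * (real (s n) * z ^ n)) sums ((e / 3) * F z)"
        unfolding F_def by (intro sums_mult summable_sums sums z)
      have s3: "(\<lambda>n. real (t n) * z ^ n - D / C * (real (s n) * z ^ n)) sums (G z - D / C * F z)"
        unfolding F_def G_def by (intro sums_diff sums_mult summable_sums sums tsums z)
      have sb: "summable (\<lambda>n. (if n < n0 then d n * \<rho> ^ n else 0) + (e / 3) * (real (s n) * z ^ n))"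
        using sums_add[OF s1 s2] by (rule sums_summable)
      have ab: "norm (real (t n) * z ^ n - D / C * (real (s n) * z ^ n)) = d n * z ^ n" for n
      proof -
        have "real (t n) * z ^ n - D / C * (real (s n) * z ^ n) = (real (t n) - D / C * real (s n)) * z ^ n"
          by (simp add: algebra_simps)
        then show ?thesis using z by (simp add: d_def abs_mult)
      qed
      have sd: "summable (\<lambda>n. d n * z ^ n)"
        by (rule summable_comparison_test'[OF sb, of 0]) (use b z in \<open>auto simp: d_def abs_mult\<close>)
      have "\<bar>G z - D / C * F z\<bar> \<le> (\<Sum>n. d n * z ^ n)"
      proof -
        have "norm (\<Sum>n. real (t n) * z ^ n - D / C * (real (s n) * z ^ n)) \<le> (\<Sum>n. d n * z ^ n)"
          using summable_norm[of "\<lambda>n. real (t n) * z ^ n - D / C * (real (s n) * z ^ n)"] sd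
          unfolding ab by blast
        then show ?thesis unfolding sums_unique[OF s3, symmetric] real_norm_def .
      qed
      also have "\<dots> \<le> K + (e / 3) * F z"
        using suminf_le[OF b sd sb] sums_unique[OF sums_add[OF s1 s2]] by simp
      also have "K \<le> (e / 3) * F z" using F1(2) e by (simp add: field_simps)
      also have "(e / 3) * F z + (e / 3) * F z < e * F z" using e F1 by simp
      finally have "\<bar>G z - D / C * F z\<bar> < e * F z" by simp
      moreover have "G z / F z - D / C = (G z - D / C * F z) / F z" using F1 by (simp add: diff_divide_distrib)
      ultimately show ?case using F1 by (simp add: dist_real_def abs_divide pos_divide_less_eq del: times_divide_eq_left)
    qed
  qed
  \<comment> \<open>The reciprocal characteristic polynomial of the recurrence. Its product with a
    generating function leaves only terms from finitely many initial values, which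
    \<open>num\<close> collects.\<close>
  define Q where "Q = (\<Sum>i\<le>N. monom (c i) (N - i))"
  define num where "num = (\<lambda>s. \<Sum>i\<le>N. monom (c i) (N - i) * (\<Sum>n<i. monom (of_nat (s n)) n))"
  have "coeff Q (N - i0) = (\<Sum>i\<le>N. if i = i0 then c i else 0)"
    unfolding Q_def coeff_sum using c(1) by (intro sum.cong) auto
  then have "coeff Q (N - i0) = c i0" using c(1) by simp
  then have Q0: "Q \<noteq> 0" using c by auto
  have numer: "rpoly z Q * (\<Sum>n. real (u n) * z ^ n) = rpoly z (num u)"
    if sm: "summable (\<lambda>n. real (u n) * z ^ n)"
      and rc: "\<And>n. (\<Sum>i\<le>N. c i * of_nat (u (n + i))) = 0" and z: "z > 0" for u z
  proof -
    have sh: "summable (\<lambda>n. real (u (n + i)) * z ^ n)" for i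
    proof -
      have "summable (\<lambda>n. inverse (z ^ i) * (real (u (n + i)) * z ^ (n + i)))"
        using summable_ignore_initial_segment[OF sm, of i] by (rule summable_mult)
      then show ?thesis using z by (simp add: power_add field_simps)
    qed
    define T where "T = (\<lambda>i. \<Sum>n. real (u (n + i)) * z ^ n)"
    have split: "(\<Sum>n. real (u n) * z ^ n) = (\<Sum>n<i. real (u n) * z ^ n) + z ^ i * T i" for i
    proof -
      have "(\<Sum>n. real (u n) * z ^ n) = (\<Sum>n. real (u (n + i)) * z ^ (n + i)) + (\<Sum>n<i. real (u n) * z ^ n)"
        by (rule suminf_split_initial_segment[OF sm])
      also have "(\<Sum>n. real (u (n + i)) * z ^ (n + i)) = (\<Sum>n. z ^ i * (real (u (n + i)) * z ^ n))"
        by (simp add: power_add mult_ac)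
      also have "\<dots> = z ^ i * T i" unfolding T_def by (rule suminf_mult[OF sh])
      finally show ?thesis by simp
    qed
    have "(\<Sum>i\<le>N. of_rat (c i) * T i) = (\<Sum>i\<le>N. \<Sum>n. of_rat (c i) * (real (u (n + i)) * z ^ n))"
      unfolding T_def by (intro sum.cong refl suminf_mult[symmetric] sh)
    also have "\<dots> = (\<Sum>n. \<Sum>i\<le>N. of_rat (c i) * (real (u (n + i)) * z ^ n))"
      by (intro suminf_sum[symmetric] summable_mult sh)
    also have "(\<lambda>n. \<Sum>i\<le>N. of_rat (c i) * (real (u (n + i)) * z ^ n)) = (\<lambda>n. 0)"
    proof
      fix n
      have "(\<Sum>i\<le>N. of_rat (c i) * (real (u (n + i)) * z ^ n)) = of_rat (\<Sum>i\<le>N. c i * of_nat (u (n + i))) * z ^ n"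
        by (simp add: of_rat_sum of_rat_mult sum_distrib_right mult.assoc)
      then show "(\<Sum>i\<le>N. of_rat (c i) * (real (u (n + i)) * z ^ n)) = 0" by (simp add: rc)
    qed
    finally have T0: "(\<Sum>i\<le>N. of_rat (c i) * T i) = 0" by simp
    have "rpoly z Q * (\<Sum>n. real (u n) * z ^ n) = (\<Sum>i\<le>N. of_rat (c i) * z ^ (N - i) * (\<Sum>n. real (u n) * z ^ n))"
      by (simp add: Q_def rpoly_sum sum_distrib_right)
    also have "\<dots> = (\<Sum>i\<le>N. of_rat (c i) * z ^ (N - i) * (\<Sum>n<i. real (u n) * z ^ n) + z ^ N * (of_rat (c i) * T i))"
    proof (intro sum.cong refl)
      fix i assume "i \<in> {..N}"
      then have "z ^ N = z ^ (N - i) * z ^ i" by (simp flip: power_add)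
      then show "of_rat (c i) * z ^ (N - i) * (\<Sum>n. real (u n) * z ^ n) =
         of_rat (c i) * z ^ (N - i) * (\<Sum>n<i. real (u n) * z ^ n) + z ^ N * (of_rat (c i) * T i)"
        by (subst split[of i]) (simp add: algebra_simps)
    qed
    also have "\<dots> = rpoly z (num u) + z ^ N * (\<Sum>i\<le>N. of_rat (c i) * T i)"
      by (simp add: num_def rpoly_sum sum.distrib sum_distrib_left)
    finally show ?thesis using T0 by simp
  qed
  have "\<forall>\<^sub>F z in at_left \<rho>. rpoly z (num t) / rpoly z (num s) = G z / F z"
    using near eventually_rpoly_nonzero[OF Q0]
  proof eventually_elim
    case (elim z)
    have "rpoly z (num s) = rpoly z Q * F z" "rpoly z (num t) = rpoly z Q * G z"
      unfolding F_def G_def using numer[OF sums recs] numer[OF tsums rect] elim by auto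
    then show ?case using elim by simp
  qed
  then have "((\<lambda>z. rpoly z (num t) / rpoly z (num s)) \<longlongrightarrow> D / C) (at_left \<rho>)"
    by (rule iffD2[OF tendsto_cong GF])
  \<comment> \<open>A zero numerator would make \<open>F\<close> vanish wherever \<open>Q\<close>
    does not, but \<open>F\<close> tends to infinity at \<rho>.\<close>
  moreover have "num s \<noteq> 0"
  proof
    assume n0: "num s = 0"
    have "\<forall>\<^sub>F z in at_left \<rho>. F z \<ge> 1" using Finf by (simp add: filterlim_at_top)
    then have "\<forall>\<^sub>F z in at_left \<rho>. False"
      using near eventually_rpoly_nonzero[OF Q0]
    proof eventually_elim
      case (elim z)
      have "rpoly z Q * F z = rpoly z (num s)"
        unfolding F_def using elim(2) by (intro numer[OF sums recs]) auto
      then show ?case using elim n0 by simp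
    qed
    then show False by simp
  qed
  ultimately show ?thesis unfolding \<rho>_def by (rule in_rational_field_limit)
qed

section \<open>Gaps in self-similar words\<close>

text \<open>The word is its own image, stated by positions so that arguments about factors become
  arithmetic. The growth of the first letter suffices to push the image of every later position
  strictly to the right.\<close>

locale self_similar_word =
  fixes g :: "'a \<Rightarrow> 'a list" and w :: "nat \<Rightarrow> 'a"
  assumes nonempty: "g c \<noteq> []"
    and image: "p < length (g (w s)) \<Longrightarrow> w ((\<Sum>r<s. length (g (w r))) + p) = g (w s) ! p"
    and expanding: "length (g (w 0)) \<ge> 2"
begin

text \<open>The start of the image of position \<open>s\<close>, equivalently the length of the
  image of the prefix of length \<open>s\<close>.\<close>

definition pos :: "nat \<Rightarrow> nat" where
  "pos s = (\<Sum>r<s. length (g (w r)))"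

lemma pos_0 [simp]: "pos 0 = 0"
  by (simp add: pos_def)

lemma pos_Suc: "pos (Suc s) = pos s + length (g (w s))"
  by (simp add: pos_def)

lemma image_pos: "p < length (g (w s)) \<Longrightarrow> w (pos s + p) = g (w s) ! p"
  using image by (simp add: pos_def)

lemma strict_mono_pos: "strict_mono pos"
  using nonempty by (simp add: strict_mono_Suc_iff pos_Suc)

lemma pos_mono: "s \<le> t \<Longrightarrow> pos s \<le> pos t"
  using strict_mono_pos by (simp add: strict_mono_less_eq)

lemma pos_gt: "s > 0 \<Longrightarrow> s < pos s"
proof (induction s)
  case (Suc s)
  show ?case
  proof (cases "s = 0")
    case True then show ?thesis using expanding by (simp add: pos_Suc)
  next
    case False
    then have "s < pos s" "pos s < pos (Suc s)"
      using Suc strict_mono_pos by (auto simp: strict_mono_less)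
    then show ?thesis by simp
  qed
qed simp

lemma letter_at: "pos s \<le> n \<Longrightarrow> n < pos (Suc s) \<Longrightarrow> w n = g (w s) ! (n - pos s)"
  using image_pos[of "n - pos s" s] by (simp add: pos_Suc)

lemma pos_cover:
  obtains s where "pos s \<le> n" "n < pos (Suc s)"
proof -
  define s where "s = (LEAST s. n < pos (Suc s))"
  have "n < pos (Suc n)" using pos_gt[of "Suc n"] by simp
  then have 1: "n < pos (Suc s)" unfolding s_def by (rule LeastI)
  have "pos s \<le> n"
  proof (cases s)
    case (Suc s')
    then have "\<not> n < pos (Suc s')" using not_less_Least[of s' "\<lambda>s. n < pos (Suc s)"] by (simp add: s_def)
    then show ?thesis using Suc by simp
  qed simp
  then show ?thesis using 1 that by blast
qed

lemma pos_less_cancel: "pos s < pos t \<Longrightarrow> s < t"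
  using strict_mono_pos by (simp add: strict_mono_less)

lemma morph_prefix: "morph g (map w [0..<s]) = map w [0..<pos s]"
proof (induction s)
  case (Suc s)
  have "map w [pos s..<pos (Suc s)] = g (w s)"
    by (rule nth_equalityI) (auto simp: pos_Suc image_pos)
  moreover have "[0..<pos (Suc s)] = [0..<pos s] @ [pos s..<pos (Suc s)]"
    using upt_add_eq_append[of 0 "pos s"] by (simp add: pos_Suc)
  ultimately show ?case using Suc by simp
qed simp

definition marks :: "'a set \<Rightarrow> 'a \<Rightarrow> nat set" where
  "marks X c = {p. p < length (g c) \<and> g c ! p \<in> X}"

text \<open>\<open>True\<close> serves the left end of a gap, which moves to the last mark of its
  image, and \<open>False\<close> the right end, which moves to the first. The default 0 still lies
  inside the nonempty image.\<close>

definition end_mark :: "'a set \<Rightarrow> bool \<Rightarrow> 'a \<Rightarrow> nat" where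
  "end_mark X b c = (if marks X c = {} then 0 else if b then Max (marks X c) else Min (marks X c))"

definition track :: "'a set \<Rightarrow> bool \<Rightarrow> nat \<Rightarrow> nat" where
  "track X b s = pos s + end_mark X b (w s)"

definition gap :: "'a set \<Rightarrow> nat \<Rightarrow> nat \<Rightarrow> bool" where
  "gap X s t \<longleftrightarrow> s < t \<and> w s \<in> X \<and> w t \<in> X \<and> (\<forall>r. s < r \<and> r < t \<longrightarrow> w r \<notin> X)"

text \<open>The factor from \<open>s\<close> to \<open>t\<close> occurs again, at \<open>s'\<close>
  and not further left. The equation says that the lengths agree, without subtraction.\<close>

definition recurs :: "nat \<Rightarrow> nat \<Rightarrow> nat \<Rightarrow> nat \<Rightarrow> bool" where
  "recurs s t s' t' \<longleftrightarrow> s \<le> s' \<and> s < t \<and> t + s' = t' + s \<and> (\<forall>r\<le>t - s. w (s + r) = w (s' + r))"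

lemma finite_marks [simp]: "finite (marks X c)"
  by (simp add: marks_def)

lemma end_mark_in: "marks X c \<noteq> {} \<Longrightarrow> end_mark X b c \<in> marks X c"
  by (auto simp: end_mark_def)

lemma end_mark_less: "end_mark X b c < length (g c)"
proof (cases "marks X c = {}")
  case False
  then show ?thesis using end_mark_in[OF False, of b] by (auto simp: marks_def)
qed (use nonempty in \<open>auto simp: end_mark_def\<close>)

lemma le_end_mark: "p \<in> marks X c \<Longrightarrow> p \<le> end_mark X True c"
  by (auto simp: end_mark_def)

lemma end_mark_le: "p \<in> marks X c \<Longrightarrow> end_mark X False c \<le> p"
  by (auto simp: end_mark_def)

lemma pos_le_track: "pos s \<le> track X b s"
  by (simp add: track_def)

lemma track_less: "track X b s < pos (Suc s)"
  using end_mark_less by (simp add: track_def pos_Suc)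

lemma track_less_track: "s < t \<Longrightarrow> track X b s < track X' b' t"
  using track_less[of X b s] pos_mono[of "Suc s" t] pos_le_track[of t X' b'] by simp

lemma track_in:
  assumes "marks X (w s) \<noteq> {}"
  shows "w (track X b s) \<in> X"
  using end_mark_in[OF assms, of b] letter_at[OF pos_le_track track_less, of X b s]
  by (simp add: track_def marks_def)

lemma mark_at: "pos s \<le> n \<Longrightarrow> n < pos (Suc s) \<Longrightarrow> w n \<in> X \<Longrightarrow> n - pos s \<in> marks X (w s)"
  using letter_at[of s n] by (auto simp: marks_def pos_Suc)

text \<open>A letter of \<open>X\<close> strictly inside would come from a position of
  \<open>Y\<close> between \<open>s\<close> and \<open>t\<close> inclusive. The choice of the last
  and the first mark excludes the two ends, the gap excludes everything in between.\<close>

lemma gap_image: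
  assumes XY: "\<And>c. c \<in> Y \<longleftrightarrow> marks X c \<noteq> {}" and gap: "gap Y s t"
  shows "gap X (track X True s) (track X False t)"
proof -
  have "w r \<notin> X" if r: "track X True s < r" "r < track X False t" for r
  proof
    assume wr: "w r \<in> X"
    obtain q where q: "pos q \<le> r" "r < pos (Suc q)" by (rule pos_cover)
    note mk = mark_at[OF q wr]
    have "pos s < pos (Suc q)" using pos_le_track[of s X True] r(1) q(2) by linarith
    then have sq: "s \<le> q" using pos_less_cancel less_Suc_eq_le by blast
    have "pos q < pos (Suc t)" using track_less[of X False t] r(2) q(1) by linarith
    then have qt: "q \<le> t" using pos_less_cancel less_Suc_eq_le by blast
    have "q \<noteq> s" using le_end_mark mk r(1) q(1) by (fastforce simp: track_def)
    moreover have "q \<noteq> t" using end_mark_le mk r(2) q(1) by (fastforce simp: track_def)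
    ultimately have "w q \<notin> Y" using gap sq qt by (auto simp: gap_def)
    then show False using XY mk by auto
  qed
  moreover have "w s \<in> Y" "w t \<in> Y" "s < t" using gap by (auto simp: gap_def)
  ultimately show ?thesis using track_in XY track_less_track by (auto simp: gap_def)
qed

text \<open>If the ends come from different letters, these belong to \<open>Y\<close>, and a further
  letter of \<open>Y\<close> between them would place a letter of \<open>X\<close> inside the gap.
  Keeping \<open>X\<close> and \<open>Y\<close> apart covers both the descent inside
  \<open>Y\<close> and the last step to the complement of \<Delta>.\<close>

lemma gap_preimage:
  assumes XY: "\<And>c. c \<in> Y \<longleftrightarrow> marks X c \<noteq> {}" and gap: "gap X s' t'"
  shows "(\<exists>q. pos q \<le> s' \<and> t' < pos (Suc q)) \<or>
    (\<exists>s t. gap Y s t \<and> s' = track X True s \<and> t' = track X False t)"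
proof -
  obtain s where s: "pos s \<le> s'" "s' < pos (Suc s)" by (rule pos_cover)
  obtain t where t: "pos t \<le> t'" "t' < pos (Suc t)" by (rule pos_cover)
  have g: "s' < t'" "w s' \<in> X" "w t' \<in> X" "\<And>r. s' < r \<Longrightarrow> r < t' \<Longrightarrow> w r \<notin> X"
    using gap by (auto simp: gap_def)
  have "pos s < pos (Suc t)" using s t g by linarith
  then have "s \<le> t" using pos_less_cancel less_Suc_eq_le by blast
  show ?thesis
  proof (cases "s = t")
    case True then show ?thesis using s t by blast
  next
    case False
    then have st: "s < t" using \<open>s \<le> t\<close> by simp
    note ms = mark_at[OF s g(2)]
    note mt = mark_at[OF t g(3)]
    have sY: "w s \<in> Y" and tY: "w t \<in> Y" using XY ms mt by auto
    have pst: "pos (Suc s) \<le> pos t" using st by (intro pos_mono) simp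
    have "w r \<notin> Y" if r: "s < r" "r < t" for r
    proof
      assume "w r \<in> Y"
      then have "w (track X True r) \<in> X" using XY track_in by auto
      moreover have "s' < track X True r"
        using s(2) pos_mono[of "Suc s" r] r pos_le_track[of r X True] by simp
      moreover have "track X True r < t'"
        using t(1) pos_mono[of "Suc r" t] r track_less[of X True r] by simp
      ultimately show False using g(4) by blast
    qed
    then have "gap Y s t" using sY tY st by (auto simp: gap_def)
    moreover have "s' = track X True s"
    proof (rule ccontr)
      assume "s' \<noteq> track X True s"
      moreover have "s' \<le> track X True s" using le_end_mark[OF ms] s(1) by (simp add: track_def)
      ultimately have "s' < track X True s" by simp
      moreover have "track X True s < t'" using track_less[of X True s] pst t(1) by simp
      moreover have "w (track X True s) \<in> X" using sY XY track_in by auto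
      ultimately show False using g(4) by blast
    qed
    moreover have "t' = track X False t"
    proof (rule ccontr)
      assume "t' \<noteq> track X False t"
      moreover have "track X False t \<le> t'" using end_mark_le[OF mt] t(1) by (simp add: track_def)
      ultimately have "track X False t < t'" by simp
      moreover have "s' < track X False t" using pos_le_track[of t X False] pst s(2) by simp
      moreover have "w (track X False t) \<in> X" using tY XY track_in by auto
      ultimately show False using g(4) by blast
    qed
    ultimately show ?thesis by blast
  qed
qed

lemma infinite_preimage:
  assumes XY: "\<And>c. c \<in> Y \<longleftrightarrow> marks X c \<noteq> {}" and inf: "infinite {n. w n \<in> X}"
  shows "infinite {n. w n \<in> Y}"
proof
  assume "finite {n. w n \<in> Y}"
  then obtain N where N: "\<And>n. w n \<in> Y \<Longrightarrow> n < N"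
    by (metis (mono_tags, lifting) finite_nat_bounded lessThan_iff mem_Collect_eq subsetD)
  have "n < pos (Suc N)" if X: "w n \<in> X" for n
  proof -
    obtain q where q: "pos q \<le> n" "n < pos (Suc q)" by (rule pos_cover)
    have "q < N" using mark_at[OF q X] XY N by blast
    then have "pos (Suc q) \<le> pos (Suc N)" by (intro pos_mono) simp
    then show ?thesis using q by simp
  qed
  then have "{n. w n \<in> X} \<subseteq> {..<pos (Suc N)}" by auto
  then show False using inf finite_subset by blast
qed

lemma recurs_pos:
  assumes "recurs s t s' t'" "r \<le> Suc (t - s)"
  shows "pos (s + r) + pos s' = pos (s' + r) + pos s"
  using assms(2)
proof (induction r)
  case (Suc r)
  then have "w (s + r) = w (s' + r)" using assms(1) by (simp add: recurs_def)
  then show ?case using Suc by (simp add: pos_Suc)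
qed simp

lemma recurs_letter:
  assumes R: "recurs s t s' t'" and o: "pos s + k < pos (Suc t)"
  shows "w (pos s + k) = w (pos s' + k)"
proof -
  obtain q where q: "pos q \<le> pos s + k" "pos s + k < pos (Suc q)" by (rule pos_cover)
  have "pos s < pos (Suc q)" using q by linarith
  then have sq: "s \<le> q" using pos_less_cancel less_Suc_eq_le by blast
  have "pos q < pos (Suc t)" using q o by linarith
  then have qt: "q \<le> t" using pos_less_cancel less_Suc_eq_le by blast
  define r where "r = q - s"
  have r: "q = s + r" "r \<le> t - s" using sq qt by (auto simp: r_def)
  have st: "s < t" using R by (simp add: recurs_def)
  have 1: "pos (s + r) + pos s' = pos (s' + r) + pos s" using r by (intro recurs_pos[OF R]) simp
  have 2: "pos (s + Suc r) + pos s' = pos (s' + Suc r) + pos s" using r by (intro recurs_pos[OF R]) simp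
  have "w (pos s + k) = g (w q) ! (pos s + k - pos q)" using q by (rule letter_at)
  moreover have "w (pos s' + k) = g (w (s' + r)) ! (pos s' + k - pos (s' + r))"
    by (rule letter_at) (use 1 2 q in \<open>auto simp: r\<close>)
  moreover have "w q = w (s' + r)" using R r by (simp add: recurs_def)
  moreover have "pos s + k - pos q = pos s' + k - pos (s' + r)" using 1 r by simp
  ultimately show ?thesis by simp
qed

text \<open>The whole image of a repeated factor is repeated, and the end marks depend only on the
  letters at its two ends.\<close>

lemma recurs_track:
  assumes R: "recurs s t s' t'"
  shows "recurs (track X True s) (track X False t) (track X True s') (track X False t')"
proof -
  have st: "s \<le> s'" "s < t" "t + s' = t' + s" "\<And>r. r \<le> t - s \<Longrightarrow> w (s + r) = w (s' + r)"
    using R by (auto simp: recurs_def)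
  have ws: "w s = w s'" using st(4)[of 0] by simp
  have wt: "w t = w t'" using st(4)[of "t - s"] st(2,3) by (metis add_diff_inverse_nat diff_add_inverse2 le_refl less_imp_le not_less add.commute Nat.add_diff_assoc)
  have t': "t' = s' + (t - s)" using st by simp
  have p: "pos t + pos s' = pos t' + pos s"
    using recurs_pos[OF R, of "t - s"] st(2) by (simp add: t')
  have "w (track X True s + r) = w (track X True s' + r)" if "r \<le> track X False t - track X True s" for r
  proof -
    have "track X True s + r < pos (Suc t)"
      using that track_less[of X False t] track_less_track[OF st(2), of X True X False] by linarith
    then show ?thesis
      using recurs_letter[OF R, of "end_mark X True (w s) + r"] ws by (simp add: track_def add.assoc)
  qed
  moreover have "track X True s \<le> track X True s'" using pos_mono[OF st(1)] ws by (simp add: track_def)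
  moreover have "track X False t + track X True s' = track X False t' + track X True s"
    using p ws wt by (simp add: track_def)
  ultimately show ?thesis using track_less_track[OF st(2)] by (auto simp: recurs_def)
qed

end

text \<open>Stability is what allows \<open>track Y\<close> to be iterated on gaps of
  \<open>Y\<close>.\<close>

locale marked_word = self_similar_word g w for g :: "'a::finite \<Rightarrow> 'a list" and w +
  fixes Y :: "'a set"
  assumes stable: "c \<in> Y \<longleftrightarrow> marks Y c \<noteq> {}"
    and infinite_marked: "infinite {n. w n \<in> Y}"
begin

text \<open>Only position 0 is critical. If the last mark in the image of the first letter were at
  0, then passing from a position of \<open>Y\<close> to the position whose image contains it would
  always end in 0 and show that 0 is the only position of \<open>Y\<close>.\<close>

lemma less_track:
  assumes "w s \<in> Y"
  shows "s < track Y True s"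
proof (cases "s = 0")
  case False
  then show ?thesis using pos_gt[of s] pos_le_track[of s Y True] by simp
next
  case True
  show ?thesis
  proof (rule ccontr)
    assume "\<not> ?thesis"
    then have t0: "end_mark Y True (w 0) = 0" using True by (simp add: track_def)
    have "n = 0" if "w n \<in> Y" for n
      using that
    proof (induction n rule: less_induct)
      case (less n)
      obtain q where q: "pos q \<le> n" "n < pos (Suc q)" by (rule pos_cover)
      note mk = mark_at[OF q less.prems]
      have wq: "w q \<in> Y" using mk stable by auto
      have "q = 0"
      proof (rule ccontr)
        assume "q \<noteq> 0"
        then have "q < n" using pos_gt[of q] q(1) by simp
        then show False using less.IH[OF _ wq] \<open>q \<noteq> 0\<close> by simp
      qed
      then show ?case using le_end_mark[OF mk] t0 by simp
    qed
    then have "{n. w n \<in> Y} \<subseteq> {0}" by auto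
    then show False using infinite_marked finite_subset by blast
  qed
qed

lemma gap_iterate: "gap Y s t \<Longrightarrow> gap Y ((track Y True ^^ n) s) ((track Y False ^^ n) t)"
proof (induction n)
  case (Suc n)
  then show ?case using gap_image[OF stable Suc.IH[OF Suc.prems]] by simp
qed simp

lemma recurs_iterate:
  "recurs s t s' t' \<Longrightarrow> recurs ((track X True ^^ n) s) ((track X False ^^ n) t) ((track X True ^^ n) s') ((track X False ^^ n) t')"
proof (induction n)
  case (Suc n)
  then show ?case using recurs_track[OF Suc.IH[OF Suc.prems]] by simp
qed simp

text \<open>The left end decreases strictly under preimages, so a gap inside the image of a single
  letter is reached.\<close>

lemma gap_descent:
  assumes "gap Y s' t'"
  shows "\<exists>s t n q. gap Y s t \<and> pos q \<le> s \<and> t < pos (Suc q) \<and>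
    s' = (track Y True ^^ n) s \<and> t' = (track Y False ^^ n) t"
  using assms
proof (induction s' arbitrary: t' rule: less_induct)
  case (less s')
  from gap_preimage[OF stable less.prems] show ?case
  proof
    assume "\<exists>q. pos q \<le> s' \<and> t' < pos (Suc q)"
    then show ?thesis using less.prems by (metis funpow_0)
  next
    assume "\<exists>s t. gap Y s t \<and> s' = track Y True s \<and> t' = track Y False t"
    then obtain s t where st: "gap Y s t" "s' = track Y True s" "t' = track Y False t" by blast
    have "s < s'" using less_track st by (auto simp: gap_def)
    from less.IH[OF this st(1)] obtain s0 t0 n q where "gap Y s0 t0" "pos q \<le> s0" "t0 < pos (Suc q)"
      "s = (track Y True ^^ n) s0" "t = (track Y False ^^ n) t0" by blast
    then show ?thesis using st
      by (intro exI[of _ s0] exI[of _ t0] exI[of _ "Suc n"] exI[of _ q]) simp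
  qed
qed

text \<open>A gap inside one image is determined up to translation by the letter and two offsets.
  The representative of such a type uses the leftmost position \<open>q\<close> at which it occurs,
  so every other gap of this type is a copy at or to the right of it, as \<open>recurs\<close>
  demands.\<close>

lemma finitely_many_base_gaps:
  obtains B where "finite B" "\<And>s t. (s, t) \<in> B \<Longrightarrow> gap Y s t"
    "\<And>s t q. gap Y s t \<Longrightarrow> pos q \<le> s \<Longrightarrow> t < pos (Suc q) \<Longrightarrow> \<exists>(s0, t0)\<in>B. recurs s0 t0 s t"
proof -
  define P where "P = (\<lambda>(c, p, p') q. w q = c \<and> p < p' \<and> p' < length (g c) \<and> gap Y (pos q + p) (pos q + p'))"
  define Ty where "Ty = (SIGMA c:UNIV. {..<length (g c)} \<times> {..<length (g c)})"
  define base where "base = (\<lambda>ty. (pos (LEAST q. P ty q) + fst (snd ty), pos (LEAST q. P ty q) + snd (snd ty)))"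
  define B where "B = base ` {ty \<in> Ty. \<exists>q. P ty q}"
  have "finite Ty" unfolding Ty_def by (intro finite_SigmaI) auto
  then have "finite B" by (simp add: B_def)
  moreover have "gap Y s t" if st: "(s, t) \<in> B" for s t
  proof -
    obtain c p p' q where ty: "(s, t) = base (c, p, p')" "P (c, p, p') q"
      using st by (auto simp: B_def)
    define q0 where "q0 = (LEAST q. P (c, p, p') q)"
    from ty(2) have "P (c, p, p') q0" unfolding q0_def by (rule LeastI)
    moreover have "s = pos q0 + p" "t = pos q0 + p'" using ty(1) by (simp_all add: base_def q0_def)
    ultimately show ?thesis by (simp add: P_def)
  qed
  moreover have "\<exists>(s0, t0)\<in>B. recurs s0 t0 s t" if g: "gap Y s t" "pos q \<le> s" "t < pos (Suc q)" for s t q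
  proof -
    define ty where "ty = (w q, s - pos q, t - pos q)"
    have st: "s < t" using g by (simp add: gap_def)
    have Pq: "P ty q" using g st by (auto simp: P_def ty_def pos_Suc)
    then have "ty \<in> Ty" using g by (auto simp: Ty_def ty_def P_def)
    then have B: "base ty \<in> B" using Pq by (auto simp: B_def)
    define q0 where "q0 = (LEAST q. P ty q)"
    have "P ty q0" unfolding q0_def using Pq by (rule LeastI)
    then have wq: "w q0 = w q" by (simp add: P_def ty_def)
    have "q0 \<le> q" unfolding q0_def using Pq by (rule Least_le)
    then have pq: "pos q0 \<le> pos q" by (rule pos_mono)
    have b: "base ty = (pos q0 + (s - pos q), pos q0 + (t - pos q))"
      by (simp add: base_def q0_def ty_def)
    have "w (pos q0 + (s - pos q) + r) = w (s + r)" if "r \<le> t - s" for r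
    proof -
      have l: "s - pos q + r < length (g (w q))" using that g st by (simp add: pos_Suc)
      have "w (s + r) = w (pos q + (s - pos q + r))" using g by simp
      also have "\<dots> = g (w q) ! (s - pos q + r)" using image_pos[OF l] by simp
      also have "\<dots> = w (pos q0 + (s - pos q + r))"
        using image_pos[of "s - pos q + r" q0] l by (simp add: wq)
      finally show ?thesis by (simp add: add.assoc)
    qed
    moreover have "pos q0 + (t - pos q) - (pos q0 + (s - pos q)) = t - s" using g st by simp
    ultimately have "recurs (pos q0 + (s - pos q)) (pos q0 + (t - pos q)) s t"
      using pq g st by (auto simp: recurs_def)
    then show ?thesis using B b by fastforce
  qed
  ultimately show ?thesis using that by blast
qed

end

section \<open>Iterates of gaps\<close>

text \<open>More iterates than letters give a linear relation between their length vectors. Lengths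
  are additive, so one relation serves all words over \<open>A\<close>, including the
  \<open>n\<close>-th iterate of \<open>u\<close>. Its order \<open>N\<close> later becomes a degree
  bound.\<close>

lemma length_recurrence:
  assumes A: "finite A" "card A \<le> N" "\<And>x. x \<in> A \<Longrightarrow> set (g x) \<subseteq> A"
  obtains c :: "nat \<Rightarrow> rat" and i0 where "i0 \<le> N" "c i0 \<noteq> 0"
    "\<And>u n. set u \<subseteq> A \<Longrightarrow> (\<Sum>i\<le>N. c i * of_nat (length (morph_pow g (m * i + n) u))) = 0"
proof -
  obtain c where c: "\<exists>i\<in>{..N}. c i \<noteq> 0"
    "\<forall>x\<in>A. (\<Sum>i\<le>N. c i * rat_of_nat (length (morph_pow g (m * i) [x]))) = 0"
    using linear_dependence[of A "{..N}" "\<lambda>i x. rat_of_nat (length (morph_pow g (m * i) [x]))"] A by auto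
  have *: "(\<Sum>i\<le>N. c i * of_nat (length (morph_pow g (m * i) u))) = 0" if "set u \<subseteq> A" for u
    using that
  proof (induction u)
    case (Cons x u)
    then show ?case using c(2)
      by (subst length_morph_pow) (simp add: distrib_left sum.distrib flip: length_morph_pow)
  qed simp
  have "(\<Sum>i\<le>N. c i * of_nat (length (morph_pow g (m * i + n) u))) = 0" if "set u \<subseteq> A" for u n
    unfolding morph_pow_add by (intro * set_morph_pow_closed A(3) that)
  then show ?thesis using that c(1) by auto
qed

text \<open>Absorbs the bounded offsets between lengths, tracked positions and ends of
  blocks.\<close>

lemma perturbed_quotient_tendsto:
  fixes a b :: "nat \<Rightarrow> real"
  assumes "(\<lambda>n. a n / b n) \<longlonglongrightarrow> L" "filterlim b at_top sequentially"
    "\<And>n. \<bar>a' n - a n\<bar> \<le> K" "\<And>n. \<bar>b' n - b n\<bar> \<le> K"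
  shows "(\<lambda>n. a' n / b' n) \<longlonglongrightarrow> L"
proof -
  have z: "(\<lambda>n. d n / b n) \<longlonglongrightarrow> 0" if d: "\<And>n. \<bar>d n\<bar> \<le> K" for d
  proof (rule tendsto_0_le[where K = 1])
    show "(\<lambda>n. K / b n) \<longlonglongrightarrow> 0"
      using assms(2) by (intro tendsto_divide_0[OF tendsto_const] filterlim_at_top_imp_at_infinity)
    show "\<forall>\<^sub>F n in sequentially. norm (d n / b n) \<le> norm (K / b n) * 1"
      using d order_trans[OF d abs_ge_self] by (intro always_eventually allI) (simp add: abs_divide divide_right_mono)
  qed
  have "(\<lambda>n. (a n / b n + (a' n - a n) / b n) / (1 + (b' n - b n) / b n)) \<longlonglongrightarrow> (L + 0) / (1 + 0)"
    by (intro tendsto_intros assms(1) z assms(3,4)) simp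
  then have "(\<lambda>n. (a n / b n + (a' n - a n) / b n) / (1 + (b' n - b n) / b n)) \<longlonglongrightarrow> L" by simp
  then show ?thesis
  proof (rule Lim_transform_eventually)
    have "\<forall>\<^sub>F n in sequentially. b n > 0" using assms(2) by (simp add: filterlim_at_top_dense)
    then show "\<forall>\<^sub>F n in sequentially. (a n / b n + (a' n - a n) / b n) / (1 + (b' n - b n) / b n) = a' n / b' n"
    proof eventually_elim
      case (elim n)
      have "a n / b n + (a' n - a n) / b n = a' n / b n" "1 + (b' n - b n) / b n = b' n / b n"
        using elim by (simp_all add: diff_divide_distrib)
      then show ?case using elim by simp
    qed
  qed
qed

context marked_word
begin

text \<open>\<open>Inl c\<close> has the full image of \<open>c\<close>; the letters \<open>Inr (b, c)\<close> have that image cut off after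
  its last (\<open>b\<close>) or first (\<open>\<not> b\<close>) marked letter, so that the length of the iterated image of a
  prefix of \<open>w\<close> ending in such a letter is one more than an iterate of \<open>track Y b\<close>.\<close>
definition tracker :: "'a + bool \<times> 'a \<Rightarrow> ('a + bool \<times> 'a) list" where
  "tracker x = (case x of Inl c \<Rightarrow> map Inl (g c)
     | Inr (b, c) \<Rightarrow> map Inl (take (end_mark Y b c) (g c)) @ [Inr (b, g c ! end_mark Y b c)])"

definition tracked_prefix :: "bool \<Rightarrow> nat \<Rightarrow> ('a + bool \<times> 'a) list" where
  "tracked_prefix b s = map Inl (map w [0..<s]) @ [Inr (b, w s)]"

text \<open>Restricted to letters that occur in \<open>w\<close>: others could grow faster than the
  prefixes of \<open>w\<close> and so change the common \<open>k\<close> and \<Lambda>.\<close>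

definition tracker_letters :: "('a + bool \<times> 'a) set" where
  "tracker_letters = Inl ` range w \<union> Inr ` (UNIV \<times> range w)"

lemma morph_tracker_Inl: "morph tracker (map Inl u) = map Inl (morph g u)"
  by (induction u) (auto simp: tracker_def)

lemma tracker_prefix:
  "morph_pow tracker n (map Inl (map w [0..<s])) = map Inl (map w [0..<(pos ^^ n) s])"
  by (induction n arbitrary: s)
    (simp_all add: morph_pow_Suc morph_tracker_Inl morph_prefix funpow_swap1 del: map_map)

lemma map_upt_track: "map w [0..<track Y b s] = map w [0..<pos s] @ take (end_mark Y b (w s)) (g (w s))"
proof -
  have "[0..<track Y b s] = [0..<pos s] @ [pos s..<track Y b s]"
    using upt_add_eq_append[of 0 "pos s"] by (simp add: track_def)
  moreover have "map w [pos s..<track Y b s] = take (end_mark Y b (w s)) (g (w s))"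
    using end_mark_less[of Y b "w s"] by (intro nth_equalityI) (auto simp: track_def image_pos)
  ultimately show ?thesis by simp
qed

lemma tracker_tracked_prefix:
  "morph_pow tracker n (tracked_prefix b s) = tracked_prefix b ((track Y b ^^ n) s)"
proof (induction n arbitrary: s)
  case (Suc n)
  have "w (track Y b s) = g (w s) ! end_mark Y b (w s)"
    using image_pos[OF end_mark_less] by (simp add: track_def)
  then have "morph tracker (tracked_prefix b s) = tracked_prefix b (track Y b s)"
    unfolding tracked_prefix_def map_upt_track
    by (simp add: morph_tracker_Inl morph_prefix tracker_def del: map_map)
  then show ?case using Suc by (simp add: morph_pow_Suc funpow_swap1)
qed simp

lemma length_tracked_prefix: "length (tracked_prefix b s) = Suc s"
  by (simp add: tracked_prefix_def)

lemma image_letters: "set (g (w s)) \<subseteq> range w"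
proof
  fix c assume "c \<in> set (g (w s))"
  then obtain p where "p < length (g (w s))" "c = g (w s) ! p" by (auto simp: in_set_conv_nth)
  then have "c = w (pos s + p)" by (simp add: image_pos)
  then show "c \<in> range w" by simp
qed

lemma tracker_closed: "x \<in> tracker_letters \<Longrightarrow> set (tracker x) \<subseteq> tracker_letters"
proof -
  have "g (w s) ! end_mark Y b (w s) \<in> range w" for b s
    using image_letters[of s] end_mark_less[of Y b "w s"] nth_mem by blast
  moreover have "set (take k (g (w s))) \<subseteq> range w" for k s
    using image_letters[of s] set_take_subset[of k "g (w s)"] by blast
  ultimately show "x \<in> tracker_letters \<Longrightarrow> set (tracker x) \<subseteq> tracker_letters"
    using image_letters by (fastforce simp: tracker_letters_def tracker_def)
qed

lemma tracker_Inl_closed: "x \<in> Inl ` range w \<Longrightarrow> set (tracker x) \<subseteq> Inl ` range w"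
  using image_letters by (fastforce simp: tracker_def)

lemma tracker_nonempty: "tracker x \<noteq> []"
  using nonempty by (auto simp: tracker_def split: sum.split)

lemma set_tracked_prefix: "set (tracked_prefix b s) \<subseteq> tracker_letters"
  by (auto simp: tracked_prefix_def tracker_letters_def)

section \<open>Tracked positions compared with iterated images of the first letter\<close>

definition max_image :: nat where
  "max_image = Max (range (\<lambda>c. length (g c)))"

lemma max_image: "length (g c) \<le> max_image"
  by (simp add: max_image_def)

lemma pos_Suc_le: "pos (Suc s) \<le> pos s + max_image"
  by (simp add: pos_Suc max_image)

lemma pos_le_mult: "pos t \<le> max_image * t"
proof (induction t)
  case (Suc t) then show ?case using pos_Suc_le[of t] by simp
qed simp

lemma pos_iterate_le_mult: "(pos ^^ q) t \<le> max_image ^ q * t"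
proof (induction q)
  case (Suc q)
  have "(pos ^^ Suc q) t \<le> max_image * (pos ^^ q) t" using pos_le_mult by simp
  also have "\<dots> \<le> max_image * (max_image ^ q * t)" using Suc by simp
  finally show ?case by (simp add: mult.assoc)
qed simp

lemma pos_iterate_mono: "s \<le> t \<Longrightarrow> (pos ^^ n) s \<le> (pos ^^ n) t"
  by (induction n) (auto intro: pos_mono)

lemma pos_iterate_ge: "q < (pos ^^ q) 1"
proof (induction q)
  case (Suc q)
  then have "(pos ^^ q) 1 < pos ((pos ^^ q) 1)" by (intro pos_gt) simp
  then show ?case using Suc by simp
qed simp

lemma pos_iterate_le_track: "(pos ^^ n) s \<le> (track X b ^^ n) s"
proof (induction n)
  case (Suc n)
  have "(pos ^^ Suc n) s \<le> pos ((track X b ^^ n) s)" using pos_mono[OF Suc] by simp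
  also have "\<dots> \<le> (track X b ^^ Suc n) s" using pos_le_track by simp
  finally show ?case .
qed simp

lemma track_iterate_less: "(track X b ^^ n) s < (pos ^^ n) (Suc s)"
proof (induction n)
  case (Suc n)
  then have "pos (Suc ((track X b ^^ n) s)) \<le> (pos ^^ Suc n) (Suc s)" by (simp add: pos_mono)
  then show ?case using track_less[of X b "(track X b ^^ n) s"] by simp
qed simp

lemma track_iterate_less_Suc:
  assumes "gap Y s t"
  shows "(track Y True ^^ n) s < (track Y True ^^ Suc n) s"
  using less_track gap_iterate[OF assms, of n] by (simp add: gap_def)

lemma track_iterate_ge:
  assumes "gap Y s t"
  shows "n \<le> (track Y True ^^ n) s"
proof (induction n)
  case (Suc n) then show ?case using track_iterate_less_Suc[OF assms, of n] by simp
qed simp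

lemma track_iterate_mono:
  assumes "gap Y s t" "i \<le> j"
  shows "(track Y True ^^ i) s \<le> (track Y True ^^ j) s"
  using lift_Suc_mono_le[of "\<lambda>n. (track Y True ^^ n) s" i j] assms(2)
    track_iterate_less_Suc[OF assms(1)] less_imp_le by blast

text \<open>The left end \<open>s\<close> may be 0, but one step makes it positive. From then on it
  stays to the right of the iterated image of the first letter; the lost step costs the factor
  \<open>max_image\<close>.\<close>

lemma pos_iterate_le_track_mult:
  assumes "gap Y s t" "n > 0"
  shows "(pos ^^ n) 1 \<le> max_image * (track Y True ^^ n) s"
proof -
  obtain n' where n: "n = Suc n'" using assms(2) gr0_implies_Suc by blast
  have "(pos ^^ n) 1 \<le> max_image * (pos ^^ n') 1" using pos_le_mult by (simp add: n)
  also have "(pos ^^ n') 1 \<le> (pos ^^ n') (track Y True s)"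
    using track_iterate_less_Suc[OF assms(1), of 0] by (intro pos_iterate_mono) simp
  also have "\<dots> \<le> (track Y True ^^ n') (track Y True s)" by (rule pos_iterate_le_track)
  also have "\<dots> = (track Y True ^^ n) s" by (simp add: n funpow_swap1)
  finally show ?thesis by simp
qed

text \<open>The letter ends a prefix of length \<open>Suc s\<close>, which is contained in the
  \<open>Suc s\<close>-fold image of the first letter. The extra \<open>Suc s\<close> iterations
  change lengths by at most the constant factor \<open>max_image ^ Suc s\<close>.\<close>

lemma tracker_letter_growth:
  assumes "x \<in> tracker_letters"
  shows "\<exists>C. \<forall>n. length (morph_pow tracker n [x]) \<le> C * (pos ^^ n) 1"
proof -
  obtain s where s: "\<And>n. length (morph_pow tracker n [x]) \<le> (pos ^^ n) (Suc s)"
  proof -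
    from assms consider s where "x = Inl (w s)" | b s where "x = Inr (b, w s)"
      by (auto simp: tracker_letters_def)
    then show ?thesis
    proof cases
      case 1
      have "length (morph_pow tracker n [x]) \<le> length (morph_pow tracker n (map Inl (map w [0..<Suc s])))" for n
        by (simp add: 1)
      then show ?thesis using that[of s] unfolding tracker_prefix by simp
    next
      case 2
      have "length (morph_pow tracker n [x]) \<le> length (morph_pow tracker n (tracked_prefix b s))" for n
        by (simp add: 2 tracked_prefix_def)
      then have "length (morph_pow tracker n [x]) \<le> Suc ((track Y b ^^ n) s)" for n
        unfolding tracker_tracked_prefix length_tracked_prefix .
      then show ?thesis using that[of s] track_iterate_less[of _ Y b s] by (meson Suc_leI order_trans)
    qed
  qed
  have "length (morph_pow tracker n [x]) \<le> max_image ^ Suc s * (pos ^^ n) 1" for n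
  proof -
    note s
    also have "(pos ^^ n) (Suc s) \<le> (pos ^^ n) ((pos ^^ Suc s) 1)"
      using pos_iterate_ge[of "Suc s"] by (intro pos_iterate_mono) simp
    also have "\<dots> = (pos ^^ Suc s) ((pos ^^ n) 1)" by (metis add.commute comp_apply funpow_add)
    also have "\<dots> \<le> max_image ^ Suc s * (pos ^^ n) 1" by (rule pos_iterate_le_mult)
    finally show ?thesis .
  qed
  then show ?thesis by blast
qed

text \<open>Some letter has a positive constant at the common rate, and its growth is bounded by
  that of the prefixes, which tracked left ends match. So all left ends have positive constants, and
  the quotients converge to quotients of constants.\<close>

theorem iterated_gap_quotients:
  obtains m \<rho> f where "m > 0" "f \<noteq> 0" "degree f \<le> card (UNIV :: 'a set)" "rpoly \<rho> f = 0"
    "\<exists>l. \<forall>c. length (g c) = l \<Longrightarrow> \<rho> \<in> \<rat>"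
    "\<And>s t r. gap Y s t \<Longrightarrow> \<exists>L. in_rational_field \<rho> L \<and>
      (\<lambda>n. real ((track Y False ^^ (m * n + r)) t) / real ((track Y True ^^ (m * n + r)) s)) \<longlonglongrightarrow> L"
proof -
  obtain m \<Lambda> k c where m: "m > 0" and L: "\<Lambda> > 0"
    and lim: "\<And>u r. set u \<subseteq> tracker_letters \<Longrightarrow>
       (\<lambda>n. wlen tracker (m * n + r) u / (real n ^ k * \<Lambda> ^ n)) \<longlonglongrightarrow> (\<Sum>x\<leftarrow>morph_pow tracker r u. c x)"
    and cpos: "\<exists>x\<in>tracker_letters. c x > 0"
  proof (rule morphism_growth[of tracker_letters tracker])
    show "tracker_letters \<noteq> {}" by (simp add: tracker_letters_def)
  qed (use tracker_closed tracker_nonempty in blast)+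
  obtain x0 where x0: "x0 \<in> tracker_letters" "c x0 > 0" using cpos by blast
  obtain C0 where C0: "\<And>n. length (morph_pow tracker n [x0]) \<le> C0 * (pos ^^ n) 1"
    using tracker_letter_growth[OF x0(1)] by blast
  have limx0: "(\<lambda>n. wlen tracker (m * n) [x0] / (real n ^ k * \<Lambda> ^ n)) \<longlonglongrightarrow> c x0"
    using lim[of "[x0]" 0] x0(1) by simp
  \<comment> \<open>Transfers positivity from the letter \<open>x0\<close>: a sequence that
    dominates the iterated prefix up to a factor also dominates the lengths for
    \<open>x0\<close>.\<close>
  have lower: "C > 0" if lim': "(\<lambda>n. real (u n) / (real n ^ k * \<Lambda> ^ n)) \<longlonglongrightarrow> C"
    and le: "\<And>n. n > 0 \<Longrightarrow> (pos ^^ (m * n)) 1 \<le> K * u n" for u C K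
  proof -
    have "c x0 \<le> real (C0 * K) * C"
    proof (rule LIMSEQ_le[OF limx0])
      show "(\<lambda>n. real (C0 * K) * (real (u n) / (real n ^ k * \<Lambda> ^ n))) \<longlonglongrightarrow> real (C0 * K) * C"
        by (intro tendsto_mult_left lim')
      have "wlen tracker (m * n) [x0] / (real n ^ k * \<Lambda> ^ n) \<le> real (C0 * K) * (real (u n) / (real n ^ k * \<Lambda> ^ n))"
        if "n \<ge> 1" for n
      proof -
        have "length (morph_pow tracker (m * n) [x0]) \<le> C0 * (K * u n)"
          using order_trans[OF C0[of "m * n"] mult_le_mono2[OF le]] that by simp
        then have "wlen tracker (m * n) [x0] \<le> real (C0 * K) * real (u n)"
          by (metis mult.assoc of_nat_le_iff of_nat_mult)
        then show ?thesis using L by (simp add: divide_right_mono)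
      qed
      then show "\<exists>N. \<forall>n\<ge>N. wlen tracker (m * n) [x0] / (real n ^ k * \<Lambda> ^ n) \<le> real (C0 * K) * (real (u n) / (real n ^ k * \<Lambda> ^ n))"
        by blast
    qed
    then show "C > 0" using x0(2) by (smt (verit) mult_nonneg_nonpos of_nat_0_le_iff)
  qed
  define N where "N = card (UNIV :: 'a set)"
  define e where "e = (\<lambda>n. (pos ^^ (m * n)) 1)"
  define u0 where "u0 = (map Inl (map w [0..<1]) :: ('a + bool \<times> 'a) list)"
  have u0_letters: "set u0 \<subseteq> Inl ` range w" by (auto simp: u0_def)
  have lenu0: "length (morph_pow tracker n u0) = (pos ^^ n) 1" for n
    unfolding u0_def tracker_prefix by simp
  have elim: "(\<lambda>n. real (e n) / (real n ^ k * \<Lambda> ^ n)) \<longlonglongrightarrow> (\<Sum>x\<leftarrow>u0. c x)"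
  proof -
    have "set u0 \<subseteq> tracker_letters" by (auto simp: u0_def tracker_letters_def)
    then show ?thesis using lim[of u0 0] by (simp add: lenu0 e_def)
  qed
  have "(\<Sum>x\<leftarrow>u0. c x) > 0" by (rule lower[OF elim, of 1]) (simp add: e_def)
  then have ratio: "(\<lambda>n. real (e (Suc n)) / real (e n)) \<longlonglongrightarrow> \<Lambda>"
    using growth_ratio[OF elim _ L] by simp
  have epos: "e n > 0" for n using pos_iterate_ge[of "m * n"] by (simp add: e_def)
  define \<rho> where "\<rho> = 1 / \<Lambda>"
  have card_le: "card (Inl ` range w :: ('a + bool \<times> 'a) set) \<le> N"
  proof -
    have "card (Inl ` range w :: ('a + bool \<times> 'a) set) \<le> card (range w)" by (rule card_image_le) simp
    also have "\<dots> \<le> N" unfolding N_def by (rule card_mono) auto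
    finally show ?thesis .
  qed
  \<comment> \<open>The prefixes involve only unmarked letters, at most one for each letter of the
    original alphabet. This recurrence therefore has order at most \<open>N\<close>, and it gives
    the degree bound for \<rho>.\<close>
  obtain d i0 where d: "i0 \<le> N" "d i0 \<noteq> 0"
    "\<And>u n. set u \<subseteq> Inl ` range w \<Longrightarrow> (\<Sum>i\<le>N. d i * rat_of_nat (length (morph_pow tracker (m * i + n) u))) = 0"
    by (rule length_recurrence[OF finite card_le tracker_Inl_closed, where m = m]) (assumption, rule that)
  \<comment> \<open>The coefficients appear in reverse order because \<rho> is the reciprocal of
    \<Lambda>.\<close>
  define f where "f = (\<Sum>i\<le>N. monom (d i) (N - i))"
  have "(\<Sum>i\<le>N. of_rat (d i) * \<Lambda> ^ i) = 0"
  proof -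
    have pw: "(\<lambda>n. real (e (n + i)) / real (e n)) \<longlonglongrightarrow> \<Lambda> ^ i" for i
    proof (induction i)
      case 0
      then show ?case using epos by (simp add: less_imp_neq[THEN not_sym])
    next
      case (Suc i)
      have "(\<lambda>n. real (e (Suc (n + i))) / real (e (n + i)) * (real (e (n + i)) / real (e n))) \<longlonglongrightarrow> \<Lambda> * \<Lambda> ^ i"
        by (intro tendsto_mult Suc LIMSEQ_ignore_initial_segment[OF ratio, of i, simplified])
      moreover have "real (e (Suc (n + i))) / real (e (n + i)) * (real (e (n + i)) / real (e n)) = real (e (n + Suc i)) / real (e n)" for n
        using epos[of "n + i"] by simp
      ultimately show ?case by (simp only: power_Suc)
    qed
    have "(\<lambda>n. \<Sum>i\<le>N. of_rat (d i) * (real (e (n + i)) / real (e n))) \<longlonglongrightarrow> (\<Sum>i\<le>N. of_rat (d i) * \<Lambda> ^ i)"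
      by (intro tendsto_sum tendsto_mult_left pw)
    moreover have "(\<Sum>i\<le>N. of_rat (d i) * (real (e (n + i)) / real (e n))) = 0" for n
    proof -
      have "(\<Sum>i\<le>N. d i * rat_of_nat (e (n + i))) = 0"
        using d(3)[OF u0_letters, of "m * n"] by (simp add: lenu0 e_def distrib_left add.commute)
      then have "real_of_rat (\<Sum>i\<le>N. d i * rat_of_nat (e (n + i))) / real (e n) = 0" by simp
      then show ?thesis by (simp add: of_rat_sum of_rat_mult sum_divide_distrib)
    qed
    ultimately show ?thesis by (simp add: LIMSEQ_const_iff)
  qed
  moreover have "rpoly \<rho> f = \<rho> ^ N * (\<Sum>i\<le>N. of_rat (d i) * \<Lambda> ^ i)"
    unfolding f_def rpoly_sum sum_distrib_left
    by (intro sum.cong refl) (use L in \<open>simp add: \<rho>_def power_divide power_diff\<close>)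
  ultimately have f1: "rpoly \<rho> f = 0" by simp
  have "coeff f (N - i0) = (\<Sum>i\<le>N. if i = i0 then d i else 0)"
    unfolding f_def coeff_sum using d(1) by (intro sum.cong) auto
  then have f2: "f \<noteq> 0" using d(1,2) by auto
  have f3: "degree f \<le> N" unfolding f_def
    by (intro degree_sum_le) (auto intro: order_trans[OF degree_monom_le])
  have rat: "\<rho> \<in> \<rat>" if unif: "\<exists>l. \<forall>c. length (g c) = l"
  proof -
    obtain l where l: "\<And>c. length (g c) = l" using unif by blast
    \<comment> \<open>In the uniform case the iterated prefix has length l^n, so \<Lambda> is the
      integer l^m.\<close>
    have "pos t = l * t" for t by (simp add: pos_def l)
    then have "(pos ^^ n) 1 = l ^ n" for n by (induction n) auto
    then have "real (e (Suc n)) / real (e n) = real (l ^ m)" for n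
      using epos[of n] by (simp add: e_def power_add)
    then have "\<Lambda> = real (l ^ m)" using ratio by (simp add: LIMSEQ_const_iff)
    then show ?thesis by (simp add: \<rho>_def)
  qed
  have main: "\<exists>L. in_rational_field \<rho> L \<and>
      (\<lambda>n. real ((track Y False ^^ (m * n + r)) t) / real ((track Y True ^^ (m * n + r)) s)) \<longlonglongrightarrow> L"
    if gap: "gap Y s t" for s t r
  proof -
    define S where "S = (\<lambda>n. length (morph_pow tracker (m * n + r) (tracked_prefix True s)))"
    define T where "T = (\<lambda>n. length (morph_pow tracker (m * n + r) (tracked_prefix False t)))"
    have S: "S n = Suc ((track Y True ^^ (m * n + r)) s)" for n
      unfolding S_def tracker_tracked_prefix length_tracked_prefix ..
    have T: "T n = Suc ((track Y False ^^ (m * n + r)) t)" for n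
      unfolding T_def tracker_tracked_prefix length_tracked_prefix ..
    obtain C where limS: "(\<lambda>n. real (S n) / (real n ^ k * \<Lambda> ^ n)) \<longlonglongrightarrow> C"
      using lim[OF set_tracked_prefix, of r True s] unfolding S_def by blast
    obtain D where limT: "(\<lambda>n. real (T n) / (real n ^ k * \<Lambda> ^ n)) \<longlonglongrightarrow> D"
      using lim[OF set_tracked_prefix, of r False t] unfolding T_def by blast
    have C: "C > 0"
    proof (rule lower[OF limS, of max_image])
      fix n :: nat assume "n > 0"
      then have "(pos ^^ (m * n)) 1 \<le> max_image * (track Y True ^^ (m * n)) s"
        using m by (intro pos_iterate_le_track_mult[OF gap]) simp
      also have "\<dots> \<le> max_image * S n"
        using track_iterate_mono[OF gap, of "m * n" "m * n + r"] by (intro mult_le_mono2) (simp add: S)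
      finally show "(pos ^^ (m * n)) 1 \<le> max_image * S n" .
    qed
    \<comment> \<open>A recurrence common to both sequences of ends; it needs the whole enlarged
      alphabet, and its order does not enter the degree bound.\<close>
    obtain b j0 where b: "j0 \<le> card tracker_letters" "b j0 \<noteq> 0"
      "\<And>u n. set u \<subseteq> tracker_letters \<Longrightarrow>
        (\<Sum>i\<le>card tracker_letters. b i * rat_of_nat (length (morph_pow tracker (m * i + n) u))) = 0"
      by (rule length_recurrence[OF finite order_refl tracker_closed, where m = m]) (assumption, rule that)
    have "in_rational_field \<rho> (D / C)" unfolding \<rho>_def
    proof (rule growth_quotient_in_rational_field[where s = S and t = T and c = b, OF L limS C limT b(1,2)])
      show "(\<Sum>i\<le>card tracker_letters. b i * rat_of_nat (S (n + i))) = 0" for n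
        using b(3)[OF set_tracked_prefix, of "m * n + r" True s]
        by (simp add: S_def distrib_left add_ac)
      show "(\<Sum>i\<le>card tracker_letters. b i * rat_of_nat (T (n + i))) = 0" for n
        using b(3)[OF set_tracked_prefix, of "m * n + r" False t]
        by (simp add: T_def distrib_left add_ac)
    qed
    moreover have "(\<lambda>n. real ((track Y False ^^ (m * n + r)) t) / real ((track Y True ^^ (m * n + r)) s)) \<longlonglongrightarrow> D / C"
    proof (rule perturbed_quotient_tendsto[where K = 1])
      have "(\<lambda>n. (real (T n) / (real n ^ k * \<Lambda> ^ n)) / (real (S n) / (real n ^ k * \<Lambda> ^ n))) \<longlonglongrightarrow> D / C"
        by (intro tendsto_divide limS limT) (use C in simp)
      then show "(\<lambda>n. real (T n) / real (S n)) \<longlonglongrightarrow> D / C"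
        by (rule Lim_transform_eventually)
          (rule eventually_mono[OF eventually_gt_at_top[of 0]], use L in auto)
      have ge: "n \<le> S n" for n
      proof -
        have "n \<le> m * n + r" using m by (simp add: trans_le_add1)
        then show ?thesis using track_iterate_ge[OF gap, of "m * n + r"] by (simp add: S)
      qed
      show "filterlim (\<lambda>n. real (S n)) at_top sequentially"
        by (rule filterlim_at_top_mono[OF filterlim_real_sequentially]) (use ge in simp)
    qed (simp_all add: S T)
    ultimately show ?thesis by blast
  qed
  show ?thesis
    by (rule that[OF m f2 _ f1]) (use f3 rat main in \<open>auto simp: N_def\<close>)
qed

text \<open>A gap from \<open>s\<close> to \<open>t\<close> of the complement of \<Delta> encloses
  the block from \<open>s + 1\<close> to \<open>t - 1\<close>, which is nonempty iff
  \<open>s + 2\<close> is at most \<open>t\<close>. Long gaps are copies of late iterates of base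
  gaps, and all other gaps are of bounded length.\<close>

lemma gap_ratio_limsup:
  assumes XY: "\<And>c. c \<in> Y \<longleftrightarrow> marks X c \<noteq> {}" and m: "m > 0"
    and quot: "\<And>s t r. gap Y s t \<Longrightarrow> \<exists>L. in_rational_field \<rho> L \<and>
      (\<lambda>n. real ((track Y False ^^ (m * n + r)) t) / real ((track Y True ^^ (m * n + r)) s)) \<longlonglongrightarrow> L"
  obtains L where "in_rational_field \<rho> L" "L \<ge> 1"
    "\<And>e. e > 0 \<Longrightarrow> \<exists>N. \<forall>s t. gap X s t \<longrightarrow> N \<le> s \<longrightarrow> s + 2 \<le> t \<longrightarrow> real (t - 1) / real (s + 1) < L + e"
    "\<And>e N. L > 1 \<Longrightarrow> e > 0 \<Longrightarrow> \<exists>s t. gap X s t \<and> N \<le> s \<and> s + 2 \<le> t \<and> L - e < real (t - 1) / real (s + 1)"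
proof -
  obtain B where B: "finite B" "\<And>s t. (s, t) \<in> B \<Longrightarrow> gap Y s t"
    "\<And>s t q. gap Y s t \<Longrightarrow> pos q \<le> s \<Longrightarrow> t < pos (Suc q) \<Longrightarrow> \<exists>(s0, t0)\<in>B. recurs s0 t0 s t"
    by (rule finitely_many_base_gaps) (rule that)
  define S where "S = (\<lambda>(p :: nat \<times> nat) i. track X True ((track Y True ^^ i) (fst p)))"
  define T where "T = (\<lambda>(p :: nat \<times> nat) i. track X False ((track Y False ^^ i) (snd p)))"
  define R where "R = (\<lambda>p i. real (T p i - 1) / real (S p i + 1))"
  have ex_lim: "\<exists>L. in_rational_field \<rho> L \<and> (\<lambda>n. R p (m * n + r)) \<longlonglongrightarrow> L" if p: "p \<in> B" for p r
  proof -
    have gap: "gap Y (fst p) (snd p)" using B(2)[of "fst p" "snd p"] p by simp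
    \<comment> \<open>After i steps with marks \<open>Y\<close>, a last step with marks
      \<open>X\<close> ends in the same letter image as one with marks \<open>Y\<close>. Hence the
      index i + 1 and an error of at most \<open>max_image\<close>, plus 1 for the ends of the
      block.\<close>
    from quot[OF gap, of "Suc r"] obtain L where L: "in_rational_field \<rho> L"
      "(\<lambda>n. real ((track Y False ^^ (m * n + Suc r)) (snd p)) / real ((track Y True ^^ (m * n + Suc r)) (fst p))) \<longlonglongrightarrow> L"
      by blast
    have near: "track X b n \<le> track X' b n + max_image" for X X' b n
      using track_less[of X b n] pos_le_track[of n X' b] pos_Suc_le[of n] by linarith
    have "(\<lambda>n. R p (m * n + r)) \<longlonglongrightarrow> L" unfolding R_def
    proof (rule perturbed_quotient_tendsto[OF L(2), where K = "real max_image + 1"])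
      have "n \<le> (track Y True ^^ (m * n + Suc r)) (fst p)" for n
      proof -
        have "n \<le> m * n" using m by simp
        then show ?thesis using track_iterate_ge[OF gap, of "m * n + Suc r"] by linarith
      qed
      then show "filterlim (\<lambda>n. real ((track Y True ^^ (m * n + Suc r)) (fst p))) at_top sequentially"
        by (intro filterlim_at_top_mono[OF filterlim_real_sequentially]) simp
      show "\<bar>real (T p (m * n + r) - 1) - real ((track Y False ^^ (m * n + Suc r)) (snd p))\<bar> \<le> real max_image + 1" for n
        using near[of X False "(track Y False ^^ (m * n + r)) (snd p)" Y]
          near[of Y False "(track Y False ^^ (m * n + r)) (snd p)" X]
        by (simp add: T_def)
      show "\<bar>real (S p (m * n + r) + 1) - real ((track Y True ^^ (m * n + Suc r)) (fst p))\<bar> \<le> real max_image + 1" for n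
        using near[of X True "(track Y True ^^ (m * n + r)) (fst p)" Y]
          near[of Y True "(track Y True ^^ (m * n + r)) (fst p)" X]
        by (simp add: S_def)
    qed
    then show ?thesis using L(1) by blast
  qed
  have "\<forall>pr\<in>B \<times> {..<m}. \<exists>L. in_rational_field \<rho> L \<and> (\<lambda>n. R (fst pr) (m * n + snd pr)) \<longlonglongrightarrow> L"
  proof
    fix pr assume "pr \<in> B \<times> {..<m}"
    then have "fst pr \<in> B" by (rule mem_Times_iff[THEN iffD1, THEN conjunct1])
    then show "\<exists>L. in_rational_field \<rho> L \<and> (\<lambda>n. R (fst pr) (m * n + snd pr)) \<longlonglongrightarrow> L"
      by (rule ex_lim)
  qed
  from bchoice[OF this] obtain l where
    *: "\<forall>pr\<in>B \<times> {..<m}. in_rational_field \<rho> (l pr) \<and> (\<lambda>n. R (fst pr) (m * n + snd pr)) \<longlonglongrightarrow> l pr" ..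
  have l: "in_rational_field \<rho> (l pr)" "(\<lambda>n. R (fst pr) (m * n + snd pr)) \<longlonglongrightarrow> l pr"
    if "pr \<in> B \<times> {..<m}" for pr
    using bspec[OF * that] by (rule conjunct1, rule conjunct2)
  \<comment> \<open>The value 1 stands for gaps of bounded length far to the right; it also keeps
    the set nonempty.\<close>
  define I where "I = insert 1 (l ` (B \<times> {..<m}))"
  define L where "L = Max I"
  have finI: "finite I" using B(1) by (simp add: I_def)
  have LI: "L \<in> I" unfolding L_def using finI by (rule Max_in) (simp add: I_def)
  have Lge: "x \<le> L" if "x \<in> I" for x unfolding L_def using finI that by (rule Max_ge)
  have L1: "L \<ge> 1" using Lge by (simp add: I_def)
  show ?thesis
  proof (rule that[of L])
    show "in_rational_field \<rho> L" using LI l(1) in_rational_field_1 by (auto simp: I_def)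
    show "L \<ge> 1" by (rule L1)
    show "\<exists>N. \<forall>s t. gap X s t \<longrightarrow> N \<le> s \<longrightarrow> s + 2 \<le> t \<longrightarrow> real (t - 1) / real (s + 1) < L + e"
      if e: "e > 0" for e
    proof -
      have "\<forall>\<^sub>F n in sequentially. \<forall>pr\<in>B \<times> {..<m}. R (fst pr) (m * n + snd pr) < L + e"
      proof (intro eventually_ball_finite ballI)
        show "finite (B \<times> {..<m})" using B(1) by simp
        fix pr assume pr: "pr \<in> B \<times> {..<m}"
        have "l pr < L + e" using Lge[of "l pr"] pr e by (auto simp: I_def)
        then show "\<forall>\<^sub>F n in sequentially. R (fst pr) (m * n + snd pr) < L + e"
          by (rule order_tendstoD(2)[OF l(2)[OF pr]])
      qed
      then obtain n0 where n0: "\<forall>n\<ge>n0. \<forall>pr\<in>B \<times> {..<m}. R (fst pr) (m * n + snd pr) < L + e"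
        unfolding eventually_at_top_linorder ..
      have late: "R p i < L + e" if p: "p \<in> B" and i: "m * n0 \<le> i" for p i
      proof -
        have "n0 \<le> i div m" using div_le_mono[OF i, of m] m by simp
        moreover have "(p, i mod m) \<in> B \<times> {..<m}" using p m by simp
        ultimately have "R (fst (p, i mod m)) (m * (i div m) + snd (p, i mod m)) < L + e"
          using n0 by blast
        then show ?thesis by simp
      qed
      \<comment> \<open>A bound for the lengths of all gaps that lie inside one image or arise from
        fewer than \<open>m * n0\<close> iterations.\<close>
      define D where "D = Max (insert max_image ((\<lambda>(p, i). T p i - S p i) ` (B \<times> {..<m * n0})))"
      have finD: "finite (insert max_image ((\<lambda>(p, i). T p i - S p i) ` (B \<times> {..<m * n0})))"
        using B(1) by simp
      have D: "max_image \<le> D" "\<And>p i. p \<in> B \<Longrightarrow> i < m * n0 \<Longrightarrow> T p i - S p i \<le> D"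
        unfolding D_def by (rule Max_ge[OF finD], force)+
      obtain N where N: "real D / e < real N" using reals_Archimedean2 by blast
      have short: "real (t - 1) / real (s + 1) < L + e" if "N \<le> s" "t \<le> s + D" "s < t" for s t
      proof -
        have "real D < e * real s" using N e that(1) by (simp add: field_simps) (smt (verit) mult_left_mono of_nat_mono)
        then have "real (t - 1) < (1 + e) * real (s + 1)" using that e by (simp add: algebra_simps)
        also have "\<dots> \<le> (L + e) * real (s + 1)" using L1 by (intro mult_right_mono) auto
        finally show ?thesis by (simp add: pos_divide_less_eq)
      qed
      have "real (t - 1) / real (s + 1) < L + e" if g: "gap X s t" "N \<le> s" "s + 2 \<le> t" for s t
        using gap_preimage[OF XY g(1)]
      proof
        assume "\<exists>q. pos q \<le> s \<and> t < pos (Suc q)"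
        then obtain q where q: "pos q \<le> s" "t < pos (Suc q)" by blast
        then have "t \<le> s + D" using pos_Suc_le[of q] D(1) by linarith
        then show ?thesis using g by (intro short) auto
      next
        assume "\<exists>s0 t0. gap Y s0 t0 \<and> s = track X True s0 \<and> t = track X False t0"
        then obtain s0 t0 where st0: "gap Y s0 t0" "s = track X True s0" "t = track X False t0" by blast
        obtain s1 t1 i q where st1: "gap Y s1 t1" "pos q \<le> s1" "t1 < pos (Suc q)"
          "s0 = (track Y True ^^ i) s1" "t0 = (track Y False ^^ i) t1"
          using gap_descent[OF st0(1)] by blast
        obtain p where p: "p \<in> B" "recurs (fst p) (snd p) s1 t1" using B(3)[OF st1(1-3)] by auto
        have "recurs (S p i) (T p i) s t"
          unfolding S_def T_def st0 st1 by (intro recurs_track recurs_iterate p(2))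
        then have rc: "S p i \<le> s" "S p i < T p i" "T p i + s = t + S p i" by (auto simp: recurs_def)
        show ?thesis
        proof (cases "i < m * n0")
          case True
          have "t \<le> s + D" using D(2)[OF p(1) True] rc by linarith
          then show ?thesis using g by (intro short) auto
        next
          case False
          \<comment> \<open>The quotient is 1 + d / (s + 1), and the base copy has the same
            \<open>d\<close> and a left end no larger, hence a quotient at least as large.\<close>
          define d where "d = t - s - 2"
          have t: "t = s + d + 2" "T p i = S p i + d + 2" using g(3) rc by (auto simp: d_def)
          have "real (t - 1) / real (s + 1) = 1 + real d / real (s + 1)"
            by (simp add: t add_divide_distrib[symmetric] field_simps)
          also have "\<dots> \<le> 1 + real d / real (S p i + 1)"
            using rc(1) by (intro add_left_mono divide_left_mono) auto
          also have "\<dots> = R p i" by (simp add: R_def t add_divide_distrib[symmetric] field_simps)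
          also have "\<dots> < L + e" using False by (intro late p(1)) simp
          finally show ?thesis .
        qed
      qed
      then show ?thesis by blast
    qed
    show "\<exists>s t. gap X s t \<and> N \<le> s \<and> s + 2 \<le> t \<and> L - e < real (t - 1) / real (s + 1)"
      if L: "L > 1" and e: "e > 0" for e N
    proof -
      obtain p r where pr: "(p, r) \<in> B \<times> {..<m}" "L = l (p, r)" using LI L by (auto simp: I_def)
      have gap: "gap Y (fst p) (snd p)" using B(2)[of "fst p" "snd p"] pr by simp
      \<comment> \<open>A quotient above 1 guarantees that the gap encloses a nonempty
        block.\<close>
      have "\<forall>\<^sub>F n in sequentially. max 1 (L - e) < R p (m * n + r)"
        using order_tendstoD(1)[OF l(2)[OF pr(1)], of "max 1 (L - e)"] L e by (simp add: pr(2)[symmetric])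
      then have "\<forall>\<^sub>F n in sequentially. max 1 (L - e) < R p (m * n + r) \<and> N \<le> n"
        using eventually_ge_at_top by (rule eventually_conj)
      then obtain n where n: "max 1 (L - e) < R p (m * n + r)" "N \<le> n"
        by (auto simp: eventually_at_top_linorder)
      define i where "i = m * n + r"
      have "n \<le> i" using m by (simp add: i_def trans_le_add1)
      then have "N \<le> S p i"
        using n(2) track_iterate_ge[OF gap, of i] pos_le_track[of "(track Y True ^^ i) (fst p)" X True]
          pos_gt[of "(track Y True ^^ i) (fst p)"] by (cases "(track Y True ^^ i) (fst p) = 0") (auto simp: S_def)
      moreover have "gap X (S p i) (T p i)"
        unfolding S_def T_def by (intro gap_image[OF XY] gap_iterate gap)
      moreover have "R p i > 1" "R p i > L - e" using n(1) by (auto simp: i_def)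
      moreover from this(1) have "S p i + 2 \<le> T p i" by (simp add: R_def field_simps split: if_splits)
      ultimately show ?thesis unfolding R_def by blast
    qed
  qed
qed

end

section \<open>Fixed points and blocks\<close>

lemma prolongable_step:
  assumes "prolongable h a"
  shows "\<exists>v. v \<noteq> [] \<and> morph_pow h (Suc n) [a] = morph_pow h n [a] @ v"
proof -
  obtain x where x: "h a = a # x" "\<And>n. morph_pow h n x \<noteq> []"
    using assms by (auto simp: prolongable_def)
  have "morph_pow h (Suc n) [a] = morph_pow h n ([a] @ x)" using x(1) by (simp add: morph_pow_Suc)
  then show ?thesis using x(2) by (auto simp only: morph_pow_append)
qed

lemma less_length_prolongable:
  assumes "prolongable h a"
  shows "n < length (morph_pow h n [a])"
proof (induction n)
  case (Suc n)
  obtain v where "v \<noteq> []" "morph_pow h (Suc n) [a] = morph_pow h n [a] @ v"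
    using prolongable_step[OF assms] by blast
  then show ?case using Suc by (cases v) auto
qed simp

lemma prolongable_prefix:
  assumes "prolongable h a" "n \<le> n'"
  shows "\<exists>v. morph_pow h n' [a] = morph_pow h n [a] @ v"
  using assms(2)
proof (induction n' rule: dec_induct)
  case (step n')
  then show ?case using prolongable_step[OF assms(1), of n'] by auto
qed simp

lemma nth_morph_pow_prolongable:
  assumes "prolongable h a" "p < length (morph_pow h n [a])"
  shows "morph_pow h n [a] ! p = fixpt h a p"
proof -
  obtain v where v: "morph_pow h (max n (Suc p)) [a] = morph_pow h n [a] @ v"
    using prolongable_prefix[OF assms(1), of n "max n (Suc p)"] by auto
  obtain u where u: "morph_pow h (max n (Suc p)) [a] = morph_pow h (Suc p) [a] @ u"
    using prolongable_prefix[OF assms(1), of "Suc p" "max n (Suc p)"] by auto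
  have "p < length (morph_pow h (Suc p) [a])" using less_length_prolongable[OF assms(1), of "Suc p"] by simp
  then have "fixpt h a p = morph_pow h (max n (Suc p)) [a] ! p" by (simp only: fixpt_def u nth_append if_True)
  also have "\<dots> = morph_pow h n [a] ! p" using assms(2) by (simp only: v nth_append if_True)
  finally show ?thesis ..
qed

lemma fixpt_self_similar:
  fixes h :: "'a \<Rightarrow> 'a list"
  assumes h: "nonerasing h" "prolongable h a" and m: "m > 0"
  shows "self_similar_word (\<lambda>c. morph_pow h m [c]) (fixpt h a)"
proof
  let ?w = "fixpt h a" and ?g = "\<lambda>c. morph_pow h m [c]"
  show "?g c \<noteq> []" for c
    using h(1) by (intro morph_pow_nonempty[of UNIV]) (auto simp: nonerasing_def)
  have "?w 0 = a" using nth_morph_pow_prolongable[OF h(2), of 0 0] by simp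
  then show "2 \<le> length (?g (?w 0))" using less_length_prolongable[OF h(2), of m] m by simp
  show "?w ((\<Sum>r<s. length (?g (?w r))) + p) = ?g (?w s) ! p" if p: "p < length (?g (?w s))" for p s
  proof -
    \<comment> \<open>A prefix of the fixed point that is long enough to contain position
      \<open>s\<close>; its image under the m-th power is again a prefix.\<close>
    define u where "u = morph_pow h (Suc s) [a]"
    have len: "s < length u" using less_length_prolongable[OF h(2), of "Suc s"] by (simp add: u_def)
    have pre: "take s u = map ?w [0..<s]" "u ! s = ?w s"
      using len nth_morph_pow_prolongable[OF h(2), of _ "Suc s"]
      by (auto intro!: nth_equalityI simp: u_def)
    define v where "v = drop (Suc s) u"
    have "u = take s u @ [u ! s] @ v"
      using id_take_nth_drop[OF len] by (simp add: v_def)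
    from arg_cong[OF this, of "morph_pow h m"]
    have "morph_pow h m u = morph_pow h m (map ?w [0..<s]) @ ?g (?w s) @ morph_pow h m v"
      unfolding morph_pow_append pre .
    moreover have "length (morph_pow h m (map ?w [0..<s])) = (\<Sum>r<s. length (?g (?w r)))"
      by (subst length_morph_pow) (simp add: comp_def interv_sum_list_conv_sum_set_nat atLeast0LessThan)
    ultimately have "(\<Sum>r<s. length (?g (?w r))) + p < length (morph_pow h m u)"
      "morph_pow h m u ! ((\<Sum>r<s. length (?g (?w r))) + p) = ?g (?w s) ! p"
      using p by (auto simp: nth_append)
    moreover have "morph_pow h m u = morph_pow h (m + Suc s) [a]" by (simp only: u_def morph_pow_add)
    ultimately show ?thesis
      using nth_morph_pow_prolongable[OF h(2), of "(\<Sum>r<s. length (?g (?w r))) + p" "m + Suc s"] by simp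
  qed
qed

section \<open>Maximal blocks and their limit superior\<close>

lemma infinite_block_starts:
  assumes "infinite {n. w n \<notin> D}" "\<forall>m. \<exists>i. \<forall>t<m. w (i + t) \<in> D"
  shows "infinite (block_starts w D)"
  unfolding infinite_nat_iff_unbounded
proof
  fix N
  obtain p where p: "p > N" "w p \<notin> D" using assms(1) by (auto simp: infinite_nat_iff_unbounded)
  \<comment> \<open>A block of length p + 2 reaches beyond position \<open>p\<close> wherever it
    begins. The first letter of \<open>D\<close> after \<open>p\<close> then starts a maximal
    block.\<close>
  obtain i where i: "\<forall>t<p + 2. w (i + t) \<in> D" using assms(2) by blast
  have ex: "p < i + Suc p \<and> w (i + Suc p) \<in> D" using i[rule_format, of "Suc p"] by simp
  define s where "s = (LEAST s. p < s \<and> w s \<in> D)"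
  have s: "p < s" "w s \<in> D" using LeastI[of "\<lambda>s. p < s \<and> w s \<in> D", OF ex] by (auto simp: s_def)
  have "w (s - 1) \<notin> D"
  proof (cases "s - 1 = p")
    case False
    then have "p < s - 1" "s - 1 < s" using s by auto
    then show ?thesis using not_less_Least[of "s - 1" "\<lambda>s. p < s \<and> w s \<in> D"] by (simp add: s_def)
  qed (use p in simp)
  then show "\<exists>n>N. n \<in> block_starts w D" using s p by (intro exI[of _ s]) (auto simp: block_starts_def)
qed

lemma block_end_props:
  assumes "infinite {n. w n \<notin> D}"
  shows "block_start w D k \<le> block_end w D k" "w (Suc (block_end w D k)) \<notin> D"
    "\<And>r. block_start w D k \<le> r \<Longrightarrow> r < block_end w D k \<Longrightarrow> w (Suc r) \<in> D"
proof -
  obtain n where "n > block_start w D k" "w n \<notin> D"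
    using assms by (auto simp: infinite_nat_iff_unbounded)
  then have ex: "block_start w D k \<le> n - 1 \<and> w (Suc (n - 1)) \<notin> D" by simp
  show "block_start w D k \<le> block_end w D k" "w (Suc (block_end w D k)) \<notin> D"
    using LeastI[of "\<lambda>j. block_start w D k \<le> j \<and> w (Suc j) \<notin> D", OF ex] by (auto simp: block_end_def)
  show "w (Suc r) \<in> D" if "block_start w D k \<le> r" "r < block_end w D k" for r
    using not_less_Least[of r "\<lambda>j. block_start w D k \<le> j \<and> w (Suc j) \<notin> D"] that
    unfolding block_end_def by blast
qed

lemma limsup_eqI:
  fixes f :: "nat \<Rightarrow> real"
  assumes "\<And>e. e > 0 \<Longrightarrow> \<forall>\<^sub>F n in sequentially. f n \<le> L + e"
    "\<And>e. e > 0 \<Longrightarrow> \<exists>\<^sub>F n in sequentially. L - e < f n"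
  shows "limsup (\<lambda>n. ereal (f n)) = ereal L"
proof (rule antisym)
  show "limsup (\<lambda>n. ereal (f n)) \<le> ereal L"
  proof (rule ereal_le_epsilon2)
    fix e :: real assume "e > 0"
    then show "limsup (\<lambda>n. ereal (f n)) \<le> ereal L + ereal e"
      using assms(1) by (intro Limsup_bounded) simp
  qed
  show "ereal L \<le> limsup (\<lambda>n. ereal (f n))"
  proof (rule ccontr)
    assume "\<not> ?thesis"
    then have "limsup (\<lambda>n. ereal (f n)) < ereal L" by (rule not_le_imp_less)
    from ereal_dense2[OF this] obtain z where z: "limsup (\<lambda>n. ereal (f n)) < ereal z" "ereal z < ereal L"
      by (elim exE conjE)
    have "\<forall>\<^sub>F n in sequentially. \<not> z < f n"
      using Limsup_lessD[OF z(1)] by (rule eventually_mono) simp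
    moreover have "\<exists>\<^sub>F n in sequentially. L - (L - z) < f n" using z(2) by (intro assms(2)) simp
    ultimately show False by (simp add: frequently_def)
  qed
qed

theorem theorem8:
  fixes h :: "'a::finite \<Rightarrow> 'a list" and a :: 'a and D :: "'a set"
  assumes "nonerasing h"
    and "prolongable h a"
    and "D \<noteq> {}" and "D \<noteq> UNIV"
    and "infinite {n. fixpt h a n \<notin> D}"
    and "\<forall>m. \<exists>i. \<forall>t<m. fixpt h a (i + t) \<in> D"
  shows "\<exists>L::real.
           limsup (\<lambda>k. ereal (real (block_end (fixpt h a) D k) / real (block_start (fixpt h a) D k)))
             = ereal L
           \<and> algebraic_deg_le L (card (UNIV :: 'a set))
           \<and> (uniform_morph h \<longrightarrow> L \<in> \<rat>)"
proof -
  define w where "w = fixpt h a"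
  obtain m where m: "m > 0"
    "\<And>x. (\<Union>y\<in>set (morph_pow h m [x]). set (morph_pow h m [y])) = set (morph_pow h m [x])"
    using idempotent_letter_sets[of h] by blast
  define g where "g = (\<lambda>c. morph_pow h m [c])"
  interpret ssw: self_similar_word g w
    unfolding g_def w_def by (rule fixpt_self_similar[OF assms(1,2) m(1)])
  define Y where "Y = {c. ssw.marks (- D) c \<noteq> {}}"
  have marks: "ssw.marks X c \<noteq> {} \<longleftrightarrow> set (g c) \<inter> X \<noteq> {}" for X c
    by (auto simp: ssw.marks_def set_conv_nth)
  have Y: "c \<in> Y \<longleftrightarrow> set (g c) \<inter> - D \<noteq> {}" for c unfolding Y_def mem_Collect_eq marks ..
  have XY: "c \<in> Y \<longleftrightarrow> ssw.marks (- D) c \<noteq> {}" for c by (simp add: Y_def)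
  \<comment> \<open>Idempotence of the letter sets is used here: the letters of the images of the
    letters of \<open>g c\<close> are exactly those of \<open>g c\<close>.\<close>
  have "c \<in> Y \<longleftrightarrow> ssw.marks Y c \<noteq> {}" for c
  proof -
    have "ssw.marks Y c \<noteq> {} \<longleftrightarrow> (\<exists>d\<in>set (g c). d \<in> Y)" unfolding marks by blast
    also have "\<dots> \<longleftrightarrow> (\<Union>d\<in>set (g c). set (g d)) \<inter> - D \<noteq> {}" unfolding Y by blast
    also have "\<dots> \<longleftrightarrow> c \<in> Y" unfolding Y g_def m(2) ..
    finally show ?thesis ..
  qed
  moreover have "infinite {n. w n \<in> Y}"
    by (rule ssw.infinite_preimage[OF XY]) (use assms(5) in \<open>simp add: w_def\<close>)
  ultimately interpret marked_word g w Y by unfold_locales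
  obtain p \<rho> f where q: "p > 0" "f \<noteq> 0" "degree f \<le> card (UNIV :: 'a set)" "rpoly \<rho> f = 0"
    "\<exists>l. \<forall>c. length (g c) = l \<Longrightarrow> \<rho> \<in> \<rat>"
    "\<And>s t r. ssw.gap Y s t \<Longrightarrow> \<exists>L. in_rational_field \<rho> L \<and>
      (\<lambda>n. real ((ssw.track Y False ^^ (p * n + r)) t) / real ((ssw.track Y True ^^ (p * n + r)) s)) \<longlonglongrightarrow> L"
    by (rule iterated_gap_quotients) (rule that)
  obtain L where L: "in_rational_field \<rho> L" "L \<ge> 1"
    "\<And>e. e > 0 \<Longrightarrow> \<exists>N. \<forall>s t. ssw.gap (- D) s t \<longrightarrow> N \<le> s \<longrightarrow> s + 2 \<le> t \<longrightarrow> real (t - 1) / real (s + 1) < L + e"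
    "\<And>e N. L > 1 \<Longrightarrow> e > 0 \<Longrightarrow> \<exists>s t. ssw.gap (- D) s t \<and> N \<le> s \<and> s + 2 \<le> t \<and> L - e < real (t - 1) / real (s + 1)"
    by (rule gap_ratio_limsup[OF XY q(1,6)]) (assumption, rule that)
  define i where "i = block_start w D"
  define j where "j = block_end w D"
  have infD: "infinite {n. w n \<notin> D}" using assms(5) by (simp add: w_def)
  have infs: "infinite (block_starts w D)"
    using infinite_block_starts[OF infD] assms(6) by (simp add: w_def)
  have i_in: "i k \<in> block_starts w D" for k
    unfolding i_def block_start_def by (rule enumerate_in_set[OF infs])
  have i_ge: "k \<le> i k" for k unfolding i_def block_start_def by (rule le_enumerate[OF infs])
  note j = block_end_props[OF infD, folded i_def j_def]
  \<comment> \<open>The block of index 0 may start at position 0 and then has no letter before it,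
    so it need not come from a gap.\<close>
  have block_gap: "ssw.gap (- D) (i k - 1) (Suc (j k))" if k: "k > 0" for k
  proof -
    have i0: "i k > 0" using i_ge[of k] k by simp
    have "w r \<in> D" if "i k - 1 < r" "r < Suc (j k)" for r
    proof (cases "r = i k")
      case True then show ?thesis using i_in[of k] by (simp add: block_starts_def)
    next
      case False
      then show ?thesis using j(3)[of k "r - 1"] that i0 by simp
    qed
    then show ?thesis using i_in[of k] i0 j(1,2)[of k] by (auto simp: ssw.gap_def block_starts_def)
  qed
  have "limsup (\<lambda>k. ereal (real (j k) / real (i k))) = ereal L"
  proof (rule limsup_eqI)
    fix e :: real assume e: "e > 0"
    obtain N where N: "\<And>s t. ssw.gap (- D) s t \<Longrightarrow> N \<le> s \<Longrightarrow> s + 2 \<le> t \<Longrightarrow> real (t - 1) / real (s + 1) < L + e"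
      using L(3)[OF e] by blast
    have "real (j k) / real (i k) \<le> L + e" if k: "k > N" for k
    proof -
      have "N \<le> i k - 1" using i_ge[of k] k by linarith
      then show ?thesis using N[OF block_gap[of k]] i_ge[of k] j(1)[of k] k by simp
    qed
    then show "\<forall>\<^sub>F k in sequentially. real (j k) / real (i k) \<le> L + e"
      by (rule eventually_mono[OF eventually_gt_at_top[of N]])
    have frequent: "\<exists>k>k0. L - e < real (j k) / real (i k)" for k0
    proof (cases "L > 1")
      case True
      \<comment> \<open>The start of the resulting block lies beyond \<open>i (Suc k0)\<close>, so
        its index exceeds \<open>k0\<close> because the enumeration increases.\<close>
      obtain s t where st: "ssw.gap (- D) s t" "i (Suc k0) \<le> s" "s + 2 \<le> t" "L - e < real (t - 1) / real (s + 1)"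
        using L(4)[OF True e] by blast
      have ws: "w s \<notin> D" "w t \<notin> D" "\<And>r. s < r \<Longrightarrow> r < t \<Longrightarrow> w r \<in> D" using st(1) by (auto simp: ssw.gap_def)
      then have "s + 1 \<in> block_starts w D" using st(3) by (simp add: block_starts_def)
      then obtain k where k: "i k = s + 1" unfolding i_def block_start_def using enumerate_Ex[OF infs] by metis
      then have "i (Suc k0) < i k" using st(2) by simp
      then have "k > k0" unfolding i_def block_start_def using infs by simp
      moreover have jk: "j k = t - 1"
      proof (rule antisym)
        show "j k \<le> t - 1"
        proof (rule ccontr)
          assume "\<not> j k \<le> t - 1"
          then have "w (Suc (t - 1)) \<in> D" using j(3)[of k "t - 1"] k st(3) by linarith
          then show False using ws(2) st(3) by simp
        qed
        show "t - 1 \<le> j k"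
        proof (rule ccontr)
          assume "\<not> t - 1 \<le> j k"
          then have "w (Suc (j k)) \<in> D" using j(1)[of k] k by (intro ws(3)) linarith+
          then show False using j(2) by blast
        qed
      qed
      ultimately show ?thesis using st(4) unfolding k[symmetric] jk[symmetric] by blast
    next
      case False
      \<comment> \<open>Every block ends no earlier than it starts, so its quotient is at least 1
        and already exceeds L - e.\<close>
      then have "L = 1" using L(2) by simp
      moreover have "1 \<le> real (j (Suc k0)) / real (i (Suc k0))"
        using j(1)[of "Suc k0"] i_ge[of "Suc k0"] by simp
      ultimately show ?thesis using e by (intro exI[of _ "Suc k0"]) auto
    qed
    then show "\<exists>\<^sub>F k in sequentially. L - e < real (j k) / real (i k)"
      unfolding frequently_def eventually_at_top_linorder by (meson frequent less_imp_le)
  qed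
  moreover have "algebraic_deg_le L (card (UNIV :: 'a set))"
    by (rule in_rational_field_algebraic[OF L(1) q(2-4)])
  moreover have "L \<in> \<rat>" if unif: "uniform_morph h"
  proof -
    obtain l where l: "\<And>c. length (h c) = l" using unif unfolding uniform_morph_def by blast
    have "length (morph_pow h n u) = l ^ n * length u" for n u
    proof (induction n arbitrary: u)
      case (Suc n)
      have "length (morph h u) = l * length u" by (induction u) (auto simp: l)
      then show ?case using Suc by (simp add: morph_pow_Suc)
    qed simp
    then have "length (g c) = l ^ m" for c by (simp add: g_def)
    then have "\<rho> \<in> \<rat>" using q(5) by blast
    then show ?thesis by (rule in_rational_field_Rats[OF L(1)])
  qed
  ultimately show ?thesis unfolding i_def j_def w_def by (intro exI[of _ L] conjI impI)
qed

end
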